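(* Let $X=\{x_1,\dots,x_n\}$. Given a homogeneous depth-three $\Sigma^{[s]}\Pi^{[k]}\Sigma$ circuit of degree $k$ computing $f\in\mathbb{F}[X]$: (i) the sum of the coefficients of all degree-$k$ multilinear monomials of $f$ can be computed deterministically in $O^*(2^k)$ time; (ii) over $\mathbb{F}=\mathbb{Z}$, whether $f$ has a nonzero degree-$k$ multilinear monomial can be decided deterministically in $O^*(4^k)$ time; (iii) over finite fields, whether $f$ has a nonzero degree-$k$ multilinear monomial can be decided deterministically in time $e^k k^{O(\log k)}(2^{ck}+2^k)\cdot\mathrm{poly}(n,k,s)$ for some constant $c\le 5$.
   Context: A $\Sigma^{[s]}\Pi^{[k]}\Sigma$ circuit computes a polynomial of the form $\sum_{i=1}^{s}\prod_{j=1}^{k}L_{i,j}$ where each $L_{i,j}$ is a homogeneous linear form in $X$. A monomial is multilinear if every variable has exponent at most $1$. $O^*(\cdot)$ suppresses factors polynomial in $n,k,s$. The field $\mathbb{F}$ is one in which arithmetic is efficiently computable. *)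

theory Defs
  imports Complex_Main "HOL-Algebra.Indexed_Polynomials" "HOL-Algebra.IntRing" "HOL-Library.Log_Nat"
begin

section \<open>The polynomial ring in the variables \<open>x\<^sub>0, \<dots>, x\<^sub>n\<^sub>-\<^sub>1\<close>\<close>

text \<open>
  As in \<^theory>\<open>HOL-Algebra.Indexed_Polynomials\<close>, a monomial is a multiset of variables and a
  polynomial maps each monomial to its coefficient. That theory multiplies only by single variables;
  the product of two polynomials is the convolution.
\<close>

definition mpoly_mult ::
    "('a, 'm) ring_scheme \<Rightarrow> (nat multiset \<Rightarrow> 'a) \<Rightarrow> (nat multiset \<Rightarrow> 'a) \<Rightarrow> (nat multiset \<Rightarrow> 'a)" where
  "mpoly_mult R p q = (\<lambda>m. \<Oplus>\<^bsub>R\<^esub>a\<in>{a. a \<subseteq># m}. p a \<otimes>\<^bsub>R\<^esub> q (m - a))"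

definition MPoly :: "('a, 'm) ring_scheme \<Rightarrow> nat \<Rightarrow> (nat multiset \<Rightarrow> 'a) ring" where
  "MPoly R n =
    \<lparr>carrier = {p. (\<forall>m. p m \<in> carrier R) \<and> finite {m. p m \<noteq> \<zero>\<^bsub>R\<^esub>} \<and>
                   (\<forall>m. p m \<noteq> \<zero>\<^bsub>R\<^esub> \<longrightarrow> set_mset m \<subseteq> {..<n})},
     monoid.mult = mpoly_mult R,
     one = ring.indexed_const R \<one>\<^bsub>R\<^esub>,
     zero = ring.indexed_const R \<zero>\<^bsub>R\<^esub>,
     add = ring.indexed_padd R\<rparr>"


lemma (in abelian_monoid) finsum_Sigma_eq:
  assumes "finite A" "\<And>a. a \<in> A \<Longrightarrow> finite (B a)"
    and "\<And>a b. a \<in> A \<Longrightarrow> b \<in> B a \<Longrightarrow> g a b \<in> carrier G"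
  shows "(\<Oplus>a\<in>A. \<Oplus>b\<in>B a. g a b) = (\<Oplus>x\<in>Sigma A B. g (fst x) (snd x))"
  using assms
proof (induction A)
  case (insert a A)
  have inj: "inj_on (Pair a) (B a)" by (simp add: inj_on_def)
  have eq: "Sigma (insert a A) B = Pair a ` B a \<union> Sigma A B" by auto
  have "(\<Oplus>x\<in>Sigma (insert a A) B. g (fst x) (snd x)) =
      (\<Oplus>x\<in>Pair a ` B a. g (fst x) (snd x)) \<oplus> (\<Oplus>x\<in>Sigma A B. g (fst x) (snd x))"
    unfolding eq using insert by (intro finsum_Un_disjoint) auto
  also have "(\<Oplus>x\<in>Pair a ` B a. g (fst x) (snd x)) = (\<Oplus>b\<in>B a. g a b)"
    using insert inj by (subst finsum_reindex) auto
  finally show ?case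
    using insert by (subst finsum_insert) (auto intro!: finsum_closed)
qed simp

lemma finite_submultisets: "finite {a. a \<subseteq># (m :: 'c multiset)}"
proof (induction m)
  case (add x m)
  have "{a. a \<subseteq># add_mset x m} \<subseteq> {a. a \<subseteq># m} \<union> add_mset x ` {a. a \<subseteq># m}"
  proof
    fix a assume a: "a \<in> {a. a \<subseteq># add_mset x m}"
    show "a \<in> {a. a \<subseteq># m} \<union> add_mset x ` {a. a \<subseteq># m}"
    proof (cases "x \<in># a")
      case True
      then obtain b where b: "a = add_mset x b" by (rule mset_add)
      with a show ?thesis by auto
    next
      case False
      have "count a y \<le> count m y" for y
        using a False mset_subset_eq_count[of a "add_mset x m" y]
        by (cases "y = x") (auto simp: not_in_iff)
      then show ?thesis by (simp add: mset_subset_eqI)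
    qed
  qed
  then show ?case using add finite_subset by blast
qed simp

lemma submultiset_diff_diff: "a \<subseteq># m \<Longrightarrow> m - (m - a) = (a :: 'c multiset)"
  by (auto simp: mset_subset_eq_exists_conv)

lemma (in cring) mpoly_mult_comm:
  assumes "\<And>m. p m \<in> carrier R" "\<And>m. q m \<in> carrier R"
  shows "mpoly_mult R p q = mpoly_mult R q p"
proof
  fix m :: "nat multiset"
  let ?S = "{a. a \<subseteq># m}"
  have inj: "inj_on (\<lambda>a. m - a) ?S"
    by (rule inj_on_inverseI[where g = "\<lambda>a. m - a"]) (simp add: submultiset_diff_diff)
  have im: "(\<lambda>a. m - a) ` ?S = ?S"
  proof
    show "?S \<subseteq> (\<lambda>a. m - a) ` ?S"
    proof
      fix a assume "a \<in> ?S"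
      then show "a \<in> (\<lambda>a. m - a) ` ?S"
        by (intro image_eqI[where x = "m - a"]) (simp_all add: submultiset_diff_diff)
    qed
  qed auto
  have "mpoly_mult R p q m = (\<Oplus>a\<in>(\<lambda>a. m - a) ` ?S. p a \<otimes> q (m - a))"
    by (simp add: mpoly_mult_def im)
  also have "\<dots> = (\<Oplus>a\<in>?S. p (m - a) \<otimes> q (m - (m - a)))"
    using assms inj by (subst finsum_reindex) auto
  also have "\<dots> = (\<Oplus>a\<in>?S. q a \<otimes> p (m - a))"
    using assms by (intro finsum_cong') (auto simp: submultiset_diff_diff m_comm)
  finally show "mpoly_mult R p q m = mpoly_mult R q p m"
    by (simp add: mpoly_mult_def)
qed

lemma (in cring) mpoly_mult_closed:
  assumes "\<And>m. p m \<in> carrier R" "\<And>m. q m \<in> carrier R"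
  shows "mpoly_mult R p q m \<in> carrier R"
  unfolding mpoly_mult_def using assms by (intro finsum_closed) auto

lemma (in cring) mpoly_mult_assoc:
  assumes p: "\<And>m. p m \<in> carrier R" and q: "\<And>m. q m \<in> carrier R" and r: "\<And>m. r m \<in> carrier R"
  shows "mpoly_mult R (mpoly_mult R p q) r = mpoly_mult R p (mpoly_mult R q r)"
proof
  fix m :: "nat multiset"
  let ?A = "SIGMA a:{a. a \<subseteq># m}. {b. b \<subseteq># a}"
  let ?B = "SIGMA b:{b. b \<subseteq># m}. {c. c \<subseteq># m - b}"
  let ?g = "\<lambda>(b, c). p b \<otimes> (q c \<otimes> r (m - b - c))"
  let ?h = "\<lambda>(a, b). (b, a - b)"
  have img: "?h ` ?A = ?B"
  proof
    show "?h ` ?A \<subseteq> ?B"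
      by (auto simp: subseteq_mset_def diff_le_mono intro: le_trans)
    show "?B \<subseteq> ?h ` ?A"
    proof
      fix x assume "x \<in> ?B"
      then obtain b c where x: "x = (b, c)" and bc: "b \<subseteq># m" "c \<subseteq># m - b" by auto
      then have "b + c \<subseteq># m"
        by (simp add: subset_mset.le_diff_conv2 add.commute)
      then show "x \<in> ?h ` ?A"
        by (intro image_eqI[where x = "(b + c, b)"]) (auto simp: x)
    qed
  qed
  have inj: "inj_on ?h ?A"
  proof (rule inj_onI)
    fix x y assume "x \<in> ?A" "y \<in> ?A" "?h x = ?h y"
    then obtain b d c e where "x = (b + c, b)" "y = (d + e, d)" "(b, c) = (d, e)"
      by (auto simp: mset_subset_eq_exists_conv)
    then show "x = y" by simp
  qed
  have "mpoly_mult R (mpoly_mult R p q) r m =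
      (\<Oplus>a\<in>{a. a \<subseteq># m}. \<Oplus>b\<in>{b. b \<subseteq># a}. (p b \<otimes> q (a - b)) \<otimes> r (m - a))"
    unfolding mpoly_mult_def using p q r
    by (intro finsum_cong') (auto simp: finsum_ldistr finite_submultisets)
  also have "\<dots> = (\<Oplus>x\<in>?A. (p (snd x) \<otimes> q (fst x - snd x)) \<otimes> r (m - fst x))"
    using p q r by (intro finsum_Sigma_eq) (auto simp: finite_submultisets)
  also have "\<dots> = (\<Oplus>x\<in>?A. ?g (?h x))"
    using p q r by (intro finsum_cong') (auto simp: m_assoc)
  also have "\<dots> = (\<Oplus>x\<in>?h ` ?A. ?g x)"
    using p q r inj by (subst finsum_reindex) auto
  also have "\<dots> = (\<Oplus>x\<in>?B. p (fst x) \<otimes> (q (snd x) \<otimes> r (m - fst x - snd x)))"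
    unfolding img by (simp add: case_prod_beta)
  also have "\<dots> = (\<Oplus>b\<in>{b. b \<subseteq># m}. \<Oplus>c\<in>{c. c \<subseteq># m - b}. p b \<otimes> (q c \<otimes> r (m - b - c)))"
    using p q r
    by (subst finsum_Sigma_eq[where g = "\<lambda>b c. p b \<otimes> (q c \<otimes> r (m - b - c))"])
       (auto simp: finite_submultisets)
  also have "\<dots> = mpoly_mult R p (mpoly_mult R q r) m"
    unfolding mpoly_mult_def using p q r
    by (intro finsum_cong') (auto simp: finsum_rdistr finite_submultisets)
  finally show "mpoly_mult R (mpoly_mult R p q) r m = mpoly_mult R p (mpoly_mult R q r) m" .
qed

lemma (in cring) mpoly_mult_one:
  assumes "\<And>m. p m \<in> carrier R"
  shows "mpoly_mult R (indexed_const \<one>) p = p"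
proof
  fix m
  have "mpoly_mult R (indexed_const \<one>) p m =
      (\<Oplus>a\<in>{a. a \<subseteq># m}. if {#} = a then p (m - a) else \<zero>)"
    unfolding mpoly_mult_def indexed_const_def using assms by (intro finsum_cong') auto
  also have "\<dots> = p (m - {#})"
    using assms by (subst finsum_singleton) (auto simp: finite_submultisets)
  finally show "mpoly_mult R (indexed_const \<one>) p m = p m" by simp
qed

lemma (in cring) mpoly_mult_nonzeroE:
  assumes "\<And>m. p m \<in> carrier R" "\<And>m. q m \<in> carrier R" "mpoly_mult R p q m \<noteq> \<zero>"
  obtains a b where "m = a + b" "p a \<noteq> \<zero>" "q b \<noteq> \<zero>"
proof (rule ccontr)
  assume not: "\<not> thesis"
  have "p a \<otimes> q (m - a) = \<zero>" if "a \<subseteq># m" for a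
  proof (cases "p a = \<zero> \<or> q (m - a) = \<zero>")
    case True
    then show ?thesis using assms(1)[of a] assms(2)[of "m - a"] by auto
  next
    case False
    moreover have "m = a + (m - a)" using that by simp
    ultimately show ?thesis using not \<open>\<And>a b. m = a + b \<Longrightarrow> p a \<noteq> \<zero> \<Longrightarrow> q b \<noteq> \<zero> \<Longrightarrow> thesis\<close> by blast
  qed
  then have "mpoly_mult R p q m = (\<Oplus>a\<in>{a. a \<subseteq># m}. \<zero>)"
    unfolding mpoly_mult_def by (intro finsum_cong') auto
  with assms(3) show False by simp
qed

lemma (in cring) MPoly_cring: "cring (MPoly R n)"
proof (rule cringI)
  let ?P = "MPoly R n"
  have inR: "p m \<in> carrier R" if "p \<in> carrier ?P" for p m
    using that by (simp add: MPoly_def)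
  have mult_closed: "mpoly_mult R p q \<in> carrier ?P" if pq: "p \<in> carrier ?P" "q \<in> carrier ?P" for p q
  proof -
    have "{m. mpoly_mult R p q m \<noteq> \<zero>} \<subseteq>
        (\<lambda>(a, b). a + b) ` ({a. p a \<noteq> \<zero>} \<times> {b. q b \<noteq> \<zero>})"
    proof
      fix m assume "m \<in> {m. mpoly_mult R p q m \<noteq> \<zero>}"
      then have nz: "mpoly_mult R p q m \<noteq> \<zero>" by simp
      obtain a b where "m = a + b" "p a \<noteq> \<zero>" "q b \<noteq> \<zero>"
        using mpoly_mult_nonzeroE[OF inR[OF pq(1)] inR[OF pq(2)] nz] by blast
      then show "m \<in> (\<lambda>(a, b). a + b) ` ({a. p a \<noteq> \<zero>} \<times> {b. q b \<noteq> \<zero>})" by force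
    qed
    moreover have "finite ((\<lambda>(a, b). a + b) ` ({a. p a \<noteq> \<zero>} \<times> {b. q b \<noteq> \<zero>}))"
      using pq by (simp add: MPoly_def)
    ultimately have "finite {m. mpoly_mult R p q m \<noteq> \<zero>}" by (rule finite_subset)
    moreover have "set_mset m \<subseteq> {..<n}" if nz: "mpoly_mult R p q m \<noteq> \<zero>" for m
    proof -
      obtain a b where "m = a + b" "p a \<noteq> \<zero>" "q b \<noteq> \<zero>"
        using mpoly_mult_nonzeroE[OF inR[OF pq(1)] inR[OF pq(2)] nz] by blast
      then show ?thesis using pq by (auto simp: MPoly_def)
    qed
    ultimately show ?thesis
      using mpoly_mult_closed[OF inR[OF pq(1)] inR[OF pq(2)]] by (simp add: MPoly_def)
  qed
  have add_closed: "indexed_padd p q \<in> carrier ?P" if pq: "p \<in> carrier ?P" "q \<in> carrier ?P" for p q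
  proof -
    have "p m \<noteq> \<zero> \<or> q m \<noteq> \<zero>" if "indexed_padd p q m \<noteq> \<zero>" for m
      using that by (auto simp: indexed_padd_def)
    then have *: "{m. indexed_padd p q m \<noteq> \<zero>} \<subseteq> {m. p m \<noteq> \<zero>} \<union> {m. q m \<noteq> \<zero>}" by auto
    have "finite ({m. p m \<noteq> \<zero>} \<union> {m. q m \<noteq> \<zero>})" using pq by (simp add: MPoly_def)
    with * have "finite {m. indexed_padd p q m \<noteq> \<zero>}" by (rule finite_subset)
    moreover have "set_mset m \<subseteq> {..<n}" if "indexed_padd p q m \<noteq> \<zero>" for m
    proof -
      from that * have "p m \<noteq> \<zero> \<or> q m \<noteq> \<zero>" by blast
      then show ?thesis using pq by (auto simp: MPoly_def)
    qed
    moreover have "indexed_padd p q m \<in> carrier R" for m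
      using inR[OF pq(1)] inR[OF pq(2)] by (simp add: indexed_padd_def)
    ultimately show ?thesis by (simp add: MPoly_def)
  qed
  have const: "indexed_const c \<in> carrier ?P" if "c \<in> carrier R" for c
    using that by (auto simp: MPoly_def indexed_const_def)
  have sel: "monoid.mult ?P = mpoly_mult R" "\<one>\<^bsub>?P\<^esub> = indexed_const \<one>" "add ?P = indexed_padd"
    "\<zero>\<^bsub>?P\<^esub> = indexed_const \<zero>"
    by (simp_all add: MPoly_def)
  show "abelian_group ?P"
  proof (rule abelian_groupI)
    fix p assume p: "p \<in> carrier ?P"
    have "(\<lambda>m. \<ominus> p m) \<in> carrier ?P"
    proof -
      have "(\<ominus> p m = \<zero>) = (p m = \<zero>)" for m
        using minus_minus[OF inR[OF p, of m]] by auto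
      then show ?thesis using p by (simp add: MPoly_def)
    qed
    moreover have "(\<lambda>m. \<ominus> p m) \<oplus>\<^bsub>?P\<^esub> p = \<zero>\<^bsub>?P\<^esub>"
      using inR[OF p] by (auto simp: MPoly_def indexed_padd_def indexed_const_def l_neg)
    ultimately show "\<exists>q\<in>carrier ?P. q \<oplus>\<^bsub>?P\<^esub> p = \<zero>\<^bsub>?P\<^esub>" by blast
    show "\<zero>\<^bsub>?P\<^esub> \<oplus>\<^bsub>?P\<^esub> p = p"
      using inR[OF p] by (auto simp: MPoly_def indexed_padd_def indexed_const_def)
  next
    show "\<zero>\<^bsub>?P\<^esub> \<in> carrier ?P" using const[of \<zero>] by (simp add: sel)
  next
    fix p q assume pq: "p \<in> carrier ?P" "q \<in> carrier ?P"
    show "p \<oplus>\<^bsub>?P\<^esub> q \<in> carrier ?P"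
      using add_closed[OF pq] by (simp add: sel)
    show "p \<oplus>\<^bsub>?P\<^esub> q = q \<oplus>\<^bsub>?P\<^esub> p"
      using a_comm[OF inR[OF pq(1)] inR[OF pq(2)]] by (simp add: sel indexed_padd_def)
  next
    fix p q r assume pqr: "p \<in> carrier ?P" "q \<in> carrier ?P" "r \<in> carrier ?P"
    show "p \<oplus>\<^bsub>?P\<^esub> q \<oplus>\<^bsub>?P\<^esub> r = p \<oplus>\<^bsub>?P\<^esub> (q \<oplus>\<^bsub>?P\<^esub> r)"
      using a_assoc[OF inR[OF pqr(1)] inR[OF pqr(2)] inR[OF pqr(3)]]
      by (simp add: sel indexed_padd_def)
  qed
  show "Group.comm_monoid ?P"
  proof (rule comm_monoidI)
    show "\<one>\<^bsub>?P\<^esub> \<in> carrier ?P" using const[of \<one>] by (simp add: sel)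
  next
    fix p assume p: "p \<in> carrier ?P"
    show "\<one>\<^bsub>?P\<^esub> \<otimes>\<^bsub>?P\<^esub> p = p"
      using mpoly_mult_one[OF inR[OF p]] by (simp add: sel)
    fix q assume q: "q \<in> carrier ?P"
    show "p \<otimes>\<^bsub>?P\<^esub> q \<in> carrier ?P" using mult_closed[OF p q] by (simp add: sel)
    show "p \<otimes>\<^bsub>?P\<^esub> q = q \<otimes>\<^bsub>?P\<^esub> p"
      using mpoly_mult_comm[OF inR[OF p] inR[OF q]] by (simp add: sel)
    fix r assume r: "r \<in> carrier ?P"
    show "p \<otimes>\<^bsub>?P\<^esub> q \<otimes>\<^bsub>?P\<^esub> r = p \<otimes>\<^bsub>?P\<^esub> (q \<otimes>\<^bsub>?P\<^esub> r)"
      using mpoly_mult_assoc[OF inR[OF p] inR[OF q] inR[OF r]] by (simp add: sel)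
  qed
  fix p q r assume pqr: "p \<in> carrier ?P" "q \<in> carrier ?P" "r \<in> carrier ?P"
  note [simp] = inR[OF pqr(1)] inR[OF pqr(2)] inR[OF pqr(3)]
  show "(p \<oplus>\<^bsub>?P\<^esub> q) \<otimes>\<^bsub>?P\<^esub> r = p \<otimes>\<^bsub>?P\<^esub> r \<oplus>\<^bsub>?P\<^esub> q \<otimes>\<^bsub>?P\<^esub> r"
  proof
    fix m
    have "mpoly_mult R (indexed_padd p q) r m =
        (\<Oplus>a\<in>{a. a \<subseteq># m}. p a \<otimes> r (m - a) \<oplus> q a \<otimes> r (m - a))"
      unfolding mpoly_mult_def indexed_padd_def
      by (intro finsum_cong') (auto simp: l_distr)
    also have "\<dots> = mpoly_mult R p r m \<oplus> mpoly_mult R q r m"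
      unfolding mpoly_mult_def by (intro finsum_addf) auto
    finally show "((p \<oplus>\<^bsub>?P\<^esub> q) \<otimes>\<^bsub>?P\<^esub> r) m = (p \<otimes>\<^bsub>?P\<^esub> r \<oplus>\<^bsub>?P\<^esub> q \<otimes>\<^bsub>?P\<^esub> r) m"
      by (simp add: sel indexed_padd_def)
  qed
qed


section \<open>Homogeneous depth-three circuits\<close>

text \<open>
  A \<open>\<Sigma>\<^sup>[\<^sup>s\<^sup>]\<Pi>\<^sup>[\<^sup>k\<^sup>]\<Sigma>\<close> circuit over \<open>n\<close> variables is given by the coefficients \<open>a i j v\<close>
  of \<open>x\<^sub>v\<close> in the linear form \<open>L\<^sub>i\<^sub>,\<^sub>j\<close>, for \<open>i < s\<close>, \<open>j < k\<close>, \<open>v < n\<close>.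
\<close>

definition depth3_circuit ::
    "('a, 'm) ring_scheme \<Rightarrow> nat \<Rightarrow> nat \<Rightarrow> nat \<Rightarrow> (nat \<Rightarrow> nat \<Rightarrow> nat \<Rightarrow> 'a) \<Rightarrow> bool" where
  "depth3_circuit R n k s a \<longleftrightarrow> (\<forall>i<s. \<forall>j<k. \<forall>v<n. a i j v \<in> carrier R)"

definition linear_form :: "('a, 'm) ring_scheme \<Rightarrow> nat \<Rightarrow> (nat \<Rightarrow> 'a) \<Rightarrow> nat multiset \<Rightarrow> 'a" where
  "linear_form R n c =
    (\<Oplus>\<^bsub>MPoly R n\<^esub>v\<in>{..<n}. ring.indexed_pmult R (ring.indexed_const R (c v)) v)"

definition circuit_poly ::
    "('a, 'm) ring_scheme \<Rightarrow> nat \<Rightarrow> nat \<Rightarrow> nat \<Rightarrow> (nat \<Rightarrow> nat \<Rightarrow> nat \<Rightarrow> 'a) \<Rightarrow> nat multiset \<Rightarrow> 'a" where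
  "circuit_poly R n k s a =
    (\<Oplus>\<^bsub>MPoly R n\<^esub>i\<in>{..<s}. \<Otimes>\<^bsub>MPoly R n\<^esub>j\<in>{..<k}. linear_form R n (a i j))"

definition multilinear :: "nat multiset \<Rightarrow> bool" where
  "multilinear m \<longleftrightarrow> (\<forall>v. count m v \<le> 1)"

definition multilinear_monomials :: "nat \<Rightarrow> nat \<Rightarrow> nat multiset set" where
  "multilinear_monomials n k = {m. set_mset m \<subseteq> {..<n} \<and> size m = k \<and> multilinear m}"

definition multilinear_coeff_sum ::
    "('a, 'm) ring_scheme \<Rightarrow> nat \<Rightarrow> nat \<Rightarrow> (nat multiset \<Rightarrow> 'a) \<Rightarrow> 'a" where
  "multilinear_coeff_sum R n k f = (\<Oplus>\<^bsub>R\<^esub>m\<in>multilinear_monomials n k. f m)"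

definition has_multilinear_monomial ::
    "('a, 'm) ring_scheme \<Rightarrow> nat \<Rightarrow> nat \<Rightarrow> (nat multiset \<Rightarrow> 'a) \<Rightarrow> bool" where
  "has_multilinear_monomial R n k f \<longleftrightarrow> (\<exists>m\<in>multilinear_monomials n k. f m \<noteq> \<zero>\<^bsub>R\<^esub>)"


section \<open>Deterministic algorithms and their running time\<close>

text \<open>
  The machine is a random access machine with two memories: one holds natural numbers (for counters,
  addresses and control) and the other holds elements of the ring \<open>R\<close>. Both are addressed by natural
  numbers, with indirect addressing. The only operations on ring elements are
  \<open>0\<close>, \<open>1\<close>, \<open>+\<close>, \<open>-\<close>, \<open>\<cdot>\<close> and the test for zero, so the syntax does not depend
  on \<open>R\<close> and the same program runs over every ring.
\<close>

datatype nexp =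
    NConst nat
  | NMem nexp
  | NAdd nexp nexp
  | NSub nexp nexp
  | NMul nexp nexp
  | NDiv nexp nexp

datatype rexp =
    RZero
  | ROne
  | RMem nexp
  | RAdd rexp rexp
  | RSub rexp rexp
  | RMul rexp rexp

datatype bexp =
    NLess nexp nexp
  | RIsZero rexp
  | BNot bexp
  | BAnd bexp bexp

datatype com =
    Skip
  | NStore nexp nexp
  | RStore nexp rexp
  | Seq com com
  | If bexp com com
  | While bexp com

type_synonym 'a state = "(nat \<Rightarrow> nat) \<times> (nat \<Rightarrow> 'a)"

primrec nval :: "nexp \<Rightarrow> 'a state \<Rightarrow> nat" where
  "nval (NConst c) \<sigma> = c"
| "nval (NMem e) \<sigma> = fst \<sigma> (nval e \<sigma>)"
| "nval (NAdd e e') \<sigma> = nval e \<sigma> + nval e' \<sigma>"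
| "nval (NSub e e') \<sigma> = nval e \<sigma> - nval e' \<sigma>"
| "nval (NMul e e') \<sigma> = nval e \<sigma> * nval e' \<sigma>"
| "nval (NDiv e e') \<sigma> = nval e \<sigma> div nval e' \<sigma>"

primrec rval :: "('a, 'm) ring_scheme \<Rightarrow> rexp \<Rightarrow> 'a state \<Rightarrow> 'a" where
  "rval R RZero \<sigma> = \<zero>\<^bsub>R\<^esub>"
| "rval R ROne \<sigma> = \<one>\<^bsub>R\<^esub>"
| "rval R (RMem e) \<sigma> = snd \<sigma> (nval e \<sigma>)"
| "rval R (RAdd e e') \<sigma> = rval R e \<sigma> \<oplus>\<^bsub>R\<^esub> rval R e' \<sigma>"
| "rval R (RSub e e') \<sigma> = rval R e \<sigma> \<ominus>\<^bsub>R\<^esub> rval R e' \<sigma>"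
| "rval R (RMul e e') \<sigma> = rval R e \<sigma> \<otimes>\<^bsub>R\<^esub> rval R e' \<sigma>"

primrec bval :: "('a, 'm) ring_scheme \<Rightarrow> bexp \<Rightarrow> 'a state \<Rightarrow> bool" where
  "bval R (NLess e e') \<sigma> \<longleftrightarrow> nval e \<sigma> < nval e' \<sigma>"
| "bval R (RIsZero e) \<sigma> \<longleftrightarrow> rval R e \<sigma> = \<zero>\<^bsub>R\<^esub>"
| "bval R (BNot b) \<sigma> \<longleftrightarrow> \<not> bval R b \<sigma>"
| "bval R (BAnd b b') \<sigma> \<longleftrightarrow> bval R b \<sigma> \<and> bval R b' \<sigma>"

text \<open>
  Natural numbers are charged by the logarithmic cost criterion: every operation costs one plus the
  bit lengths of all numbers involved (\<^term>\<open>floorlog 2 x\<close> is the length of \<open>x\<close> in binary), so nothing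
  is gained by computing with huge numbers. Ring elements are charged by a size function \<open>sz\<close>:
  for \<open>sz = (\<lambda>_. 0)\<close> each ring operation costs \<open>1\<close>, and for \<open>sz = int_bits\<close> integers are also charged
  by their bit length.
\<close>

definition int_bits :: "int \<Rightarrow> nat" where
  "int_bits z = floorlog 2 (nat \<bar>z\<bar>)"

primrec ncost :: "nexp \<Rightarrow> 'a state \<Rightarrow> nat" where
  "ncost (NConst c) \<sigma> = 1 + floorlog 2 c"
| "ncost (NMem e) \<sigma> = 1 + floorlog 2 (nval (NMem e) \<sigma>) + ncost e \<sigma>"
| "ncost (NAdd e e') \<sigma> = 1 + floorlog 2 (nval (NAdd e e') \<sigma>) + ncost e \<sigma> + ncost e' \<sigma>"
| "ncost (NSub e e') \<sigma> = 1 + floorlog 2 (nval (NSub e e') \<sigma>) + ncost e \<sigma> + ncost e' \<sigma>"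
| "ncost (NMul e e') \<sigma> = 1 + floorlog 2 (nval (NMul e e') \<sigma>) + ncost e \<sigma> + ncost e' \<sigma>"
| "ncost (NDiv e e') \<sigma> = 1 + floorlog 2 (nval (NDiv e e') \<sigma>) + ncost e \<sigma> + ncost e' \<sigma>"

primrec rcost :: "('a, 'm) ring_scheme \<Rightarrow> ('a \<Rightarrow> nat) \<Rightarrow> rexp \<Rightarrow> 'a state \<Rightarrow> nat" where
  "rcost R sz RZero \<sigma> = 1 + sz \<zero>\<^bsub>R\<^esub>"
| "rcost R sz ROne \<sigma> = 1 + sz \<one>\<^bsub>R\<^esub>"
| "rcost R sz (RMem e) \<sigma> = 1 + sz (rval R (RMem e) \<sigma>) + ncost e \<sigma>"
| "rcost R sz (RAdd e e') \<sigma> = 1 + sz (rval R (RAdd e e') \<sigma>) + rcost R sz e \<sigma> + rcost R sz e' \<sigma>"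
| "rcost R sz (RSub e e') \<sigma> = 1 + sz (rval R (RSub e e') \<sigma>) + rcost R sz e \<sigma> + rcost R sz e' \<sigma>"
| "rcost R sz (RMul e e') \<sigma> = 1 + sz (rval R (RMul e e') \<sigma>) + rcost R sz e \<sigma> + rcost R sz e' \<sigma>"

primrec bcost :: "('a, 'm) ring_scheme \<Rightarrow> ('a \<Rightarrow> nat) \<Rightarrow> bexp \<Rightarrow> 'a state \<Rightarrow> nat" where
  "bcost R sz (NLess e e') \<sigma> = 1 + ncost e \<sigma> + ncost e' \<sigma>"
| "bcost R sz (RIsZero e) \<sigma> = 1 + rcost R sz e \<sigma>"
| "bcost R sz (BNot b) \<sigma> = 1 + bcost R sz b \<sigma>"
| "bcost R sz (BAnd b b') \<sigma> = 1 + bcost R sz b \<sigma> + bcost R sz b' \<sigma>"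

text \<open>\<open>exec R sz c \<sigma> t \<sigma>'\<close>: started in \<open>\<sigma>\<close>, the program \<open>c\<close> halts in \<open>\<sigma>'\<close> after time \<open>t\<close>.\<close>

inductive exec ::
    "('a, 'm) ring_scheme \<Rightarrow> ('a \<Rightarrow> nat) \<Rightarrow> com \<Rightarrow> 'a state \<Rightarrow> nat \<Rightarrow> 'a state \<Rightarrow> bool"
  for R :: "('a, 'm) ring_scheme" and sz :: "'a \<Rightarrow> nat" where
  Skip: "exec R sz Skip \<sigma> 1 \<sigma>"
| NStore: "exec R sz (NStore e e') \<sigma> (1 + ncost e \<sigma> + ncost e' \<sigma>)
    ((fst \<sigma>)(nval e \<sigma> := nval e' \<sigma>), snd \<sigma>)"
| RStore: "exec R sz (RStore e e') \<sigma> (1 + ncost e \<sigma> + rcost R sz e' \<sigma>)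
    (fst \<sigma>, (snd \<sigma>)(nval e \<sigma> := rval R e' \<sigma>))"
| Seq: "exec R sz c \<sigma> t \<sigma>' \<Longrightarrow> exec R sz c' \<sigma>' t' \<sigma>'' \<Longrightarrow> exec R sz (Seq c c') \<sigma> (t + t') \<sigma>''"
| IfTrue: "bval R b \<sigma> \<Longrightarrow> exec R sz c \<sigma> t \<sigma>' \<Longrightarrow>
    exec R sz (If b c c') \<sigma> (1 + bcost R sz b \<sigma> + t) \<sigma>'"
| IfFalse: "\<not> bval R b \<sigma> \<Longrightarrow> exec R sz c' \<sigma> t \<sigma>' \<Longrightarrow>
    exec R sz (If b c c') \<sigma> (1 + bcost R sz b \<sigma> + t) \<sigma>'"
| WhileTrue: "bval R b \<sigma> \<Longrightarrow> exec R sz c \<sigma> t \<sigma>' \<Longrightarrow> exec R sz (While b c) \<sigma>' t' \<sigma>'' \<Longrightarrow>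
    exec R sz (While b c) \<sigma> (1 + bcost R sz b \<sigma> + t + t') \<sigma>''"
| WhileFalse: "\<not> bval R b \<sigma> \<Longrightarrow> exec R sz (While b c) \<sigma> (1 + bcost R sz b \<sigma>) \<sigma>"

text \<open>
  Initially the first three natural number cells hold \<open>n\<close>, \<open>k\<close>, \<open>s\<close>, the ring cell
  \<open>(i \<cdot> k + j) \<cdot> n + v\<close> holds \<open>a i j v\<close>, and all other cells are zero.
\<close>

definition input_state ::
    "('a, 'm) ring_scheme \<Rightarrow> nat \<Rightarrow> nat \<Rightarrow> nat \<Rightarrow> (nat \<Rightarrow> nat \<Rightarrow> nat \<Rightarrow> 'a) \<Rightarrow> 'a state" where
  "input_state R n k s a =
    ((\<lambda>_. 0)(0 := n, 1 := k, 2 := s),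
     (\<lambda>x. if x < s * k * n then a (x div (k * n)) (x div n mod k) (x mod n) else \<zero>\<^bsub>R\<^esub>))"

definition outputs_sum_within ::
    "('a, 'm) ring_scheme \<Rightarrow> ('a \<Rightarrow> nat) \<Rightarrow> com \<Rightarrow> nat \<Rightarrow> nat \<Rightarrow> nat \<Rightarrow> (nat \<Rightarrow> nat \<Rightarrow> nat \<Rightarrow> 'a) \<Rightarrow>
     real \<Rightarrow> bool" where
  "outputs_sum_within R sz P n k s a T \<longleftrightarrow>
    (\<exists>t \<sigma>. exec R sz P (input_state R n k s a) t \<sigma> \<and> real t \<le> T \<and>
       snd \<sigma> 0 = multilinear_coeff_sum R n k (circuit_poly R n k s a))"

definition decides_monomial_within ::
    "('a, 'm) ring_scheme \<Rightarrow> ('a \<Rightarrow> nat) \<Rightarrow> com \<Rightarrow> nat \<Rightarrow> nat \<Rightarrow> nat \<Rightarrow> (nat \<Rightarrow> nat \<Rightarrow> nat \<Rightarrow> 'a) \<Rightarrow>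
     real \<Rightarrow> bool" where
  "decides_monomial_within R sz P n k s a T \<longleftrightarrow>
    (\<exists>t \<sigma>. exec R sz P (input_state R n k s a) t \<sigma> \<and> real t \<le> T \<and>
       fst \<sigma> 0 = (if has_multilinear_monomial R n k (circuit_poly R n k s a) then 1 else 0))"

inductive_cases SkipE: "exec R sz Skip \<sigma> t \<tau>"
  and NStoreE: "exec R sz (NStore e e') \<sigma> t \<tau>"
  and RStoreE: "exec R sz (RStore e r) \<sigma> t \<tau>"
  and SeqE: "exec R sz (Seq c c') \<sigma> t \<tau>"
  and IfE: "exec R sz (If b c c') \<sigma> t \<tau>"
  and WhileE: "exec R sz (While b c) \<sigma> t \<tau>"

lemma exec_deterministic:
  "exec R sz c \<sigma> t \<sigma>' \<Longrightarrow> exec R sz c \<sigma> u \<tau> \<Longrightarrow> u = t \<and> \<tau> = \<sigma>'"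
proof (induction arbitrary: u \<tau> rule: exec.induct)
  case (Skip \<sigma>)
  then show ?case by (rule SkipE) simp
next
  case (NStore e e' \<sigma>)
  then show ?case by (rule NStoreE) simp
next
  case (RStore e e' \<sigma>)
  then show ?case by (rule RStoreE) simp
next
  case (Seq c \<sigma> t \<sigma>' c' t' \<sigma>'')
  from Seq.prems obtain t1 \<rho> t2
    where *: "u = t1 + t2" "exec R sz c \<sigma> t1 \<rho>" "exec R sz c' \<rho> t2 \<tau>"
    by (rule SeqE)
  from Seq.IH(1)[OF *(2)] have "t1 = t" "\<rho> = \<sigma>'" by simp_all
  with Seq.IH(2)[of t2 \<tau>] * show ?case by simp
next
  case (IfTrue b \<sigma> c t \<sigma>' c')
  from IfTrue.prems obtain t1 where *: "u = 1 + bcost R sz b \<sigma> + t1" "exec R sz c \<sigma> t1 \<tau>"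
    using IfTrue.hyps(1) by (rule_tac IfE) auto
  with IfTrue.IH[OF *(2)] show ?case by simp
next
  case (IfFalse b \<sigma> c' t \<sigma>' c)
  from IfFalse.prems obtain t1 where *: "u = 1 + bcost R sz b \<sigma> + t1" "exec R sz c' \<sigma> t1 \<tau>"
    using IfFalse.hyps(1) by (rule_tac IfE) auto
  with IfFalse.IH[OF *(2)] show ?case by simp
next
  case (WhileTrue b \<sigma> c t \<sigma>' t' \<sigma>'')
  from WhileTrue.prems obtain t1 \<rho> t2 where *: "u = 1 + bcost R sz b \<sigma> + t1 + t2"
      "exec R sz c \<sigma> t1 \<rho>" "exec R sz (While b c) \<rho> t2 \<tau>"
    using WhileTrue.hyps(1) by (rule_tac WhileE) auto
  from WhileTrue.IH(1)[OF *(2)] have "t1 = t" "\<rho> = \<sigma>'" by simp_all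
  with WhileTrue.IH(2)[of t2 \<tau>] * show ?case by simp
next
  case (WhileFalse b \<sigma> c)
  from WhileFalse.prems WhileFalse.hyps show ?case by (rule_tac WhileE) auto
qed

end

theory Submission
  imports Defs
begin

text \<open>
  Let \<open>e\<^sub>A(i, S)\<close> be the coefficient of the multilinear monomial \<open>x\<^sub>A\<close> in the product of the \<open>L\<^sub>i\<^sub>,\<^sub>j\<close>
  with \<open>j \<in> S\<close>. Expanding along a variable \<open>v \<notin> A\<close> gives \<open>e\<^sub>B = M\<^sub>v e\<^sub>A\<close> for \<open>B = A \<union> {v}\<close> and a
  linear operator \<open>M\<^sub>v\<close> on vectors of length \<open>W = s \<cdot> 2\<^sup>k\<close>; the coefficient of \<open>x\<^sub>A\<close> in \<open>f\<close> is a fixed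
  linear functional of \<open>e\<^sub>A\<close>. The variables are processed one by one, and a summary of the vectors \<open>e\<^sub>A\<close>
  with \<open>A \<subseteq> {..<v}\<close> is kept: for (i) their sum \<open>D\<close>, with update \<open>D + M\<^sub>v D\<close>; for (ii) their Gram matrix
  \<open>G\<close>, the sum of all \<open>e\<^sub>A e\<^sub>A\<^sup>T\<close>, with update \<open>G + M\<^sub>v G M\<^sub>v\<^sup>T\<close>, which yields the sum of the squared
  coefficients; for (iii) a triangular basis of their span. Linear algebra on the span takes time
  \<open>O\<^sup>*(8\<^sup>k)\<close>, so that (iii) holds without hashing for \<open>c = 5\<close> and \<open>\<alpha> = 0\<close>.
\<close>

section \<open>Static cost bounds and a timed program logic\<close>

text \<open>The sum and the Gram matrix range over all subsets of the variables, not only over those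
  of size \<open>k\<close>: by homogeneity the other subsets have coefficient zero, so no recurrence
  has to count. Over the integers squares cannot cancel, hence one number extracted from
  \<open>G\<close> settles (ii). Over a finite field they can, which forces the detour through the
  span: a coefficient is nonzero iff \<open>top_sum\<close> does not vanish on it. The span itself
  is never formed; it is represented by the linear functionals that vanish on it. This view suits
  \<open>M\<^sub>v\<close>, with which a functional is composed, and elimination without division,
  where a nonzero factor cancels in a domain.

  Each application of \<open>M\<^sub>v\<close> adds at most \<open>b + k + 1\<close> bits, so sums
  and Gram matrices keep polynomial bit length over \<open>n\<close> variables. Elimination
  multiplies earlier results with each other; its analysis takes all ring elements to have size
  zero.

  Up to the final answer, the natural number memory does not depend on the values of ring elements.
  The program logic therefore tracks it exactly, and every address evaluates to a known
  number.\<close>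

abbreviation V :: "nat \<Rightarrow> nexp" where
  "V x \<equiv> NMem (NConst x)"

text \<open>The unit of these static bounds is \<open>unit_time\<close> below, which exceeds the
  size of every memory cell. A read thus counts as one unit whatever its address, and the bounds
  depend on the program text alone.\<close>

primrec nexp_bits :: "nexp \<Rightarrow> nat" where
  "nexp_bits (NConst c) = floorlog 2 c"
| "nexp_bits (NMem e) = 1"
| "nexp_bits (NAdd e e') = nexp_bits e + nexp_bits e' + 1"
| "nexp_bits (NSub e e') = nexp_bits e"
| "nexp_bits (NMul e e') = nexp_bits e + nexp_bits e'"
| "nexp_bits (NDiv e e') = nexp_bits e"

primrec nexp_weight :: "nexp \<Rightarrow> nat" where
  "nexp_weight (NConst c) = 1 + floorlog 2 c"
| "nexp_weight (NMem e) = 1 + nexp_bits (NMem e) + nexp_weight e"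
| "nexp_weight (NAdd e e') = 1 + nexp_bits (NAdd e e') + nexp_weight e + nexp_weight e'"
| "nexp_weight (NSub e e') = 1 + nexp_bits (NSub e e') + nexp_weight e + nexp_weight e'"
| "nexp_weight (NMul e e') = 1 + nexp_bits (NMul e e') + nexp_weight e + nexp_weight e'"
| "nexp_weight (NDiv e e') = 1 + nexp_bits (NDiv e e') + nexp_weight e + nexp_weight e'"

primrec rexp_bits :: "rexp \<Rightarrow> nat" where
  "rexp_bits RZero = 1"
| "rexp_bits ROne = 1"
| "rexp_bits (RMem e) = 1"
| "rexp_bits (RAdd e e') = rexp_bits e + rexp_bits e' + 1"
| "rexp_bits (RSub e e') = rexp_bits e + rexp_bits e' + 1"
| "rexp_bits (RMul e e') = rexp_bits e + rexp_bits e'"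

primrec rexp_weight :: "rexp \<Rightarrow> nat" where
  "rexp_weight RZero = 2"
| "rexp_weight ROne = 2"
| "rexp_weight (RMem e) = 2 + nexp_weight e"
| "rexp_weight (RAdd e e') = 1 + rexp_bits (RAdd e e') + rexp_weight e + rexp_weight e'"
| "rexp_weight (RSub e e') = 1 + rexp_bits (RSub e e') + rexp_weight e + rexp_weight e'"
| "rexp_weight (RMul e e') = 1 + rexp_bits (RMul e e') + rexp_weight e + rexp_weight e'"

primrec bexp_weight :: "bexp \<Rightarrow> nat" where
  "bexp_weight (NLess e e') = 1 + nexp_weight e + nexp_weight e'"
| "bexp_weight (RIsZero e) = 1 + rexp_weight e"
| "bexp_weight (BNot b) = 1 + bexp_weight b"
| "bexp_weight (BAnd b b') = 1 + bexp_weight b + bexp_weight b'"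

text \<open>The loop counter is reset at the end, so that a loop leaves the natural number memory as it
  found it.\<close>

definition For :: "nat \<Rightarrow> nexp \<Rightarrow> com \<Rightarrow> com" where
  "For x e c = Seq (While (NLess (V x) e) (Seq c (NStore (NConst x) (NAdd (V x) (NConst 1)))))
     (NStore (NConst x) (NConst 0))"

text \<open>The overhead of one round. The final reset of the counter is charged to every round, so
  that the cost of a loop is a single product.\<close>

definition for_weight :: "nat \<Rightarrow> nexp \<Rightarrow> nat" where
  "for_weight x e = 4 + bexp_weight (NLess (V x) e) + 2 * nexp_weight (NConst x) +
     nexp_weight (NAdd (V x) (NConst 1)) + nexp_weight (NConst 0)"

section \<open>Bit lengths of sums and products\<close>

lemma floorlog2_le_iff: "floorlog 2 x \<le> m \<longleftrightarrow> x < 2 ^ m"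
  by (simp add: floorlog_le_iff)

lemma floorlog2_less: "x < 2 ^ floorlog 2 x"
  using floorlog2_le_iff by blast

lemma floorlog2_add: "floorlog 2 (x + y) \<le> max (floorlog 2 x) (floorlog 2 y) + 1"
proof -
  have "x < 2 ^ max (floorlog 2 x) (floorlog 2 y)" "y < 2 ^ max (floorlog 2 x) (floorlog 2 y)"
    using floorlog2_less[of x] floorlog2_less[of y]
    by (meson floorlog2_le_iff max.cobounded1 max.cobounded2)+
  then show ?thesis unfolding floorlog2_le_iff by simp
qed

lemma floorlog2_mult: "floorlog 2 (x * y) \<le> floorlog 2 x + floorlog 2 y"
  unfolding floorlog2_le_iff power_add
  using floorlog2_less[of x] floorlog2_less[of y] by (intro mult_strict_mono') auto

text \<open>The two cost models are instances: size \<open>0\<close> throughout, and bit length over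
  the integers. The programs for (i) and (ii) are thereby analysed once for both. The integer
  \<open>1\<close> has one bit, whence the bound in \<open>sz_one\<close>.\<close>

locale sized_cring = cring R for R (structure) +
  fixes sz :: "'a \<Rightarrow> nat"
  assumes sz_zero: "sz \<zero> \<le> 1"
    and sz_one: "sz \<one> \<le> 1"
    and sz_add: "x \<in> carrier R \<Longrightarrow> y \<in> carrier R \<Longrightarrow> sz (x \<oplus> y) \<le> max (sz x) (sz y) + 1"
    and sz_minus: "x \<in> carrier R \<Longrightarrow> y \<in> carrier R \<Longrightarrow> sz (x \<ominus> y) \<le> max (sz x) (sz y) + 1"
    and sz_mult: "x \<in> carrier R \<Longrightarrow> y \<in> carrier R \<Longrightarrow> sz (x \<otimes> y) \<le> sz x + sz y"

text \<open>\<open>L\<close> bounds the bit lengths in the natural number memory and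
  \<open>Z\<close> the sizes in the ring memory. Both are fixed during a run and are chosen only
  when a program meets its input.\<close>

locale bounded_machine = sized_cring +
  fixes L Z :: nat
begin

definition nat_ok :: "(nat \<Rightarrow> nat) \<Rightarrow> bool" where
  "nat_ok \<rho> \<longleftrightarrow> (\<forall>x. \<rho> x < 2 ^ L)"

definition ring_ok :: "(nat \<Rightarrow> 'a) \<Rightarrow> bool" where
  "ring_ok g \<longleftrightarrow> (\<forall>x. g x \<in> carrier R \<and> sz (g x) \<le> Z)"

definition unit_time :: nat where
  "unit_time = L + Z + 1"

lemma nat_okD: "nat_ok \<rho> \<Longrightarrow> floorlog 2 (\<rho> x) \<le> unit_time"
  unfolding floorlog2_le_iff nat_ok_def unit_time_def
  by (rule order.strict_trans2[of _ "2 ^ L"]) (auto intro: power_increasing simp del: power_Suc)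

lemma nat_ok_upd: "nat_ok \<rho> \<Longrightarrow> m < 2 ^ L \<Longrightarrow> nat_ok (\<rho>(x := m))"
  by (simp add: nat_ok_def)

lemma ring_okD: "ring_ok g \<Longrightarrow> g x \<in> carrier R" "ring_ok g \<Longrightarrow> sz (g x) \<le> Z"
  by (auto simp: ring_ok_def)

lemma ring_ok_upd: "ring_ok g \<Longrightarrow> c \<in> carrier R \<Longrightarrow> sz c \<le> Z \<Longrightarrow> ring_ok (g(x := c))"
  by (simp add: ring_ok_def)

lemma le_mult_unit_time: "x \<le> x * unit_time"
  by (simp add: unit_time_def)

section \<open>Actual sizes and costs are at most the static bounds times the unit of time\<close>

lemma nval_bits:
  assumes "nat_ok \<rho>"
  shows "floorlog 2 (nval e (\<rho>, g)) \<le> nexp_bits e * unit_time"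
proof (induction e)
  case (NMem e)
  then show ?case using nat_okD[OF assms] by simp
next
  case (NConst c)
  then show ?case by (simp add: le_mult_unit_time)
next
  case (NAdd e e')
  then show ?case
    using floorlog2_add[of "nval e (\<rho>, g)" "nval e' (\<rho>, g)"] le_mult_unit_time[of 1]
    by (simp add: algebra_simps)
next
  case (NSub e e')
  then show ?case
    using floorlog_mono[of "nval e (\<rho>, g) - nval e' (\<rho>, g)" "nval e (\<rho>, g)" 2] by simp
next
  case (NMul e e')
  then show ?case
    using floorlog2_mult[of "nval e (\<rho>, g)" "nval e' (\<rho>, g)"]
    by (simp add: algebra_simps)
next
  case (NDiv e e')
  then show ?case
    using floorlog_mono[of "nval e (\<rho>, g) div nval e' (\<rho>, g)" "nval e (\<rho>, g)" 2] by simp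
qed

lemma add_le_unit_time:
  "a \<le> x * unit_time \<Longrightarrow> b \<le> y * unit_time \<Longrightarrow> a + b \<le> (x + y) * unit_time"
  by (simp add: algebra_simps)

lemma Suc_le_unit_time: "a \<le> x * unit_time \<Longrightarrow> Suc a \<le> Suc x * unit_time"
  by (simp add: unit_time_def)

lemma ncost_le:
  assumes "nat_ok \<rho>"
  shows "ncost e (\<rho>, g) \<le> nexp_weight e * unit_time"
proof (induction e)
  case (NConst c)
  then show ?case using le_mult_unit_time[of "Suc (floorlog 2 c)"] by simp
qed (simp_all only: ncost.simps nexp_weight.simps plus_1_eq_Suc add_Suc,
  (intro Suc_le_unit_time add_le_unit_time nval_bits[OF assms]; assumption)+)

lemma rval_closed: "ring_ok g \<Longrightarrow> rval R e (\<rho>, g) \<in> carrier R"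
  by (induction e) (auto simp: ring_okD)

lemma rval_bits:
  assumes "ring_ok g"
  shows "sz (rval R e (\<rho>, g)) \<le> rexp_bits e * unit_time"
proof (induction e)
  case RZero
  then show ?case using sz_zero le_mult_unit_time[of 1] by simp
next
  case ROne
  then show ?case using sz_one le_mult_unit_time[of 1] by simp
next
  case (RMem e)
  then show ?case using ring_okD(2)[OF assms, of "nval e (\<rho>, g)"] by (simp add: unit_time_def)
next
  case (RAdd e e')
  then show ?case
    using sz_add[OF rval_closed rval_closed, OF assms assms, of e \<rho> e' \<rho>] le_mult_unit_time[of 1]
    by (simp add: algebra_simps)
next
  case (RSub e e')
  then show ?case
    using sz_minus[OF rval_closed rval_closed, OF assms assms, of e \<rho> e' \<rho>] le_mult_unit_time[of 1]
    by (simp add: algebra_simps)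
next
  case (RMul e e')
  then show ?case
    using sz_mult[OF rval_closed rval_closed, OF assms assms, of e \<rho> e' \<rho>]
    by (simp add: algebra_simps)
qed

lemma rcost_le:
  assumes "nat_ok \<rho>" "ring_ok g"
  shows "rcost R sz e (\<rho>, g) \<le> rexp_weight e * unit_time"
proof (induction e)
  case RZero
  then show ?case using sz_zero le_mult_unit_time[of 2] by simp
next
  case ROne
  then show ?case using sz_one le_mult_unit_time[of 2] by simp
next
  case (RMem e)
  have "1 + sz (rval R (RMem e) (\<rho>, g)) \<le> 2 * unit_time"
    using ring_okD(2)[OF assms(2), of "nval e (\<rho>, g)"] by (simp add: unit_time_def)
  from add_le_unit_time[OF this ncost_le[OF assms(1)]] show ?case by simp
qed (simp_all only: rcost.simps rexp_weight.simps plus_1_eq_Suc add_Suc,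
  (intro Suc_le_unit_time add_le_unit_time rval_bits[OF assms(2)]; assumption)+)

lemma bcost_le:
  assumes "nat_ok \<rho>" "ring_ok g"
  shows "bcost R sz b (\<rho>, g) \<le> bexp_weight b * unit_time"
  by (induction b, simp_all only: bcost.simps bexp_weight.simps plus_1_eq_Suc add_Suc)
    (intro Suc_le_unit_time add_le_unit_time ncost_le[OF assms(1)] rcost_le[OF assms]; assumption)+

text \<open>The natural number memory is prescribed exactly, the ring memory only by predicates.
  Boundedness of both memories is carried along because every cost bound depends on it.\<close>

definition triple ::
    "(nat \<Rightarrow> nat) \<Rightarrow> ((nat \<Rightarrow> 'a) \<Rightarrow> bool) \<Rightarrow> com \<Rightarrow> nat \<Rightarrow> (nat \<Rightarrow> nat) \<Rightarrow> ((nat \<Rightarrow> 'a) \<Rightarrow> bool) \<Rightarrow> bool"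
  where
  "triple \<rho> I c A \<rho>' J \<longleftrightarrow> (\<forall>g. nat_ok \<rho> \<and> ring_ok g \<and> I g \<longrightarrow>
     (\<exists>t g'. exec R sz c (\<rho>, g) t (\<rho>', g') \<and> t \<le> A * unit_time \<and> nat_ok \<rho>' \<and> ring_ok g' \<and> J g'))"

lemma tripleE:
  assumes "triple \<rho> I c A \<rho>' J" "nat_ok \<rho>" "ring_ok g" "I g"
  obtains t g' where "exec R sz c (\<rho>, g) t (\<rho>', g')" "t \<le> A * unit_time"
    "nat_ok \<rho>'" "ring_ok g'" "J g'"
  using assms unfolding triple_def by blast

text \<open>Fixes a name for the initial ring memory, so that a postcondition can compare the final
  memory with it.\<close>

lemma triple_ghost:
  "(\<And>g0. nat_ok \<rho> \<Longrightarrow> ring_ok g0 \<Longrightarrow> I g0 \<Longrightarrow> triple \<rho> (\<lambda>g. g = g0) c A \<rho>' J) \<Longrightarrow> triple \<rho> I c A \<rho>' J"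
  unfolding triple_def by blast

lemma triple_conseq:
  assumes "triple \<rho> I c A \<rho>' J"
    and "\<And>g. nat_ok \<rho> \<Longrightarrow> ring_ok g \<Longrightarrow> I' g \<Longrightarrow> I g"
    and "\<And>g. ring_ok g \<Longrightarrow> J g \<Longrightarrow> J' g"
  shows "triple \<rho> I' c A \<rho>' J'"
  using assms unfolding triple_def by meson

lemma triple_Skip: "(\<And>g. ring_ok g \<Longrightarrow> I g \<Longrightarrow> J g) \<Longrightarrow> triple \<rho> I Skip 1 \<rho> J"
  unfolding triple_def using exec.Skip le_mult_unit_time[of 1] by fastforce

lemma triple_RStore:
  assumes "\<And>g. nat_ok \<rho> \<Longrightarrow> ring_ok g \<Longrightarrow> I g \<Longrightarrow> sz (rval R r (\<rho>, g)) \<le> Z"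
    and "\<And>g. nat_ok \<rho> \<Longrightarrow> ring_ok g \<Longrightarrow> I g \<Longrightarrow> J (g(nval e (\<rho>, g) := rval R r (\<rho>, g)))"
  shows "triple \<rho> I (RStore e r) (1 + nexp_weight e + rexp_weight r) \<rho> J"
  unfolding triple_def
proof (intro allI impI)
  fix g assume *: "nat_ok \<rho> \<and> ring_ok g \<and> I g"
  have "1 + ncost e (\<rho>, g) + rcost R sz r (\<rho>, g)
      \<le> (1 + nexp_weight e + rexp_weight r) * unit_time"
    unfolding plus_1_eq_Suc add_Suc using *
    by (intro Suc_le_unit_time add_le_unit_time ncost_le rcost_le) auto
  moreover have "ring_ok (g(nval e (\<rho>, g) := rval R r (\<rho>, g)))"
    using * assms(1) by (intro ring_ok_upd rval_closed) auto
  moreover note exec.RStore[of R sz e r "(\<rho>, g)"]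
  ultimately show "\<exists>t g'. exec R sz (RStore e r) (\<rho>, g) t (\<rho>, g') \<and>
      t \<le> (1 + nexp_weight e + rexp_weight r) * unit_time \<and> nat_ok \<rho> \<and> ring_ok g' \<and> J g'"
    using * assms(2) by fastforce
qed

lemma triple_NStore:
  assumes "\<And>g :: nat \<Rightarrow> 'a. nval e (\<rho>, g) = x" "\<And>g :: nat \<Rightarrow> 'a. nval e' (\<rho>, g) = m" "m < 2 ^ L"
  shows "triple \<rho> I (NStore e e') (1 + nexp_weight e + nexp_weight e') (\<rho>(x := m)) I"
  unfolding triple_def
proof (intro allI impI)
  fix g assume *: "nat_ok \<rho> \<and> ring_ok g \<and> I g"
  have "1 + ncost e (\<rho>, g) + ncost e' (\<rho>, g)
      \<le> (1 + nexp_weight e + nexp_weight e') * unit_time"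
    unfolding plus_1_eq_Suc add_Suc using *
    by (intro Suc_le_unit_time add_le_unit_time ncost_le) auto
  moreover note exec.NStore[of R sz e e' "(\<rho>, g)"]
  ultimately show "\<exists>t g'. exec R sz (NStore e e') (\<rho>, g) t (\<rho>(x := m), g') \<and>
      t \<le> (1 + nexp_weight e + nexp_weight e') * unit_time \<and> nat_ok (\<rho>(x := m)) \<and> ring_ok g' \<and> I g'"
    using * assms nat_ok_upd by fastforce
qed

lemma triple_Seq:
  assumes "triple \<rho> I c A \<rho>' J" "triple \<rho>' J c' B \<rho>'' K"
  shows "triple \<rho> I (Seq c c') (A + B) \<rho>'' K"
  unfolding triple_def
proof (intro allI impI)
  fix g assume *: "nat_ok \<rho> \<and> ring_ok g \<and> I g"
  then obtain t g' where 1: "exec R sz c (\<rho>, g) t (\<rho>', g')" "t \<le> A * unit_time"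
    "nat_ok \<rho>'" "ring_ok g'" "J g'"
    using tripleE[OF assms(1)] by blast
  then obtain t' g'' where 2: "exec R sz c' (\<rho>', g') t' (\<rho>'', g'')" "t' \<le> B * unit_time"
    "nat_ok \<rho>''" "ring_ok g''" "K g''"
    using tripleE[OF assms(2)] by blast
  show "\<exists>t g'. exec R sz (Seq c c') (\<rho>, g) t (\<rho>'', g') \<and> t \<le> (A + B) * unit_time \<and>
      nat_ok \<rho>'' \<and> ring_ok g' \<and> K g'"
    using exec.Seq[OF 1(1) 2(1)] add_le_unit_time[OF 1(2) 2(2)] 2 by blast
qed

text \<open>Charging both branches instead of their maximum keeps all bounds free of
  \<open>max\<close> and affects only constant factors.\<close>

lemma triple_If:
  assumes "triple \<rho> (\<lambda>g. I g \<and> bval R b (\<rho>, g)) c A \<rho>' J"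
    and "triple \<rho> (\<lambda>g. I g \<and> \<not> bval R b (\<rho>, g)) c' B \<rho>' J"
  shows "triple \<rho> I (If b c c') (1 + bexp_weight b + (A + B)) \<rho>' J"
  unfolding triple_def
proof (intro allI impI)
  fix g assume *: "nat_ok \<rho> \<and> ring_ok g \<and> I g"
  have "\<exists>t g'. exec R sz (If b c c') (\<rho>, g) (1 + bcost R sz b (\<rho>, g) + t) (\<rho>', g') \<and>
     t \<le> (A + B) * unit_time \<and> nat_ok \<rho>' \<and> ring_ok g' \<and> J g'"
  proof (cases "bval R b (\<rho>, g)")
    case True
    with * obtain t g' where 1: "exec R sz c (\<rho>, g) t (\<rho>', g')" "t \<le> A * unit_time"
      "nat_ok \<rho>'" "ring_ok g'" "J g'"
      using tripleE[OF assms(1)] by blast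
    have "t \<le> (A + B) * unit_time" using 1(2) by (simp add: algebra_simps)
    then show ?thesis using exec.IfTrue[OF True 1(1)] 1 by blast
  next
    case False
    with * obtain t g' where 1: "exec R sz c' (\<rho>, g) t (\<rho>', g')" "t \<le> B * unit_time"
      "nat_ok \<rho>'" "ring_ok g'" "J g'"
      using tripleE[OF assms(2)] by blast
    have "t \<le> (A + B) * unit_time" using 1(2) by (simp add: algebra_simps)
    then show ?thesis using exec.IfFalse[OF False 1(1)] 1 by blast
  qed
  then obtain t g' where t: "exec R sz (If b c c') (\<rho>, g) (1 + bcost R sz b (\<rho>, g) + t) (\<rho>', g')"
     "t \<le> (A + B) * unit_time" "nat_ok \<rho>'" "ring_ok g'" "J g'" by blast
  have "1 + bcost R sz b (\<rho>, g) + t \<le> (1 + bexp_weight b + (A + B)) * unit_time"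
    unfolding plus_1_eq_Suc add_Suc using * t(2)
    by (intro Suc_le_unit_time add_le_unit_time bcost_le) auto
  then show "\<exists>t g'. exec R sz (If b c c') (\<rho>, g) t (\<rho>', g') \<and>
      t \<le> (1 + bexp_weight b + (A + B)) * unit_time \<and> nat_ok \<rho>' \<and> ring_ok g' \<and> J g'"
    using t by blast
qed

text \<open>The natural number memory may change from round to round, as it does while the table of
  powers is filled; the other loops use \<open>triple_For\<close>, where it is constant.
  \<open>Suc N\<close> also counts the last, failing test.\<close>

lemma triple_For_env:
  assumes bound: "\<And>i (g :: nat \<Rightarrow> 'a). i \<le> N \<Longrightarrow> nval e ((\<rho> i)(x := i), g) = N"
    and N: "N < 2 ^ L" and x0: "\<rho> 0 x = 0" "\<rho> N x = 0"
    and body: "\<And>i. i < N \<Longrightarrow> triple ((\<rho> i)(x := i)) (I i) c A ((\<rho> (Suc i))(x := i)) (I (Suc i))"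
  shows "triple (\<rho> 0) (I 0) (For x e c) (Suc N * (A + for_weight x e)) (\<rho> N) (I N)"
proof -
  let ?b = "NLess (V x) e" and ?inc = "NStore (NConst x) (NAdd (V x) (NConst 1))"
  let ?w = "1 + bexp_weight ?b + (A + (1 + nexp_weight (NConst x) + nexp_weight (NAdd (V x) (NConst 1))))"
  have body': "triple ((\<rho> i)(x := i)) (I i) (Seq c ?inc)
      (A + (1 + nexp_weight (NConst x) + nexp_weight (NAdd (V x) (NConst 1))))
      ((\<rho> (Suc i))(x := Suc i)) (I (Suc i))" if i: "i < N" for i
  proof (rule triple_Seq[OF body[OF i]])
    have "Suc i < 2 ^ L" using i N by simp
    then show "triple ((\<rho> (Suc i))(x := i)) (I (Suc i)) ?inc
      (1 + nexp_weight (NConst x) + nexp_weight (NAdd (V x) (NConst 1))) ((\<rho> (Suc i))(x := Suc i)) (I (Suc i))"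
      using triple_NStore[of "NConst x" "(\<rho> (Suc i))(x := i)" x "NAdd (V x) (NConst 1)" "Suc i" "I (Suc i)"]
      by simp
  qed
  \<comment> \<open>Induction downwards from \<open>N\<close>: started with counter
    \<open>i\<close>, the loop is the same command for every \<open>i\<close>, with
    \<open>N - i\<close> rounds and the failing test ahead.\<close>
  have loop: "triple ((\<rho> i)(x := i)) (I i) (While ?b (Seq c ?inc))
      (Suc (N - i) * ?w) ((\<rho> N)(x := N)) (I N)" if "i \<le> N" for i
    using that
  proof (induction rule: inc_induct)
    case base
    show ?case
      unfolding triple_def
    proof (intro allI impI)
      fix g assume *: "nat_ok ((\<rho> N)(x := N)) \<and> ring_ok g \<and> I N g"
      have "\<not> bval R ?b ((\<rho> N)(x := N), g)" using bound[of N g] by simp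
      note ex = exec.WhileFalse[OF this, of sz "Seq c ?inc"]
      have "1 + bcost R sz ?b ((\<rho> N)(x := N), g) \<le> (1 + bexp_weight ?b) * unit_time"
        unfolding plus_1_eq_Suc add_Suc using * by (intro Suc_le_unit_time bcost_le) auto
      also have "\<dots> \<le> ?w * unit_time" by (intro mult_le_mono1) simp
      finally have "1 + bcost R sz ?b ((\<rho> N)(x := N), g) \<le> Suc (N - N) * ?w * unit_time" by simp
      with ex * show "\<exists>t g'. exec R sz (While ?b (Seq c ?inc)) ((\<rho> N)(x := N), g) t ((\<rho> N)(x := N), g') \<and>
          t \<le> Suc (N - N) * ?w * unit_time \<and> nat_ok ((\<rho> N)(x := N)) \<and> ring_ok g' \<and> I N g'"
        by blast
    qed
  next
    case (step i)
    show ?case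
      unfolding triple_def
    proof (intro allI impI)
      fix g assume *: "nat_ok ((\<rho> i)(x := i)) \<and> ring_ok g \<and> I i g"
      have b: "bval R ?b ((\<rho> i)(x := i), g)" using bound[of i g] step by simp
      from * obtain t g' where 1: "exec R sz (Seq c ?inc) ((\<rho> i)(x := i), g) t ((\<rho> (Suc i))(x := Suc i), g')"
        "t \<le> (A + (1 + nexp_weight (NConst x) + nexp_weight (NAdd (V x) (NConst 1)))) * unit_time"
        "nat_ok ((\<rho> (Suc i))(x := Suc i))" "ring_ok g'" "I (Suc i) g'"
        using tripleE[OF body'[OF step.hyps(2)]] by metis
      then obtain t' g'' where 2: "exec R sz (While ?b (Seq c ?inc)) ((\<rho> (Suc i))(x := Suc i), g') t' ((\<rho> N)(x := N), g'')"
        "t' \<le> Suc (N - Suc i) * ?w * unit_time" "nat_ok ((\<rho> N)(x := N))" "ring_ok g''" "I N g''"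
        using tripleE[OF step.IH] by metis
      have "1 + bcost R sz ?b ((\<rho> i)(x := i), g) + t \<le> ?w * unit_time"
        unfolding plus_1_eq_Suc add_Suc using * 1(2)
        by (intro Suc_le_unit_time add_le_unit_time bcost_le) (auto simp: add_ac)
      from add_le_unit_time[OF this 2(2)]
      have "1 + bcost R sz ?b ((\<rho> i)(x := i), g) + t + t' \<le> (?w + Suc (N - Suc i) * ?w) * unit_time" .
      also have "?w + Suc (N - Suc i) * ?w = Suc (N - i) * ?w"
        using step.hyps(2) by (metis Suc_diff_Suc mult_Suc)
      finally show "\<exists>t g'. exec R sz (While ?b (Seq c ?inc)) ((\<rho> i)(x := i), g) t ((\<rho> N)(x := N), g') \<and>
          t \<le> Suc (N - i) * ?w * unit_time \<and> nat_ok ((\<rho> N)(x := N)) \<and> ring_ok g' \<and> I N g'"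
        using exec.WhileTrue[OF b 1(1) 2(1)] 2 by blast
    qed
  qed
  have reset: "triple ((\<rho> N)(x := N)) (I N) (NStore (NConst x) (NConst 0))
      (1 + nexp_weight (NConst x) + nexp_weight (NConst 0)) (\<rho> N) (I N)"
    using triple_NStore[of "NConst x" "(\<rho> N)(x := N)" x "NConst 0" 0 "I N"] x0 by (simp add: fun_upd_idem)
  have start: "(\<rho> 0)(x := 0) = \<rho> 0" using x0 by (simp add: fun_upd_idem)
  have le: "Suc (N - 0) * ?w + (1 + nexp_weight (NConst x) + nexp_weight (NConst 0))
      \<le> Suc N * (A + for_weight x e)"
    by (simp add: for_weight_def algebra_simps)
  from triple_Seq[OF loop[of 0] reset] show ?thesis
    unfolding For_def start triple_def using mult_le_mono1[OF le, of unit_time]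
    by (meson le_trans zero_le)
qed

lemma triple_For:
  assumes "\<And>i (g :: nat \<Rightarrow> 'a). i \<le> N \<Longrightarrow> nval e (\<rho>(x := i), g) = N" "N < 2 ^ L" "\<rho> x = 0"
    and "\<And>i. i < N \<Longrightarrow> triple (\<rho>(x := i)) (I i) c A (\<rho>(x := i)) (I (Suc i))"
  shows "triple \<rho> (I 0) (For x e c) (Suc N * (A + for_weight x e)) \<rho> (I N)"
  using triple_For_env[of N e "\<lambda>_. \<rho>" x I c A] assms by blast

text \<open>The second conjunct is a frame condition: whatever is known of \<open>g0\<close> outside
  the written cells carries over without being listed.\<close>

definition writes :: "(nat \<Rightarrow> 'a) \<Rightarrow> (nat \<Rightarrow> nat) \<Rightarrow> nat \<Rightarrow> (nat \<Rightarrow> 'a) \<Rightarrow> (nat \<Rightarrow> 'a) \<Rightarrow> bool" where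
  "writes g0 d N h g \<longleftrightarrow> (\<forall>i<N. g (d i) = h i) \<and> (\<forall>y. y \<notin> d ` {..<N} \<longrightarrow> g y = g0 y)"

lemma writesD:
  "writes g0 d N h g \<Longrightarrow> i < N \<Longrightarrow> g (d i) = h i"
  "writes g0 d N h g \<Longrightarrow> (\<And>i. i < N \<Longrightarrow> y \<noteq> d i) \<Longrightarrow> g y = g0 y"
  by (auto simp: writes_def)

lemma writes_0 [simp]: "writes g0 d 0 h g \<longleftrightarrow> g = g0"
  by (auto simp: writes_def)

lemma writes_Suc:
  assumes "writes g0 d i h g" "inj_on d {..<N}" "i < N" "c = h i"
  shows "writes g0 d (Suc i) h (g(d i := c))"
proof -
  have "d j \<noteq> d i" if "j < i" for j
    using inj_onD[OF assms(2), of j i] assms(3) that by auto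
  then show ?thesis using assms(1,4) by (auto simp: writes_def less_Suc_eq lessThan_Suc)
qed

text \<open>Round \<open>i\<close> may rely on only \<open>i\<close> writes having happened. A
  program may therefore overwrite its own input if each cell is read before it is written; the
  additions in place and the elimination do so.\<close>

lemma triple_map:
  assumes "\<And>i (g :: nat \<Rightarrow> 'a). i \<le> N \<Longrightarrow> nval e (\<rho>(x := i), g) = N" "N < 2 ^ L" "\<rho> x = 0"
    and inj: "inj_on d {..<N}"
    and d: "\<And>i (g :: nat \<Rightarrow> 'a). i < N \<Longrightarrow> nval D (\<rho>(x := i), g) = d i"
    and h: "\<And>i g. i < N \<Longrightarrow> ring_ok g \<Longrightarrow> writes g0 d i h g \<Longrightarrow> rval R r (\<rho>(x := i), g) = h i \<and> sz (h i) \<le> Z"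
  shows "triple \<rho> (\<lambda>g. g = g0) (For x e (RStore D r))
    (Suc N * (1 + nexp_weight D + rexp_weight r + for_weight x e)) \<rho> (writes g0 d N h)"
proof -
  have "triple \<rho> (writes g0 d 0 h) (For x e (RStore D r))
    (Suc N * (1 + nexp_weight D + rexp_weight r + for_weight x e)) \<rho> (writes g0 d N h)"
  proof (rule triple_For[OF assms(1-3)])
    fix i assume i: "i < N"
    show "triple (\<rho>(x := i)) (writes g0 d i h) (RStore D r) (1 + nexp_weight D + rexp_weight r)
        (\<rho>(x := i)) (writes g0 d (Suc i) h)"
    proof (rule triple_RStore)
      fix g assume *: "ring_ok g" "writes g0 d i h g"
      show "sz (rval R r (\<rho>(x := i), g)) \<le> Z" using h[OF i *] by simp
      show "writes g0 d (Suc i) h (g(nval D (\<rho>(x := i), g) := rval R r (\<rho>(x := i), g)))"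
        using h[OF i *] d[OF i] * i inj by (simp add: writes_Suc)
    qed
  qed
  then show ?thesis by (rule triple_conseq) simp_all
qed

end

section \<open>Coefficients of multilinear monomials\<close>

definition bits_below :: "nat \<Rightarrow> nat \<Rightarrow> nat set" where
  "bits_below k x = {j. j < k \<and> odd (x div 2 ^ j)}"

lemma finite_bits_below [simp]: "finite (bits_below k x)"
  by (simp add: bits_below_def)

lemma nat_unset_bit_eq: "bit (x :: nat) j \<Longrightarrow> unset_bit j x = x - 2 ^ j"
proof -
  assume "bit x j"
  then have "int (unset_bit j x) = int x - 2 ^ j"
    by (simp add: of_nat_unset_bit_eq unset_bit_eq bit_of_nat_iff_bit)
  then have "unset_bit j x = nat (int x - int (2 ^ j))" by simp
  then show ?thesis by linarith
qed

text \<open>Clearing a set bit causes no borrow, so the part above the lowest \<open>k\<close> bits,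
  which encodes the gate, stays the same. Dropping a factor from a product is thus a subtraction,
  which the machine can perform.\<close>

lemma remove_bit:
  assumes "j \<in> bits_below k x"
  shows "(x - 2 ^ j) div 2 ^ k = x div 2 ^ k" "bits_below k (x - 2 ^ j) = bits_below k x - {j}"
    and "2 ^ j \<le> x"
proof -
  from assms have j: "j < k" "bit x j" by (auto simp: bits_below_def bit_iff_odd)
  have "drop_bit k (unset_bit j x) = drop_bit k x"
    using j by (intro bit_eqI) (auto simp: bit_simps)
  then show "(x - 2 ^ j) div 2 ^ k = x div 2 ^ k"
    using j by (simp add: nat_unset_bit_eq drop_bit_eq_div)
  have "bit (x - 2 ^ j) i \<longleftrightarrow> bit x i \<and> i \<noteq> j" for i
    using j(2) by (metis bit_unset_bit_iff nat_unset_bit_eq)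
  then show "bits_below k (x - 2 ^ j) = bits_below k x - {j}"
    by (auto simp: bits_below_def bit_iff_odd)
  show "2 ^ j \<le> x"
    using j by (metis bit_iff_odd div_less even_zero not_le)
qed

lemma bits_below_empty_iff: "bits_below k x = {} \<longleftrightarrow> 2 ^ k dvd x"
proof -
  have "2 ^ k dvd x \<longleftrightarrow> take_bit k x = 0"
    by (simp add: take_bit_eq_mod dvd_eq_mod_eq_0)
  also have "\<dots> \<longleftrightarrow> (\<forall>j. \<not> bit (take_bit k x) j)"
    by (metis bit_0_eq bit_eqI bot_apply bot_bool_def)
  also have "\<dots> \<longleftrightarrow> bits_below k x = {}"
    by (auto simp: bits_below_def bit_iff_odd[symmetric] bit_take_bit_iff)
  finally show ?thesis by simp
qed

lemma bits_below_full: "bits_below k (i * 2 ^ k + (2 ^ k - 1)) = {..<k}"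
proof -
  let ?x = "i * 2 ^ k + (2 ^ k - 1)"
  have "?x mod 2 ^ k = (2 ^ k - 1) mod 2 ^ k" by (rule mod_mult_self3)
  then have "?x mod 2 ^ k = 2 ^ k - 1" by simp
  then have "take_bit k ?x = mask k"
    by (simp add: take_bit_eq_mod mask_eq_exp_minus_1)
  then have "bit (take_bit k ?x) j = bit (mask k :: nat) j" for j by simp
  then show ?thesis
    by (auto simp: bits_below_def bit_iff_odd[symmetric] bit_take_bit_iff bit_mask_iff)
qed

context cring
begin

section \<open>Coefficients of sums, of linear forms and of products with a linear form\<close>

lemma MPoly_sel:
  "monoid.mult (MPoly R n) = mpoly_mult R" "one (MPoly R n) = indexed_const \<one>"
  "add (MPoly R n) = indexed_padd" "zero (MPoly R n) = indexed_const \<zero>"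
  by (simp_all add: MPoly_def)

lemma MPoly_carrierD: "p \<in> carrier (MPoly R n) \<Longrightarrow> p m \<in> carrier R"
  by (simp add: MPoly_def)

lemma MPoly_finsum_apply:
  assumes "finite I" "f \<in> I \<rightarrow> carrier (MPoly R n)"
  shows "(\<Oplus>\<^bsub>MPoly R n\<^esub>i\<in>I. f i) m = (\<Oplus>i\<in>I. f i m)"
  using assms
proof (induction I)
  interpret P: cring "MPoly R n" by (rule MPoly_cring)
  case empty
  show ?case by (simp add: MPoly_sel indexed_const_def)
next
  interpret P: cring "MPoly R n" by (rule MPoly_cring)
  case (insert i I)
  then have "(\<lambda>i. f i m) \<in> I \<rightarrow> carrier R" by (auto intro: MPoly_carrierD)
  moreover have "f i m \<in> carrier R" using insert.prems by (auto intro: MPoly_carrierD)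
  ultimately have "(\<Oplus>i\<in>insert i I. f i m) = f i m \<oplus> (\<Oplus>i\<in>I. f i m)"
    using insert.hyps by (intro finsum_insert) auto
  with insert show ?case
    by (simp add: MPoly_sel indexed_padd_def Pi_def)
qed

lemma scaled_variable_closed:
  assumes "c \<in> carrier R" "v < n"
  shows "indexed_pmult (indexed_const c) v \<in> carrier (MPoly R n)"
proof -
  have eq: "indexed_pmult (indexed_const c) v = (\<lambda>m. if m = {#v#} then c else \<zero>)"
    by (auto simp: indexed_pmult_def indexed_const_def fun_eq_iff dest: multi_member_split)
  have "{m. (if m = {#v#} then c else \<zero>) \<noteq> \<zero>} \<subseteq> {{#v#}}" by auto
  then have "finite {m. (if m = {#v#} then c else \<zero>) \<noteq> \<zero>}" by (rule finite_subset) simp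
  then show ?thesis using assms by (auto simp: MPoly_def eq)
qed

lemma linear_form_closed:
  assumes "\<And>v. v < n \<Longrightarrow> c v \<in> carrier R"
  shows "linear_form R n c \<in> carrier (MPoly R n)"
proof -
  interpret P: cring "MPoly R n" by (rule MPoly_cring)
  show ?thesis
    unfolding linear_form_def using assms by (auto intro!: P.finsum_closed scaled_variable_closed)
qed

lemma linear_form_apply:
  assumes "\<And>v. v < n \<Longrightarrow> c v \<in> carrier R"
  shows "linear_form R n c m = (\<Oplus>v\<in>{..<n}. if m = {#v#} then c v else \<zero>)"
proof -
  have eq: "indexed_pmult (indexed_const (c v)) v = (\<lambda>m. if m = {#v#} then c v else \<zero>)" for v
    by (auto simp: indexed_pmult_def indexed_const_def fun_eq_iff dest: multi_member_split)
  have "linear_form R n c m = (\<Oplus>v\<in>{..<n}. indexed_pmult (indexed_const (c v)) v m)"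
    unfolding linear_form_def using assms
    by (intro MPoly_finsum_apply) (auto intro: scaled_variable_closed)
  then show ?thesis by (simp add: eq)
qed

lemma linear_form_singleton:
  assumes "\<And>v. v < n \<Longrightarrow> c v \<in> carrier R" "w < n"
  shows "linear_form R n c {#w#} = c w"
proof -
  have "linear_form R n c {#w#} = (\<Oplus>v\<in>{..<n}. if w = v then c v else \<zero>)"
    using assms by (subst linear_form_apply) (auto intro!: finsum_cong')
  also have "\<dots> = c w" using assms by (intro finsum_singleton) auto
  finally show ?thesis .
qed

lemma linear_form_eq_zero:
  assumes "\<And>v. v < n \<Longrightarrow> c v \<in> carrier R" "\<And>v. v < n \<Longrightarrow> m \<noteq> {#v#}"
  shows "linear_form R n c m = \<zero>"
proof -
  have "(\<Oplus>v\<in>{..<n}. if m = {#v#} then c v else \<zero>) = (\<Oplus>v\<in>{..<n}. \<zero>)"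
    using assms by (intro finsum_cong') auto
  then show ?thesis using linear_form_apply[of n c m, OF assms(1)] by simp
qed

text \<open>A linear form has only monomials of the form \<open>{#w#}\<close>, so at most
  \<open>card B\<close> terms of the convolution survive. Divisors of a squarefree monomial are
  squarefree, hence the other monomials never have to be tracked.\<close>

lemma linear_form_mult:
  assumes c: "\<And>v. v < n \<Longrightarrow> c v \<in> carrier R" and q: "\<And>m. q m \<in> carrier R" and B: "B \<subseteq> {..<n}"
  shows "mpoly_mult R (linear_form R n c) q (mset_set B) = (\<Oplus>w\<in>B. c w \<otimes> q (mset_set (B - {w})))"
proof -
  have fB: "finite B" using B finite_subset by blast
  let ?h = "\<lambda>a. linear_form R n c a \<otimes> q (mset_set B - a)"
  have lf: "linear_form R n c a \<in> carrier R" for a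
    using MPoly_carrierD[OF linear_form_closed, of n c a] c by simp
  have h: "?h a \<in> carrier R" for a using lf q by simp
  have sub: "(\<lambda>w. {#w#}) ` B \<subseteq> {a. a \<subseteq># mset_set B}" using fB by auto
  have zero: "?h a = \<zero>" if "a \<in> {a. a \<subseteq># mset_set B} - (\<lambda>w. {#w#}) ` B" for a
  proof -
    have "linear_form R n c a = \<zero>"
    proof (rule linear_form_eq_zero[OF c])
      fix v assume "v < n"
      show "a \<noteq> {#v#}"
      proof
        assume a: "a = {#v#}"
        with that have "v \<in># mset_set B" by simp
        with fB a that show False by auto
      qed
    qed
    then show ?thesis using q by simp
  qed
  have "mpoly_mult R (linear_form R n c) q (mset_set B) = finsum R ?h {a. a \<subseteq># mset_set B}"
    by (simp add: mpoly_mult_def)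
  also have "\<dots> = finsum R ?h ((\<lambda>w. {#w#}) ` B)"
    using sub zero h by (intro add.finprod_mono_neutral_cong_right) (auto simp: finite_submultisets)
  also have "\<dots> = (\<Oplus>w\<in>B. ?h {#w#})"
    using h by (intro finsum_reindex) (auto simp: inj_on_def)
  also have "\<dots> = (\<Oplus>w\<in>B. c w \<otimes> q (mset_set (B - {w})))"
  proof (rule finsum_cong')
    show "(\<lambda>w. c w \<otimes> q (mset_set (B - {w}))) \<in> B \<rightarrow> carrier R" using B c q by auto
    fix w assume w: "w \<in> B"
    then have "mset_set B - {#w#} = mset_set (B - {w})"
      using fB by (simp add: mset_set.remove)
    then show "?h {#w#} = c w \<otimes> q (mset_set (B - {w}))"
      using w B c by (auto simp: linear_form_singleton)
  qed simp
  finally show ?thesis .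
qed

section \<open>Squarefree coefficients of products of linear forms, which are permanents\<close>

definition prod_coeff :: "nat \<Rightarrow> (nat \<Rightarrow> nat \<Rightarrow> 'a) \<Rightarrow> nat set \<Rightarrow> nat set \<Rightarrow> 'a" where
  "prod_coeff n c T A = (\<Otimes>\<^bsub>MPoly R n\<^esub>j\<in>T. linear_form R n (c j)) (mset_set A)"

lemma prod_closed:
  assumes "\<And>j v. j \<in> T \<Longrightarrow> v < n \<Longrightarrow> c j v \<in> carrier R"
  shows "(\<Otimes>\<^bsub>MPoly R n\<^esub>j\<in>T. linear_form R n (c j)) \<in> carrier (MPoly R n)"
proof -
  interpret P: cring "MPoly R n" by (rule MPoly_cring)
  show ?thesis using assms by (auto intro!: P.finprod_closed linear_form_closed)
qed

lemma prod_coeff_closed: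
  assumes "\<And>j v. j \<in> T \<Longrightarrow> v < n \<Longrightarrow> c j v \<in> carrier R"
  shows "prod_coeff n c T A \<in> carrier R"
  using prod_closed[of T n c] assms MPoly_carrierD unfolding prod_coeff_def by blast

lemma prod_coeff_empty: "A \<subseteq> {..<n} \<Longrightarrow> prod_coeff n c {} A = (if A = {} then \<one> else \<zero>)"
proof -
  interpret P: cring "MPoly R n" by (rule MPoly_cring)
  assume "A \<subseteq> {..<n}"
  then have "finite A" using finite_subset by blast
  then show ?thesis by (simp add: prod_coeff_def MPoly_sel indexed_const_def mset_set_empty_iff)
qed

lemma prod_coeff_insert:
  assumes c: "\<And>i v. i \<in> insert j T \<Longrightarrow> v < n \<Longrightarrow> c i v \<in> carrier R"
    and "finite T" "j \<notin> T" "A \<subseteq> {..<n}"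
  shows "prod_coeff n c (insert j T) A = (\<Oplus>w\<in>A. c j w \<otimes> prod_coeff n c T (A - {w}))"
proof -
  interpret P: cring "MPoly R n" by (rule MPoly_cring)
  have T: "(\<Otimes>\<^bsub>MPoly R n\<^esub>i\<in>T. linear_form R n (c i)) \<in> carrier (MPoly R n)"
    using c by (intro prod_closed) auto
  have "(\<Otimes>\<^bsub>MPoly R n\<^esub>i\<in>insert j T. linear_form R n (c i)) =
      mpoly_mult R (linear_form R n (c j)) (\<Otimes>\<^bsub>MPoly R n\<^esub>i\<in>T. linear_form R n (c i))"
  proof -
    have "linear_form R n (c i) \<in> carrier (MPoly R n)" if "i \<in> insert j T" for i
      using c that by (intro linear_form_closed) auto
    then show ?thesis
      using P.finprod_insert[of T j "\<lambda>i. linear_form R n (c i)"] assms(2,3)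
      by (auto simp: MPoly_sel)
  qed
  then show ?thesis
    unfolding prod_coeff_def using linear_form_mult[OF _ MPoly_carrierD[OF T] assms(4), of "c j"] c by simp
qed

text \<open>A product of \<open>card T\<close> linear forms is homogeneous of that degree. This
  makes the restriction to subsets of size \<open>k\<close> automatic later on.\<close>

lemma prod_coeff_card:
  assumes "finite T" "\<And>i v. i \<in> T \<Longrightarrow> v < n \<Longrightarrow> c i v \<in> carrier R" "A \<subseteq> {..<n}" "card A \<noteq> card T"
  shows "prod_coeff n c T A = \<zero>"
  using assms
proof (induction T arbitrary: A)
  case empty
  then show ?case by (auto simp: prod_coeff_empty)
next
  case (insert j T)
  have "finite A" using insert.prems(2) finite_subset by blast
  have "prod_coeff n c (insert j T) A = (\<Oplus>w\<in>A. c j w \<otimes> prod_coeff n c T (A - {w}))"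
    using insert by (intro prod_coeff_insert) auto
  also have "\<dots> = (\<Oplus>w\<in>A. \<zero>)"
  proof (rule finsum_cong')
    fix w assume w: "w \<in> A"
    then have "card A = Suc (card (A - {w}))" using \<open>finite A\<close> by (metis card.remove)
    then have "prod_coeff n c T (A - {w}) = \<zero>"
      using insert.prems insert.hyps by (intro insert.IH) auto
    then show "c j w \<otimes> prod_coeff n c T (A - {w}) = \<zero>"
      using insert.prems w by auto
  qed auto
  finally show ?case by simp
qed

lemma finsum_swap:
  assumes "finite A" "finite B" "\<And>x y. x \<in> A \<Longrightarrow> y \<in> B \<Longrightarrow> f x y \<in> carrier R"
  shows "(\<Oplus>x\<in>A. \<Oplus>y\<in>B. f x y) = (\<Oplus>y\<in>B. \<Oplus>x\<in>A. f x y)"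
  using assms(1,3)
proof (induction A)
  case (insert a A)
  have "(\<Oplus>x\<in>insert a A. \<Oplus>y\<in>B. f x y) = (\<Oplus>y\<in>B. f a y) \<oplus> (\<Oplus>y\<in>B. \<Oplus>x\<in>A. f x y)"
    using insert by (subst finsum_insert) (auto intro!: finsum_closed)
  also have "\<dots> = (\<Oplus>y\<in>B. f a y \<oplus> (\<Oplus>x\<in>A. f x y))"
    using insert by (subst finsum_addf) (auto intro!: finsum_closed)
  also have "\<dots> = (\<Oplus>y\<in>B. \<Oplus>x\<in>insert a A. f x y)"
    using insert by (intro finsum_cong') (auto intro!: finsum_closed)
  finally show ?case .
qed simp

text \<open>This is the column expansion of a permanent; \<open>prod_coeff_insert\<close> is the row expansion.\<close>

lemma prod_coeff_expand:
  assumes "finite T" "\<And>i v. i \<in> T \<Longrightarrow> v < n \<Longrightarrow> c i v \<in> carrier R"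
    and "A \<subseteq> {..<n}" "v < n" "v \<notin> A"
  shows "prod_coeff n c T (insert v A) = (\<Oplus>j\<in>T. c j v \<otimes> prod_coeff n c (T - {j}) A)"
  using assms
proof (induction T arbitrary: A)
  case empty
  then show ?case by (auto simp: prod_coeff_empty)
next
  case (insert j T)
  have fA: "finite A" using insert.prems(2) finite_subset by blast
  have c: "c i w \<in> carrier R" if "i \<in> insert j T" "w < n" for i w using insert.prems that by blast
  have pc: "prod_coeff n c T' B \<in> carrier R" if "T' \<subseteq> insert j T" for T' B
    by (rule prod_coeff_closed) (use that c in blast)
  have [simp]: "prod_coeff n c T B \<in> carrier R" "prod_coeff n c (T - Y) B \<in> carrier R"
    "prod_coeff n c (insert j T - Y) B \<in> carrier R" for B Y
    by (rule pc; fastforce)+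
  have An: "\<And>w. w \<in> A \<Longrightarrow> w < n" using insert.prems(2) by auto
  have "prod_coeff n c (insert j T) (insert v A) =
      (\<Oplus>w\<in>insert v A. c j w \<otimes> prod_coeff n c T (insert v A - {w}))"
    using insert by (intro prod_coeff_insert) auto
  \<comment> \<open>In the expansion along row \<open>j\<close>, the summand \<open>w = v\<close>
    already is the term of \<open>j\<close> in the column expansion. In the others the induction
    hypothesis expands column \<open>v\<close>; exchanging the sums and folding row \<open>j\<close>
    back yields the terms of all \<open>i \<in> T\<close>.\<close>
  also have "\<dots> = c j v \<otimes> prod_coeff n c T A \<oplus>
      (\<Oplus>w\<in>A. c j w \<otimes> prod_coeff n c T (insert v A - {w}))"
    using insert.prems fA c An by (subst finsum_insert) auto
  also have "(\<Oplus>w\<in>A. c j w \<otimes> prod_coeff n c T (insert v A - {w})) =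
      (\<Oplus>w\<in>A. \<Oplus>i\<in>T. c i v \<otimes> (c j w \<otimes> prod_coeff n c (T - {i}) (A - {w})))"
  proof (rule finsum_cong')
    show "(\<lambda>w. \<Oplus>i\<in>T. c i v \<otimes> (c j w \<otimes> prod_coeff n c (T - {i}) (A - {w}))) \<in> A \<rightarrow> carrier R"
      using c An insert.prems by (auto intro!: finsum_closed)
    fix w assume w: "w \<in> A"
    then have "insert v A - {w} = insert v (A - {w})" using insert.prems by auto
    then have "prod_coeff n c T (insert v A - {w}) =
        (\<Oplus>i\<in>T. c i v \<otimes> prod_coeff n c (T - {i}) (A - {w}))"
      using insert.prems by (simp add: insert.IH subset_iff)
    then have "c j w \<otimes> prod_coeff n c T (insert v A - {w}) =
        (\<Oplus>i\<in>T. c j w \<otimes> (c i v \<otimes> prod_coeff n c (T - {i}) (A - {w})))"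
      using insert.hyps w c An insert.prems by (simp add: finsum_rdistr Pi_def subset_iff)
    also have "\<dots> = (\<Oplus>i\<in>T. c i v \<otimes> (c j w \<otimes> prod_coeff n c (T - {i}) (A - {w})))"
      using w c An insert.prems by (intro finsum_cong') (auto simp: m_lcomm)
    finally show "c j w \<otimes> prod_coeff n c T (insert v A - {w}) =
        (\<Oplus>i\<in>T. c i v \<otimes> (c j w \<otimes> prod_coeff n c (T - {i}) (A - {w})))" .
  qed simp
  also have "\<dots> = (\<Oplus>i\<in>T. \<Oplus>w\<in>A. c i v \<otimes> (c j w \<otimes> prod_coeff n c (T - {i}) (A - {w})))"
    using fA insert.hyps c An insert.prems by (intro finsum_swap) auto
  also have "\<dots> = (\<Oplus>i\<in>T. c i v \<otimes> prod_coeff n c (insert j T - {i}) A)"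
  proof (rule finsum_cong')
    show "(\<lambda>i. c i v \<otimes> prod_coeff n c (insert j T - {i}) A) \<in> T \<rightarrow> carrier R"
      using c insert.prems by auto
    fix i assume i: "i \<in> T"
    then have eq: "insert j T - {i} = insert j (T - {i})" using insert.hyps by auto
    have "prod_coeff n c (insert j T - {i}) A =
        (\<Oplus>w\<in>A. c j w \<otimes> prod_coeff n c (T - {i}) (A - {w}))"
      unfolding eq by (rule prod_coeff_insert) (use c insert.hyps insert.prems in auto)
    then show "(\<Oplus>w\<in>A. c i v \<otimes> (c j w \<otimes> prod_coeff n c (T - {i}) (A - {w}))) =
        c i v \<otimes> prod_coeff n c (insert j T - {i}) A"
      using fA i c An insert.prems by (simp add: finsum_rdistr Pi_def subset_iff)
  qed simp
  also have "c j v \<otimes> prod_coeff n c T A \<oplus> (\<Oplus>i\<in>T. c i v \<otimes> prod_coeff n c (insert j T - {i}) A) =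
      (\<Oplus>i\<in>insert j T. c i v \<otimes> prod_coeff n c (insert j T - {i}) A)"
    using insert.hyps insert.prems c by (subst finsum_insert) auto
  finally show ?case .
qed

lemma circuit_poly_mset_set:
  assumes "depth3_circuit R n k s a"
  shows "circuit_poly R n k s a (mset_set A) = (\<Oplus>i\<in>{..<s}. prod_coeff n (a i) {..<k} A)"
  unfolding circuit_poly_def prod_coeff_def using assms
  by (intro MPoly_finsum_apply) (auto simp: depth3_circuit_def intro!: prod_closed)

end

lemma multilinear_monomials_eq:
  "multilinear_monomials n k = mset_set ` {A. A \<subseteq> {..<n} \<and> card A = k}"
proof
  show "mset_set ` {A. A \<subseteq> {..<n} \<and> card A = k} \<subseteq> multilinear_monomials n k"
  proof
    fix m assume "m \<in> mset_set ` {A. A \<subseteq> {..<n} \<and> card A = k}"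
    then obtain A where A: "m = mset_set A" "A \<subseteq> {..<n}" "card A = k" by auto
    then have "finite A" using finite_subset by blast
    with A show "m \<in> multilinear_monomials n k"
      by (auto simp: multilinear_monomials_def multilinear_def count_mset_set')
  qed
  show "multilinear_monomials n k \<subseteq> mset_set ` {A. A \<subseteq> {..<n} \<and> card A = k}"
  proof
    fix m assume m: "m \<in> multilinear_monomials n k"
    have "count m v = (if v \<in># m then 1 else 0)" for v
      using m unfolding multilinear_monomials_def multilinear_def
      by (auto simp: not_in_iff le_Suc_eq) (metis not_in_iff)
    then have "m = mset_set (set_mset m)"
      by (intro multiset_eqI) (simp add: count_mset_set')
    moreover from this have "card (set_mset m) = size m" by (metis size_mset_set)
    ultimately show "m \<in> mset_set ` {A. A \<subseteq> {..<n} \<and> card A = k}"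
      using m by (auto simp: multilinear_monomials_def)
  qed
qed

section \<open>The vectors of partial coefficients\<close>

lemma Pow_lessThan_Suc: "Pow {..<Suc v} = Pow {..<v} \<union> insert v ` Pow {..<v}"
  by (simp add: lessThan_Suc Pow_insert)

locale circuit = cring R for R (structure) +
  fixes n k s :: nat and a :: "nat \<Rightarrow> nat \<Rightarrow> nat \<Rightarrow> 'a"
  assumes circuit: "depth3_circuit R n k s a"
begin

definition W :: nat where
  "W = s * 2 ^ k"

text \<open>The position of the complete product of gate \<open>i\<close>: all of the lowest
  \<open>k\<close> bits are set.\<close>

definition full :: "nat \<Rightarrow> nat" where
  "full i = i * 2 ^ k + (2 ^ k - 1)"

text \<open>A position \<open>x < W\<close> encodes the gate \<open>x div 2\<^sup>k\<close> together with the subset of its factors given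
  by the lowest \<open>k\<close> bits of \<open>x\<close>.\<close>

definition evec :: "nat set \<Rightarrow> nat \<Rightarrow> 'a" where
  "evec A x = prod_coeff n (a (x div 2 ^ k)) (bits_below k x) A"

text \<open>This is \<open>M\<^sub>v\<close>. Subtracting \<open>2 ^ j\<close> clears bit
  \<open>j\<close>, that is, it removes the factor that contributes the variable
  \<open>v\<close>.\<close>

definition step :: "nat \<Rightarrow> (nat \<Rightarrow> 'a) \<Rightarrow> nat \<Rightarrow> 'a" where
  "step v f x = (\<Oplus>j\<in>bits_below k x. a (x div 2 ^ k) j v \<otimes> f (x - 2 ^ j))"

definition vec :: "(nat \<Rightarrow> 'a) \<Rightarrow> bool" where
  "vec f \<longleftrightarrow> (\<forall>x<W. f x \<in> carrier R)"

lemma vecD [simp]: "vec f \<Longrightarrow> x < W \<Longrightarrow> f x \<in> carrier R"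
  by (simp add: vec_def)

lemma gate_less: "x < W \<Longrightarrow> x div 2 ^ k < s"
  by (simp add: W_def less_mult_imp_div_less)

lemma gate_closed [simp]:
  "x < W \<Longrightarrow> j \<in> bits_below k x \<Longrightarrow> v < n \<Longrightarrow> a (x div 2 ^ k) j v \<in> carrier R"
  using circuit gate_less[of x] by (auto simp: depth3_circuit_def bits_below_def)

lemma full_less [simp]: "i < s \<Longrightarrow> full i < W"
proof -
  assume "i < s"
  then have "Suc i * 2 ^ k \<le> s * 2 ^ k" by (intro mult_le_mono1) simp
  moreover have "(2 :: nat) ^ k - 1 < 2 ^ k" by simp
  then have "full i < Suc i * 2 ^ k" unfolding full_def mult_Suc by linarith
  ultimately show ?thesis by (simp add: W_def)
qed

lemma full_div: "full i div 2 ^ k = i"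
proof -
  have "(2 ^ k - 1 + i * 2 ^ k) div 2 ^ k = i + (2 ^ k - 1) div (2 ^ k :: nat)"
    by (rule div_mult_self1) simp
  then show ?thesis by (simp add: full_def add.commute)
qed

lemma bits_below_full_eq: "bits_below k (full i) = {..<k}"
  by (simp only: full_def bits_below_full)

lemma evec_closed [simp]: "x < W \<Longrightarrow> evec A x \<in> carrier R"
  unfolding evec_def by (intro prod_coeff_closed) auto

lemma vec_evec [simp]: "vec (evec A)"
  by (simp add: vec_def)

lemma step_closed [simp]: "x < W \<Longrightarrow> v < n \<Longrightarrow> vec f \<Longrightarrow> step v f x \<in> carrier R"
  unfolding step_def by (intro finsum_closed) (auto simp: vec_def)

lemma vec_step [simp]: "v < n \<Longrightarrow> vec f \<Longrightarrow> vec (step v f)"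
  by (simp add: vec_def step_closed[unfolded vec_def])

lemma step_cong: "x < W \<Longrightarrow> v < n \<Longrightarrow> vec g \<Longrightarrow> (\<And>y. y < W \<Longrightarrow> f y = g y) \<Longrightarrow> step v f x = step v g x"
  unfolding step_def by (intro finsum_cong') auto

lemma evec_empty: "evec {} x = (if 2 ^ k dvd x then \<one> else \<zero>)" if "x < W"
proof (cases "2 ^ k dvd x")
  case True
  then have "bits_below k x = {}" by (simp add: bits_below_empty_iff)
  with True show ?thesis by (simp add: evec_def prod_coeff_empty)
next
  case False
  then have "card (bits_below k x) \<noteq> card ({} :: nat set)"
    using bits_below_empty_iff[of k x] by auto
  then have "evec {} x = \<zero>"
    unfolding evec_def using that by (intro prod_coeff_card) auto
  with False show ?thesis by simp
qed

lemma evec_insert: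
  assumes "x < W" "A \<subseteq> {..<v}" "v < n"
  shows "evec (insert v A) x = step v (evec A) x"
proof -
  have "evec (insert v A) x =
      (\<Oplus>j\<in>bits_below k x. a (x div 2 ^ k) j v \<otimes> prod_coeff n (a (x div 2 ^ k)) (bits_below k x - {j}) A)"
    unfolding evec_def using assms by (intro prod_coeff_expand) auto
  also have "\<dots> = step v (evec A) x"
    unfolding step_def using assms
    by (intro finsum_cong') (auto simp: evec_def remove_bit intro!: prod_coeff_closed)
  finally show ?thesis .
qed

lemma step_finsum:
  assumes "finite F" "x < W" "v < n" "\<And>B. B \<in> F \<Longrightarrow> vec (h B)"
  shows "step v (\<lambda>y. \<Oplus>B\<in>F. h B y) x = (\<Oplus>B\<in>F. step v (h B) x)"
proof -
  have lt: "x - 2 ^ j < W" for j using assms(2) by simp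
  have "step v (\<lambda>y. \<Oplus>B\<in>F. h B y) x =
      (\<Oplus>j\<in>bits_below k x. \<Oplus>B\<in>F. a (x div 2 ^ k) j v \<otimes> h B (x - 2 ^ j))"
    unfolding step_def using assms lt
    by (intro finsum_cong') (auto simp: finsum_rdistr Pi_def intro!: finsum_closed)
  also have "\<dots> = (\<Oplus>B\<in>F. step v (h B) x)"
    unfolding step_def using assms lt by (intro finsum_swap) auto
  finally show ?thesis .
qed

lemma step_scale:
  assumes "x < W" "v < n" "vec f" "c \<in> carrier R"
  shows "step v (\<lambda>y. f y \<otimes> c) x = step v f x \<otimes> c"
  unfolding step_def using assms by (subst finsum_ldistr) (auto intro!: finsum_cong' simp: m_assoc)

text \<open>The combination has the shape that elimination without division produces.\<close>

lemma step_lincomb: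
  assumes "x < W" "v < n" "vec f" "vec g" "c \<in> carrier R" "d \<in> carrier R"
  shows "step v (\<lambda>y. c \<otimes> f y \<ominus> d \<otimes> g y) x = c \<otimes> step v f x \<ominus> d \<otimes> step v g x"
proof -
  have lt: "x - 2 ^ j < W" for j using assms(1) by simp
  have "step v (\<lambda>y. c \<otimes> f y \<ominus> d \<otimes> g y) x =
      (\<Oplus>j\<in>bits_below k x. c \<otimes> (a (x div 2 ^ k) j v \<otimes> f (x - 2 ^ j)) \<oplus>
         (\<ominus> d) \<otimes> (a (x div 2 ^ k) j v \<otimes> g (x - 2 ^ j)))"
    unfolding step_def
  proof (rule finsum_cong')
    fix j assume j: "j \<in> bits_below k x"
    have "p \<otimes> (c \<otimes> y \<ominus> d \<otimes> z) = c \<otimes> (p \<otimes> y) \<oplus> (\<ominus> d) \<otimes> (p \<otimes> z)"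
      if "p \<in> carrier R" "y \<in> carrier R" "z \<in> carrier R" for p y z
      using assms(5,6) that by algebra
    then show "a (x div 2 ^ k) j v \<otimes> (c \<otimes> f (x - 2 ^ j) \<ominus> d \<otimes> g (x - 2 ^ j)) =
        c \<otimes> (a (x div 2 ^ k) j v \<otimes> f (x - 2 ^ j)) \<oplus> (\<ominus> d) \<otimes> (a (x div 2 ^ k) j v \<otimes> g (x - 2 ^ j))"
      using assms lt j by simp
  qed (use assms lt in auto)
  also have "\<dots> = c \<otimes> step v f x \<oplus> (\<ominus> d) \<otimes> step v g x"
    unfolding step_def using assms lt
    by (subst finsum_addf) (auto simp: finsum_rdistr Pi_def)
  also have "\<dots> = c \<otimes> step v f x \<ominus> d \<otimes> step v g x"
    using assms by (simp add: a_minus_def l_minus)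
  finally show ?thesis .
qed

section \<open>From the vectors to the coefficients of the circuit polynomial\<close>

definition top_sum :: "(nat \<Rightarrow> 'a) \<Rightarrow> 'a" where
  "top_sum f = (\<Oplus>i\<in>{..<s}. f (full i))"

lemma top_sum_closed [simp]: "vec f \<Longrightarrow> top_sum f \<in> carrier R"
  by (auto simp: top_sum_def intro!: finsum_closed)

lemma circuit_coeff: "circuit_poly R n k s a (mset_set A) = top_sum (evec A)"
  unfolding top_sum_def circuit_poly_mset_set[OF circuit] using circuit
  by (intro finsum_cong')
    (auto simp: evec_def full_div depth3_circuit_def bits_below_full_eq
      intro!: prod_coeff_closed)

text \<open>Homogeneity again. It permits sums over the whole of \<open>Pow {..<n}\<close> in place
  of sums over the subsets of size \<open>k\<close>.\<close>

lemma top_sum_evec_eq_zero: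
  assumes "A \<subseteq> {..<n}" "card A \<noteq> k"
  shows "top_sum (evec A) = \<zero>"
proof -
  have "top_sum (evec A) = (\<Oplus>i\<in>{..<s}. \<zero>)"
    unfolding top_sum_def evec_def full_div bits_below_full_eq using assms circuit
    by (intro finsum_cong') (auto intro!: prod_coeff_card simp: depth3_circuit_def)
  then show ?thesis by simp
qed

lemma has_multilinear_monomial_iff:
  "has_multilinear_monomial R n k (circuit_poly R n k s a) \<longleftrightarrow> (\<exists>A\<subseteq>{..<n}. top_sum (evec A) \<noteq> \<zero>)"
  unfolding has_multilinear_monomial_def multilinear_monomials_eq using top_sum_evec_eq_zero
  by (auto simp: circuit_coeff)

lemma multilinear_coeff_sum_eq:
  "multilinear_coeff_sum R n k (circuit_poly R n k s a) = (\<Oplus>A\<in>Pow {..<n}. top_sum (evec A))"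
proof -
  have cl: "circuit_poly R n k s a (mset_set A) \<in> carrier R" for A
    by (simp add: circuit_coeff)
  have "inj_on mset_set {A. A \<subseteq> {..<n} \<and> card A = k}"
    by (rule inj_on_inverseI[of _ set_mset]) (auto simp: finite_subset)
  then have "multilinear_coeff_sum R n k (circuit_poly R n k s a) =
      (\<Oplus>A\<in>{A. A \<subseteq> {..<n} \<and> card A = k}. top_sum (evec A))"
    unfolding multilinear_coeff_sum_def multilinear_monomials_eq
    unfolding circuit_coeff[symmetric]
    by (intro finsum_reindex) (use cl in blast)+
  also have "\<dots> = (\<Oplus>A\<in>Pow {..<n}. top_sum (evec A))"
    using top_sum_evec_eq_zero by (intro add.finprod_mono_neutral_cong_left) auto
  finally show ?thesis .
qed

text \<open>A subset of \<open>{..<Suc v}\<close> avoids \<open>v\<close> or arises by inserting it.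
  Together with \<open>evec_insert\<close> this gives the recurrences for the sum and for the Gram
  matrix.\<close>

lemma finsum_Pow_Suc:
  assumes "\<And>A. A \<subseteq> {..<Suc v} \<Longrightarrow> F A \<in> carrier R"
  shows "(\<Oplus>A\<in>Pow {..<Suc v}. F A) = (\<Oplus>A\<in>Pow {..<v}. F A) \<oplus> (\<Oplus>A\<in>Pow {..<v}. F (insert v A))"
proof -
  have inj: "inj_on (insert v) (Pow {..<v})"
    by (rule inj_on_inverseI[of _ "\<lambda>A. A - {v}"]) auto
  have cl: "F A \<in> carrier R" "F (insert v A) \<in> carrier R" if "A \<subseteq> {..<v}" for A
    using that by (auto intro!: assms simp: lessThan_Suc)
  have "(\<Oplus>A\<in>Pow {..<Suc v}. F A) = (\<Oplus>A\<in>Pow {..<v}. F A) \<oplus> (\<Oplus>A\<in>insert v ` Pow {..<v}. F A)"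
    unfolding Pow_lessThan_Suc using cl by (intro finsum_Un_disjoint) auto
  also have "(\<Oplus>A\<in>insert v ` Pow {..<v}. F A) = (\<Oplus>A\<in>Pow {..<v}. F (insert v A))"
  proof (intro finsum_reindex inj funcsetI)
    fix B assume "B \<in> insert v ` Pow {..<v}"
    then show "F B \<in> carrier R" using assms[of B] by (auto simp: lessThan_Suc)
  qed
  finally show ?thesis .
qed

section \<open>The sum of the vectors\<close>

definition subset_sum :: "nat \<Rightarrow> nat \<Rightarrow> 'a" where
  "subset_sum v x = (\<Oplus>A\<in>Pow {..<v}. evec A x)"

lemma vec_subset_sum [simp]: "vec (subset_sum v)"
  by (auto simp: vec_def subset_sum_def intro!: finsum_closed)

lemma subset_sum_0: "x < W \<Longrightarrow> subset_sum 0 x = (if 2 ^ k dvd x then \<one> else \<zero>)"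
  by (simp add: subset_sum_def evec_empty Pi_def)

lemma subset_sum_Suc:
  assumes "x < W" "v < n"
  shows "subset_sum (Suc v) x = subset_sum v x \<oplus> step v (subset_sum v) x"
proof -
  have "subset_sum (Suc v) x = subset_sum v x \<oplus> (\<Oplus>A\<in>Pow {..<v}. evec (insert v A) x)"
    unfolding subset_sum_def using assms by (intro finsum_Pow_Suc) auto
  also have "(\<Oplus>A\<in>Pow {..<v}. evec (insert v A) x) = (\<Oplus>A\<in>Pow {..<v}. step v (evec A) x)"
    using assms by (intro finsum_cong') (auto simp: evec_insert)
  also have "\<dots> = step v (subset_sum v) x"
    unfolding subset_sum_def using assms by (subst step_finsum) auto
  finally show ?thesis .
qed

lemma top_sum_subset_sum:
  "top_sum (subset_sum n) = multilinear_coeff_sum R n k (circuit_poly R n k s a)"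
  unfolding multilinear_coeff_sum_eq top_sum_def subset_sum_def by (intro finsum_swap) auto

section \<open>The Gram matrix of the vectors\<close>

definition gram :: "nat \<Rightarrow> nat \<Rightarrow> nat \<Rightarrow> 'a" where
  "gram v x y = (\<Oplus>A\<in>Pow {..<v}. evec A x \<otimes> evec A y)"

lemma gram_closed [simp]: "x < W \<Longrightarrow> y < W \<Longrightarrow> gram v x y \<in> carrier R"
  by (auto simp: gram_def intro!: finsum_closed)

lemma vec_gram [simp]: "x < W \<Longrightarrow> vec (gram v x)"
  by (simp add: vec_def)

lemma gram_0: "x < W \<Longrightarrow> y < W \<Longrightarrow> gram 0 x y = (if 2 ^ k dvd x \<and> 2 ^ k dvd y then \<one> else \<zero>)"
  by (simp add: gram_def evec_empty Pi_def)

text \<open>Inserting \<open>v\<close> applies \<open>M\<^sub>v\<close> to both factors of each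
  rank-one term. In the nested form the inner \<open>step\<close> acts on the second index and the
  outer one on the first.\<close>

lemma gram_Suc:
  assumes "x < W" "y < W" "v < n"
  shows "gram (Suc v) x y = gram v x y \<oplus> step v (\<lambda>x'. step v (gram v x') y) x"
proof -
  have inner: "step v (gram v x') y = (\<Oplus>A\<in>Pow {..<v}. evec A x' \<otimes> step v (evec A) y)"
    if "x' < W" for x'
  proof -
    have "step v (gram v x') y = (\<Oplus>A\<in>Pow {..<v}. step v (\<lambda>y. evec A x' \<otimes> evec A y) y)"
      unfolding gram_def using assms that by (subst step_finsum) (auto simp: vec_def)
    also have "\<dots> = (\<Oplus>A\<in>Pow {..<v}. evec A x' \<otimes> step v (evec A) y)"
    proof (rule finsum_cong')
      fix A
      have "step v (\<lambda>y. evec A x' \<otimes> evec A y) y = step v (\<lambda>y. evec A y \<otimes> evec A x') y"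
        using assms that by (intro step_cong) (auto simp: vec_def m_comm)
      then show "step v (\<lambda>y. evec A x' \<otimes> evec A y) y = evec A x' \<otimes> step v (evec A) y"
        using assms that by (simp add: step_scale m_comm)
    qed (use assms that in auto)
    finally show ?thesis .
  qed
  have "step v (\<lambda>x'. step v (gram v x') y) x =
      step v (\<lambda>x'. \<Oplus>A\<in>Pow {..<v}. evec A x' \<otimes> step v (evec A) y) x"
    using assms inner by (intro step_cong) (auto simp: vec_def intro!: finsum_closed)
  also have "\<dots> = (\<Oplus>A\<in>Pow {..<v}. step v (\<lambda>x'. evec A x' \<otimes> step v (evec A) y) x)"
    using assms by (intro step_finsum) (auto simp: vec_def)
  also have "\<dots> = (\<Oplus>A\<in>Pow {..<v}. evec (insert v A) x \<otimes> evec (insert v A) y)"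
    using assms by (intro finsum_cong') (auto simp: step_scale evec_insert)
  finally have step: "step v (\<lambda>x'. step v (gram v x') y) x =
      (\<Oplus>A\<in>Pow {..<v}. evec (insert v A) x \<otimes> evec (insert v A) y)" .
  show ?thesis
    unfolding step unfolding gram_def using assms by (intro finsum_Pow_Suc) auto
qed

text \<open>The quadratic form of \<open>G\<close> evaluated at the functional
  \<open>top_sum\<close>: every rank-one term contributes a square.\<close>

lemma top_sum_gram:
  "(\<Oplus>i\<in>{..<s}. \<Oplus>i'\<in>{..<s}. gram n (full i) (full i')) =
    (\<Oplus>A\<in>Pow {..<n}. top_sum (evec A) \<otimes> top_sum (evec A))"
proof -
  have "(\<Oplus>i'\<in>{..<s}. gram n (full i) (full i')) =
      (\<Oplus>A\<in>Pow {..<n}. evec A (full i) \<otimes> top_sum (evec A))" if "i < s" for i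
  proof -
    have "(\<Oplus>i'\<in>{..<s}. gram n (full i) (full i')) =
        (\<Oplus>A\<in>Pow {..<n}. \<Oplus>i'\<in>{..<s}. evec A (full i) \<otimes> evec A (full i'))"
      unfolding gram_def using that by (intro finsum_swap) auto
    also have "\<dots> = (\<Oplus>A\<in>Pow {..<n}. evec A (full i) \<otimes> top_sum (evec A))"
      unfolding top_sum_def using that
      by (intro finsum_cong') (auto simp: finsum_rdistr Pi_def intro!: finsum_closed)
    finally show ?thesis .
  qed
  then have "(\<Oplus>i\<in>{..<s}. \<Oplus>i'\<in>{..<s}. gram n (full i) (full i')) =
      (\<Oplus>i\<in>{..<s}. \<Oplus>A\<in>Pow {..<n}. evec A (full i) \<otimes> top_sum (evec A))"
    by (intro finsum_cong') (auto intro!: finsum_closed)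
  also have "\<dots> = (\<Oplus>A\<in>Pow {..<n}. \<Oplus>i\<in>{..<s}. evec A (full i) \<otimes> top_sum (evec A))"
    by (intro finsum_swap) auto
  also have "\<dots> = (\<Oplus>A\<in>Pow {..<n}. top_sum (evec A) \<otimes> top_sum (evec A))"
    by (intro finsum_cong') (auto simp: top_sum_def finsum_ldistr Pi_def intro!: finsum_closed)
  finally show ?thesis .
qed

section \<open>Spans, described by the linear functionals that vanish on them\<close>

definition linear_functional :: "((nat \<Rightarrow> 'a) \<Rightarrow> 'a) \<Rightarrow> bool" where
  "linear_functional \<psi> \<longleftrightarrow>
    (\<forall>f. vec f \<longrightarrow> \<psi> f \<in> carrier R) \<and>
    (\<forall>f g. vec f \<longrightarrow> (\<forall>x<W. f x = g x) \<longrightarrow> \<psi> f = \<psi> g) \<and>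
    (\<forall>c d f g. c \<in> carrier R \<longrightarrow> d \<in> carrier R \<longrightarrow> vec f \<longrightarrow> vec g \<longrightarrow>
       \<psi> (\<lambda>x. c \<otimes> f x \<ominus> d \<otimes> g x) = c \<otimes> \<psi> f \<ominus> d \<otimes> \<psi> g)"

lemma linear_functionalD:
  assumes "linear_functional \<psi>"
  shows "vec f \<Longrightarrow> \<psi> f \<in> carrier R"
    and "vec f \<Longrightarrow> (\<And>x. x < W \<Longrightarrow> f x = g x) \<Longrightarrow> \<psi> f = \<psi> g"
    and "c \<in> carrier R \<Longrightarrow> d \<in> carrier R \<Longrightarrow> vec f \<Longrightarrow> vec g \<Longrightarrow>
       \<psi> (\<lambda>x. c \<otimes> f x \<ominus> d \<otimes> g x) = c \<otimes> \<psi> f \<ominus> d \<otimes> \<psi> g"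
  using assms unfolding linear_functional_def by blast+

lemma linear_functional_zero:
  assumes "linear_functional \<psi>" "\<And>x. x < W \<Longrightarrow> f x = \<zero>"
  shows "\<psi> f = \<zero>"
proof -
  have f: "vec f" using assms(2) by (simp add: vec_def)
  have "\<psi> f = \<psi> (\<lambda>x. \<zero> \<otimes> f x \<ominus> \<zero> \<otimes> f x)"
    by (rule linear_functionalD(2)[OF assms(1) f]) (simp add: a_minus_def assms(2))
  also have "\<dots> = \<zero> \<otimes> \<psi> f \<ominus> \<zero> \<otimes> \<psi> f" by (rule linear_functionalD(3)[OF assms(1)]) (simp_all add: f)
  also have "\<dots> = \<zero>" using linear_functionalD(1)[OF assms(1) f] by (simp add: a_minus_def)
  finally show ?thesis .
qed

text \<open>The transpose of \<open>M\<^sub>v\<close> acting on functionals. A fact about all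
  functionals can hence be used at the composition with \<open>M\<^sub>v\<close> as well.\<close>

lemma linear_functional_step:
  assumes "linear_functional \<psi>" "v < n"
  shows "linear_functional (\<lambda>f. \<psi> (step v f))"
  unfolding linear_functional_def
proof (intro conjI allI impI)
  fix f assume "vec f"
  then show "\<psi> (step v f) \<in> carrier R" using assms(2) by (intro linear_functionalD(1)[OF assms(1)] vec_step)
next
  fix f g assume f: "vec f" "\<forall>x<W. f x = g x"
  then have g: "vec g" by (simp add: vec_def)
  show "\<psi> (step v f) = \<psi> (step v g)"
    by (rule linear_functionalD(2)[OF assms(1)]) (use assms(2) f g in \<open>auto intro: step_cong\<close>)
next
  fix c d f g assume *: "c \<in> carrier R" "d \<in> carrier R" "vec f" "vec g"
  have "\<psi> (step v (\<lambda>x. c \<otimes> f x \<ominus> d \<otimes> g x)) = \<psi> (\<lambda>x. c \<otimes> step v f x \<ominus> d \<otimes> step v g x)"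
    by (rule linear_functionalD(2)[OF assms(1)]) (use * assms(2) in \<open>auto simp: step_lincomb vec_def intro!: vec_step[unfolded vec_def, rule_format]\<close>)
  also have "\<dots> = c \<otimes> \<psi> (step v f) \<ominus> d \<otimes> \<psi> (step v g)"
    by (rule linear_functionalD(3)[OF assms(1)]) (use * assms(2) in simp_all)
  finally show "\<psi> (step v (\<lambda>x. c \<otimes> f x \<ominus> d \<otimes> g x)) = c \<otimes> \<psi> (step v f) \<ominus> d \<otimes> \<psi> (step v g)" .
qed

lemma linear_functional_top_sum: "linear_functional top_sum"
  unfolding linear_functional_def
proof (intro conjI allI impI)
  fix f g assume "vec f" "\<forall>x<W. f x = g x"
  then show "top_sum f = top_sum g"
    unfolding top_sum_def by (intro finsum_cong') (auto simp: vec_def)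
next
  fix c d f g assume *: "c \<in> carrier R" "d \<in> carrier R" "vec f" "vec g"
  then have "top_sum (\<lambda>x. c \<otimes> f x \<ominus> d \<otimes> g x) = (\<Oplus>i\<in>{..<s}. c \<otimes> f (full i) \<oplus> (\<ominus> d) \<otimes> g (full i))"
    unfolding top_sum_def by (intro finsum_cong') (auto simp: a_minus_def l_minus)
  also have "\<dots> = c \<otimes> top_sum f \<oplus> (\<ominus> d) \<otimes> top_sum g"
    unfolding top_sum_def using * by (subst finsum_addf) (auto simp: finsum_rdistr Pi_def)
  also have "\<dots> = c \<otimes> top_sum f \<ominus> d \<otimes> top_sum g"
    using * by (simp add: a_minus_def l_minus)
  finally show "top_sum (\<lambda>x. c \<otimes> f x \<ominus> d \<otimes> g x) = c \<otimes> top_sum f \<ominus> d \<otimes> top_sum g" .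
qed simp

text \<open>Over a field, a span of vectors of length \<open>W\<close> is determined by the
  functionals vanishing on it. Equality of spans can thus be expressed without any coefficients of
  linear combinations.\<close>

definition annihilates :: "((nat \<Rightarrow> 'a) \<Rightarrow> 'a) \<Rightarrow> (nat \<Rightarrow> nat \<Rightarrow> 'a) \<Rightarrow> bool" where
  "annihilates \<psi> r \<longleftrightarrow> (\<forall>q<W. \<psi> (r q) = \<zero>)"

text \<open>Triangular form with one slot per pivot column: row \<open>q\<close> starts at column
  \<open>q\<close>, and a zero pivot marks the slot as empty. Hence \<open>W\<close> rows always
  suffice.\<close>

definition reduced :: "(nat \<Rightarrow> nat \<Rightarrow> 'a) \<Rightarrow> bool" where
  "reduced r \<longleftrightarrow> (\<forall>q<W. (\<forall>y<q. r q y = \<zero>) \<and> (r q q = \<zero> \<longrightarrow> (\<forall>y<W. r q y = \<zero>)))"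

text \<open>Nothing is lost by overwriting row \<open>q\<close>: its pivot is zero, so in a reduced
  system the whole row is zero. The candidate moves into the row and leaves a zero vector
  behind.\<close>

lemma annihilates_store:
  assumes "linear_functional \<psi>" "reduced r" "q < W" "r q q = \<zero>" "vec x" "\<And>p. p < W \<Longrightarrow> vec (r p)"
    and r': "\<And>p y. p < W \<Longrightarrow> y < W \<Longrightarrow> r' p y = (if p = q then x y else r p y)"
    and x': "\<And>y. y < W \<Longrightarrow> x' y = \<zero>"
  shows "annihilates \<psi> r' \<and> \<psi> x' = \<zero> \<longleftrightarrow> annihilates \<psi> r \<and> \<psi> x = \<zero>"
proof -
  have rq: "\<psi> (r q) = \<zero>"
    by (rule linear_functional_zero[OF assms(1)]) (use assms(2-4) in \<open>auto simp: reduced_def\<close>)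
  have "\<psi> x = \<psi> (r' q)"
    by (rule linear_functionalD(2)[OF assms(1,5)]) (simp add: r' \<open>q < W\<close>)
  moreover have "\<psi> (r p) = \<psi> (r' p)" if "p < W" "p \<noteq> q" for p
    by (rule linear_functionalD(2)[OF assms(1) assms(6)[OF that(1)]]) (simp add: r' that)
  moreover have "\<psi> x' = \<zero>" by (rule linear_functional_zero[OF assms(1) x'])
  ultimately have "annihilates \<psi> r' \<and> \<psi> x' = \<zero> \<longleftrightarrow> (\<forall>p<W. \<psi> (if p = q then x else r p) = \<zero>)"
    unfolding annihilates_def by auto
  also have "\<dots> \<longleftrightarrow> annihilates \<psi> r \<and> \<psi> x = \<zero>"
    using rq \<open>q < W\<close> unfolding annihilates_def by (auto split: if_splits)
  finally show ?thesis .
qed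

lemma reduced_store:
  assumes "reduced r" "q < W" "x q \<noteq> \<zero>" "\<And>y. y < q \<Longrightarrow> x y = \<zero>"
    and r': "\<And>p y. p < W \<Longrightarrow> y < W \<Longrightarrow> r' p y = (if p = q then x y else r p y)"
  shows "reduced r'"
  unfolding reduced_def
proof (intro allI impI)
  fix p assume p: "p < W"
  show "(\<forall>y<p. r' p y = \<zero>) \<and> (r' p p = \<zero> \<longrightarrow> (\<forall>y<W. r' p y = \<zero>))"
  proof (cases "p = q")
    case True
    then have "r' p y = x y" if "y < W" for y using r'[OF p that] by simp
    with True assms(2-4) show ?thesis by simp
  next
    case False
    then have "r' p y = r p y" if "y < W" for y using r'[OF p that] by simp
    with assms(1) p show ?thesis unfolding reduced_def by simp
  qed
qed

text \<open>The hypothesis on \<open>r\<close> is used twice, for \<open>\<psi>\<close> and for its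
  composition with \<open>M\<^sub>v\<close>. The second use turns vanishing on the images of the
  rows into vanishing on the vectors of the sets that contain \<open>v\<close>.\<close>

lemma annihilates_stage:
  assumes "linear_functional \<psi>" "v < n" "\<And>q. q < W \<Longrightarrow> vec (r q)"
    and r: "\<And>\<psi>. linear_functional \<psi> \<Longrightarrow> annihilates \<psi> r \<longleftrightarrow> (\<forall>A\<subseteq>{..<v}. \<psi> (evec A) = \<zero>)"
    and r': "annihilates \<psi> r' \<longleftrightarrow> annihilates \<psi> r \<and> (\<forall>q<W. \<psi> (step v (r q)) = \<zero>)"
  shows "annihilates \<psi> r' \<longleftrightarrow> (\<forall>A\<subseteq>{..<Suc v}. \<psi> (evec A) = \<zero>)"
proof -
  have "(\<forall>q<W. \<psi> (step v (r q)) = \<zero>) \<longleftrightarrow> (\<forall>A\<subseteq>{..<v}. \<psi> (step v (evec A)) = \<zero>)"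
    using r[OF linear_functional_step[OF assms(1,2)]] by (simp add: annihilates_def)
  moreover have "\<psi> (step v (evec A)) = \<psi> (evec (insert v A))" if "A \<subseteq> {..<v}" for A
    by (rule linear_functionalD(2)[OF assms(1)]) (simp_all add: evec_insert that assms(2))
  moreover have "(\<forall>A\<subseteq>{..<Suc v}. P A) \<longleftrightarrow> (\<forall>A\<subseteq>{..<v}. P A) \<and> (\<forall>A\<subseteq>{..<v}. P (insert v A))" for P
  proof -
    have "(\<forall>A\<subseteq>{..<Suc v}. P A) \<longleftrightarrow> (\<forall>A\<in>Pow {..<Suc v}. P A)" by blast
    then show ?thesis unfolding Pow_lessThan_Suc by blast
  qed
  ultimately show ?thesis using r[OF assms(1)] r' by simp
qed

end

locale domain_circuit = circuit + domain R
begin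

text \<open>If \<open>\<psi>\<close> kills row \<open>q\<close>, then \<open>\<psi> x'\<close> is
  \<open>\<psi> x\<close> times the pivot. In a domain the nonzero pivot cancels, so no inverse is
  called for.\<close>

lemma annihilates_eliminate:
  assumes "linear_functional \<psi>" "q < W" "r q q \<noteq> \<zero>" "vec x" "vec (r q)" "d \<in> carrier R"
    and x': "\<And>y. y < W \<Longrightarrow> x' y = r q q \<otimes> x y \<ominus> d \<otimes> r q y"
  shows "annihilates \<psi> r \<and> \<psi> x' = \<zero> \<longleftrightarrow> annihilates \<psi> r \<and> \<psi> x = \<zero>"
proof -
  have "\<psi> x' = \<zero> \<longleftrightarrow> \<psi> x = \<zero>" if "annihilates \<psi> r"
  proof -
    have rq: "r q q \<in> carrier R" using assms(2,5) by simp
    have "\<psi> (\<lambda>y. r q q \<otimes> x y \<ominus> d \<otimes> r q y) = \<psi> x'"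
      by (rule linear_functionalD(2)[OF assms(1)]) (use assms(4-6) rq in \<open>simp_all add: vec_def x'\<close>)
    then have "\<psi> x' = r q q \<otimes> \<psi> x \<ominus> d \<otimes> \<psi> (r q)"
      using linear_functionalD(3)[OF assms(1) rq assms(6,4,5)] by simp
    also have "\<psi> (r q) = \<zero>" using that assms(2) by (simp add: annihilates_def)
    also have "r q q \<otimes> \<psi> x \<ominus> d \<otimes> \<zero> = r q q \<otimes> \<psi> x"
      using assms(6) rq linear_functionalD(1)[OF assms(1,4)] by (simp add: a_minus_def)
    finally show ?thesis
      using assms(3) rq linear_functionalD(1)[OF assms(1,4)] by (simp add: integral_iff)
  qed
  then show ?thesis by blast
qed

end

section \<open>Program fragments\<close>

text \<open>Cells \<open>0, 1, 2\<close> hold \<open>n, k, s\<close>; cells \<open>3\<close> to \<open>8\<close> are loop counters (\<open>6\<close> for the current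
  variable, \<open>5\<close> for a position \<open>x < W\<close>, \<open>4\<close> for a bit of it); cell \<open>20 + j\<close> holds \<open>2\<^sup>j\<close>. In the ring
  memory the input is followed by two scratch cells and the arrays.\<close>

definition pow2 :: "nexp \<Rightarrow> nexp" where
  "pow2 e = NMem (NAdd (NConst 20) e)"

definition width :: nexp where
  "width = NMul (V 2) (pow2 (V 1))"

definition acc_addr :: nexp where
  "acc_addr = NMul (NMul (V 2) (V 1)) (V 0)"

definition tmp_addr :: nexp where
  "tmp_addr = NAdd acc_addr (NConst 1)"

definition base :: nexp where
  "base = NAdd acc_addr (NConst 2)"

definition full_pos :: "nexp \<Rightarrow> nexp" where
  "full_pos e = NAdd (NMul e (pow2 (V 1))) (NSub (pow2 (V 1)) (NConst 1))"

text \<open>The machine has no exponentiation; the powers of two that address single bits are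
  tabulated by doubling.\<close>

definition powers_prog :: com where
  "powers_prog = Seq (NStore (NConst 20) (NConst 1))
     (For 3 (V 1) (NStore (NAdd (NConst 21) (V 3)) (NMul (NConst 2) (pow2 (V 3)))))"

text \<open>There is no remainder operation either: the parity of \<open>q\<close> is
  \<open>q\<close> minus twice its half.\<close>

definition bit_test :: bexp where
  "bit_test = (let q = NDiv (V 5) (pow2 (V 4))
     in NLess (NConst 0) (NSub q (NMul (NConst 2) (NDiv q (NConst 2)))))"

definition gate_coeff :: rexp where
  "gate_coeff = RMem (NAdd (NMul (NAdd (NMul (NDiv (V 5) (pow2 (V 1))) (V 1)) (V 4)) (V 0)) (V 6))"

definition add_term :: "nexp \<Rightarrow> nexp \<Rightarrow> nexp \<Rightarrow> com" where
  "add_term d st e = RStore (NAdd d (NMul st (V 5))) (RAdd (RMem (NAdd d (NMul st (V 5))))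
     (RMul gate_coeff (RMem (NAdd e (NMul st (NSub (V 5) (pow2 (V 4))))))))"

definition add_term_weight :: "nexp \<Rightarrow> nexp \<Rightarrow> nexp \<Rightarrow> nat" where
  "add_term_weight d st e = 1 + nexp_weight (NAdd d (NMul st (V 5))) +
     rexp_weight (RAdd (RMem (NAdd d (NMul st (V 5))))
       (RMul gate_coeff (RMem (NAdd e (NMul st (NSub (V 5) (pow2 (V 4))))))))"

text \<open>Applies \<^const>\<open>circuit.step\<close> to the vector stored from \<open>e\<close> on with stride \<open>st\<close>; the result goes
  to \<open>d\<close> with the same stride.\<close>

definition step_prog :: "nexp \<Rightarrow> nexp \<Rightarrow> nexp \<Rightarrow> com" where
  "step_prog d st e = For 5 width (Seq (RStore (NAdd d (NMul st (V 5))) RZero)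
     (For 4 (V 1) (If bit_test (add_term d st e) Skip)))"

definition step_time :: "nexp \<Rightarrow> nexp \<Rightarrow> nexp \<Rightarrow> nat \<Rightarrow> nat \<Rightarrow> nat" where
  "step_time d st e w k = Suc w *
     (1 + nexp_weight (NAdd d (NMul st (V 5))) + rexp_weight RZero +
      Suc k * (1 + bexp_weight bit_test + (add_term_weight d st e + 1) + for_weight 4 (V 1)) +
      for_weight 5 width)"

definition powers_time :: "nat \<Rightarrow> nat" where
  "powers_time k = 1 + nexp_weight (NConst 20) + nexp_weight (NConst 1) +
     Suc k * (1 + nexp_weight (NAdd (NConst 21) (V 3)) +
       nexp_weight (NMul (NConst 2) (pow2 (V 3))) + for_weight 3 (V 1))"

definition sum_weight :: "nexp \<Rightarrow> rexp \<Rightarrow> nat" where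
  "sum_weight A r = 1 + nexp_weight A + rexp_weight (RAdd (RMem A) r)"

text \<open>The bounds on \<open>L\<close> cover all that is ever stored in a natural number cell:
  the parameters, the powers of two and the loop counters, which reach \<open>W * W\<close> when a
  whole matrix is traversed. Addresses occur only inside expressions and are never stored.\<close>

locale circuit_machine = bounded_machine + circuit +
  fixes b :: nat
  assumes coeff_size: "i < s \<Longrightarrow> j < k \<Longrightarrow> v < n \<Longrightarrow> sz (a i j v) \<le> b"
    and L_bounds: "n < 2 ^ L" "k < 2 ^ L" "s < 2 ^ L" "2 ^ k < (2 :: nat) ^ L" "W < 2 ^ L" "W * W < 2 ^ L"
begin

section \<open>Memory layout and the table of powers\<close>

definition env :: "(nat \<Rightarrow> nat) \<Rightarrow> bool" where
  "env \<rho> \<longleftrightarrow> \<rho> 0 = n \<and> \<rho> 1 = k \<and> \<rho> 2 = s \<and> (\<forall>j\<le>k. \<rho> (20 + j) = 2 ^ j)"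

definition acc :: nat where
  "acc = s * k * n"

lemma env_upd [simp]: "env \<rho> \<Longrightarrow> 2 < x \<Longrightarrow> x < 20 \<Longrightarrow> env (\<rho>(x := m))"
  by (auto simp: env_def)

lemma envD: "env \<rho> \<Longrightarrow> \<rho> 0 = n" "env \<rho> \<Longrightarrow> \<rho> 1 = k" "env \<rho> \<Longrightarrow> \<rho> (Suc 0) = k" "env \<rho> \<Longrightarrow> \<rho> 2 = s"
  "env \<rho> \<Longrightarrow> j \<le> k \<Longrightarrow> \<rho> (20 + j) = 2 ^ j"
  by (auto simp: env_def)

lemma nval_pow2 [simp]: "env \<rho> \<Longrightarrow> nval e (\<rho>, g) \<le> k \<Longrightarrow> nval (pow2 e) (\<rho>, g) = 2 ^ nval e (\<rho>, g)"
  by (simp add: pow2_def envD)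

lemma nval_width [simp]: "env \<rho> \<Longrightarrow> nval width (\<rho>, g) = W"
  by (simp add: width_def W_def envD)

lemma nval_acc_addr [simp]: "env \<rho> \<Longrightarrow> nval acc_addr (\<rho>, g) = acc"
  by (simp add: acc_addr_def acc_def envD)

lemma nval_tmp_addr [simp]: "env \<rho> \<Longrightarrow> nval tmp_addr (\<rho>, g) = Suc acc"
  by (simp add: tmp_addr_def)

lemma nval_base [simp]: "env \<rho> \<Longrightarrow> nval base (\<rho>, g) = acc + 2"
  by (simp add: base_def)

lemma nval_full_pos [simp]: "env \<rho> \<Longrightarrow> nval (full_pos e) (\<rho>, g) = full (nval e (\<rho>, g))"
  by (simp add: full_pos_def full_def envD)

lemma bval_bit_test [simp]:
  "env \<rho> \<Longrightarrow> \<rho> 4 < k \<Longrightarrow> bval R bit_test (\<rho>, g) \<longleftrightarrow> odd (\<rho> 5 div 2 ^ \<rho> 4)"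
  by (simp add: bit_test_def Let_def minus_mult_div_eq_mod odd_iff_mod_2_eq_one)

definition inp :: "(nat \<Rightarrow> 'a) \<Rightarrow> bool" where
  "inp g \<longleftrightarrow> (\<forall>i<s. \<forall>j<k. \<forall>v<n. g ((i * k + j) * n + v) = a i j v)"

lemma mult_add_less: "i < p \<Longrightarrow> j < q \<Longrightarrow> i * q + j < p * (q :: nat)"
proof -
  assume "i < p" "j < q"
  then have "i * q + j < Suc i * q" by simp
  also have "\<dots> \<le> p * q" using \<open>i < p\<close> by (intro mult_le_mono1) simp
  finally show ?thesis .
qed

lemma coeff_addr_less: "i < s \<Longrightarrow> j < k \<Longrightarrow> v < n \<Longrightarrow> (i * k + j) * n + v < acc"
  unfolding acc_def by (intro mult_add_less)

lemma inp_cong: "inp g0 \<Longrightarrow> (\<And>y. y < acc \<Longrightarrow> g y = g0 y) \<Longrightarrow> inp g"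
  by (simp add: inp_def coeff_addr_less)

lemma inp_writes: "inp g0 \<Longrightarrow> writes g0 d N h g \<Longrightarrow> (\<And>i. i < N \<Longrightarrow> acc \<le> d i) \<Longrightarrow> inp g"
proof (erule inp_cong)
  fix y assume "writes g0 d N h g" "\<And>i. i < N \<Longrightarrow> acc \<le> d i" "y < acc"
  then show "g y = g0 y" by (intro writesD(2)) fastforce+
qed

lemma triple_powers:
  assumes "\<rho> 0 = n" "\<rho> 1 = k" "\<rho> 2 = s" "\<rho> 3 = 0"
  shows "triple \<rho> I powers_prog (powers_time k) (\<lambda>y. if 20 \<le> y \<and> y \<le> 20 + k then 2 ^ (y - 20) else \<rho> y) I"
proof -
  let ?w = "(1 + nexp_weight (NAdd (NConst 21) (V 3)) + nexp_weight (NMul (NConst 2) (pow2 (V 3))))"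
  let ?store = "(NStore (NAdd (NConst 21) (V 3)) (NMul (NConst 2) (pow2 (V 3))))"
  let ?\<rho> = "\<lambda>i y. if 20 \<le> y \<and> y \<le> 20 + i then 2 ^ (y - 20) else \<rho> y"
  have 1: "triple \<rho> I (NStore (NConst 20) (NConst 1)) (1 + nexp_weight (NConst 20) + nexp_weight (NConst 1))
      (?\<rho> 0) I"
  proof -
    have "?\<rho> 0 = \<rho>(20 := 1)" by auto
    moreover have "(1 :: nat) < 2 ^ L"
      using L_bounds(4) by (metis le_less_trans one_le_numeral one_le_power)
    ultimately show ?thesis using triple_NStore[of "NConst 20" \<rho> 20 "NConst 1" 1 I] by simp
  qed
  have 2: "triple (?\<rho> 0) I (For 3 (V 1) ?store)
      (Suc k * (1 + nexp_weight (NAdd (NConst 21) (V 3)) +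
       nexp_weight (NMul (NConst 2) (pow2 (V 3))) + for_weight 3 (V 1))) (?\<rho> k) I"
  proof (rule triple_For_env[where \<rho> = ?\<rho> and I = "\<lambda>_. I"])
    fix i assume i: "i < k"
    let ?\<rho>i = "(?\<rho> i)(3 := i)"
    have upd: "(?\<rho> (Suc i))(3 := i) = ?\<rho>i(21 + i := 2 * 2 ^ i)" by auto
    have "2 * 2 ^ i \<le> (2 :: nat) ^ k" using i by (simp add: power_increasing flip: power_Suc)
    then have "2 * 2 ^ i < (2 :: nat) ^ L" using L_bounds(4) by (rule le_less_trans)
    then show "triple ?\<rho>i I ?store
        ?w
        ((?\<rho> (Suc i))(3 := i)) I"
      unfolding upd by (intro triple_NStore) (auto simp: pow2_def)
  qed (use assms L_bounds in auto)
  show ?thesis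
    unfolding powers_prog_def powers_time_def by (rule triple_Seq[OF 1 2])
qed

text \<open>The accumulator of the inner loop after the bits below \<open>J\<close>. The gate is
  still read off above bit \<open>k\<close>.\<close>

definition partial_step :: "nat \<Rightarrow> (nat \<Rightarrow> 'a) \<Rightarrow> nat \<Rightarrow> nat \<Rightarrow> 'a" where
  "partial_step v f J x = (\<Oplus>j\<in>bits_below J x. a (x div 2 ^ k) j v \<otimes> f (x - 2 ^ j))"

lemma partial_step_0: "partial_step v f 0 x = \<zero>"
  by (simp add: partial_step_def bits_below_def)

lemma partial_step_k: "partial_step v f k x = step v f x"
  by (simp add: partial_step_def step_def)

lemma partial_step_closed:
  assumes "x < W" "v < n" "vec f" "J \<le> k"
  shows "partial_step v f J x \<in> carrier R"
proof -
  have "bits_below J x \<subseteq> bits_below k x" using assms(4) by (auto simp: bits_below_def)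
  then show ?thesis
    unfolding partial_step_def using assms by (intro finsum_closed) (auto simp: vec_def)
qed

lemma partial_step_Suc:
  assumes "x < W" "v < n" "vec f" "J < k"
  shows "partial_step v f (Suc J) x = (if odd (x div 2 ^ J)
    then partial_step v f J x \<oplus> a (x div 2 ^ k) J v \<otimes> f (x - 2 ^ J) else partial_step v f J x)"
proof (cases "odd (x div 2 ^ J)")
  case True
  then have eq: "bits_below (Suc J) x = insert J (bits_below J x)"
    by (auto simp: bits_below_def less_Suc_eq)
  have sub: "insert J (bits_below J x) \<subseteq> bits_below k x"
    using assms(4) True by (auto simp: bits_below_def)
  have c: "a (x div 2 ^ k) j v \<otimes> f (x - 2 ^ j) \<in> carrier R" if "j \<in> insert J (bits_below J x)" for j
    using sub that assms by auto
  have "partial_step v f (Suc J) x = a (x div 2 ^ k) J v \<otimes> f (x - 2 ^ J) \<oplus> partial_step v f J x"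
    unfolding partial_step_def eq using c by (intro finsum_insert) (auto simp: bits_below_def)
  then show ?thesis
    using True c partial_step_closed[of x v f J] assms by (simp add: a_comm)
next
  case False
  then have "bits_below (Suc J) x = bits_below J x"
    by (auto simp: bits_below_def less_Suc_eq)
  then show ?thesis using False by (simp add: partial_step_def)
qed

text \<open>A product has at most \<open>b + z\<close> bits and each addition costs at most one
  more, so the growth is additive in \<open>z\<close>. Iterating over \<open>n\<close> variables
  thus keeps the bit length polynomial.\<close>

lemma partial_step_size:
  assumes "x < W" "v < n" "vec f" "J \<le> k" "\<And>y. y < W \<Longrightarrow> sz (f y) \<le> z"
  shows "sz (partial_step v f J x) \<le> z + b + 1 + J"
  using assms(4)
proof (induction J)
  case 0
  then show ?case using sz_zero by (simp add: partial_step_0)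
next
  case (Suc J)
  show ?case
  proof (cases "odd (x div 2 ^ J)")
    case True
    have x: "x - 2 ^ J < W" using assms(1) by simp
    have J: "J \<in> bits_below k x" using True Suc.prems by (simp add: bits_below_def)
    have "sz (a (x div 2 ^ k) J v \<otimes> f (x - 2 ^ J)) \<le> sz (a (x div 2 ^ k) J v) + sz (f (x - 2 ^ J))"
      using assms J x by (intro sz_mult) auto
    also have "\<dots> \<le> b + z"
      using assms x Suc.prems by (intro add_mono coeff_size gate_less) auto
    moreover have "sz (partial_step v f J x) \<le> z + b + 1 + J" using Suc by simp
    moreover have "sz (partial_step v f J x \<oplus> a (x div 2 ^ k) J v \<otimes> f (x - 2 ^ J)) \<le>
        max (sz (partial_step v f J x)) (sz (a (x div 2 ^ k) J v \<otimes> f (x - 2 ^ J))) + 1"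
      using assms(1-3) J x Suc.prems by (intro sz_add partial_step_closed m_closed) auto
    ultimately show ?thesis
      using partial_step_Suc[OF assms(1-3), of J] Suc.prems True by simp
  next
    case False
    then show ?thesis using partial_step_Suc[OF assms(1-3), of J] Suc by simp
  qed
qed

lemmas step_size = partial_step_size[where J = k, OF _ _ _ order_refl, unfolded partial_step_k]

text \<open>Describes accumulation: the last cell is rewritten in each inner round while the cells
  before it are final.\<close>

lemma writes_rewrite_last:
  assumes "writes g0 d (Suc i) (h(i := c)) g" "inj_on d {..i}"
  shows "writes g0 d (Suc i) (h(i := c')) (g(d i := c'))"
proof -
  have "d j \<noteq> d i" if "j < i" for j
    using inj_onD[OF assms(2), of j i] that by auto
  then show ?thesis using assms(1) by (auto simp: writes_def less_Suc_eq lessThan_Suc)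
qed

text \<open>The three address expressions must not depend on the counters \<open>4\<close> and
  \<open>5\<close>. Disjointness keeps the source intact while the target is filled, and
  \<open>acc \<le> D\<close> protects the coefficients of the circuit. With stride \<open>1\<close>
  a row is processed, with stride \<open>W\<close> a column.\<close>

lemma triple_step:
  assumes env: "env \<rho>" "\<rho> 4 = 0" "\<rho> 5 = 0" "\<rho> 6 = v" "v < n"
    and dse: "\<And>x j (g :: nat \<Rightarrow> 'a). nval d (\<rho>(5 := x, 4 := j), g) = D"
      "\<And>x j (g :: nat \<Rightarrow> 'a). nval st (\<rho>(5 := x, 4 := j), g) = S"
      "\<And>x j (g :: nat \<Rightarrow> 'a). nval e (\<rho>(5 := x, 4 := j), g) = E"
    and S: "S > 0" and D: "acc \<le> D"
    and dis: "\<And>x y. x < W \<Longrightarrow> y < W \<Longrightarrow> E + S * x \<noteq> D + S * y"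
    and g0: "inp g0" "ring_ok g0"
    and z: "\<And>x. x < W \<Longrightarrow> sz (g0 (E + S * x)) \<le> z" "z + b + 1 + k \<le> Z"
  shows "triple \<rho> (\<lambda>g. g = g0) (step_prog d st e) (step_time d st e W k) \<rho>
     (writes g0 (\<lambda>x. D + S * x) W (step v (\<lambda>x. g0 (E + S * x))))"
proof -
  let ?zero = "(RStore (NAdd d (NMul st (V 5))) RZero)"
  let ?sum = "(RAdd (RMem (NAdd d (NMul st (V 5)))) (RMul gate_coeff (RMem (NAdd e (NMul st (NSub (V 5) (pow2 (V 4))))))))"
  let ?loop = "(For 4 (V 1) (If bit_test (add_term d st e) Skip))"
  let ?f = "\<lambda>x. g0 (E + S * x)" and ?d = "\<lambda>x. D + S * x"
  let ?h = "step v ?f"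
  have f: "vec ?f" using g0(2) by (simp add: vec_def ring_ok_def)
  have inj: "inj_on ?d A" for A using S by (auto simp: inj_on_def)
  have dse0: "nval d (\<rho>(5 := x), g) = D" "nval st (\<rho>(5 := x), g) = S" "nval e (\<rho>(5 := x), g) = E"
    for x and g :: "nat \<Rightarrow> 'a"
    using dse[of x 0 g] env(2) by (simp_all add: fun_upd_idem)
  have size: "sz (partial_step v ?f J x) \<le> Z" if "x < W" "J \<le> k" for J x
    using partial_step_size[OF that(1) env(5) f that(2) z(1)] z(2) that(2) by simp
  have "triple \<rho> (writes g0 ?d 0 ?h) (step_prog d st e) (step_time d st e W k) \<rho> (writes g0 ?d W ?h)"
    unfolding step_prog_def step_time_def
  proof (rule triple_For)
    fix x assume x: "x < W"
    \<comment> \<open>The cells before \<open>x\<close> are final, and cell \<open>x\<close> holds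
      the sum over the bits below \<open>J\<close>.\<close>
    let ?\<rho> = "\<rho>(5 := x)" and ?I = "\<lambda>J. writes g0 ?d (Suc x) (?h(x := partial_step v ?f J x))"
    have 1: "triple ?\<rho> (writes g0 ?d x ?h) ?zero
        (1 + nexp_weight (NAdd d (NMul st (V 5))) + rexp_weight RZero) ?\<rho> (?I 0)"
    proof (rule triple_RStore)
      fix g assume g: "writes g0 ?d x ?h g"
      show "sz (rval R RZero (?\<rho>, g)) \<le> Z" using size[OF x, of 0] by (simp add: partial_step_0)
      have "writes g0 ?d x (?h(x := \<zero>)) g" using g by (auto simp: writes_def)
      then show "?I 0 (g(nval (NAdd d (NMul st (V 5))) (?\<rho>, g) := rval R RZero (?\<rho>, g)))"
        using writes_Suc[OF _ inj x, of g0 "?h(x := \<zero>)" g \<zero>] by (simp add: dse0 partial_step_0)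
    qed
    have 2: "triple ?\<rho> (?I 0) ?loop
        (Suc k * (1 + bexp_weight bit_test + (add_term_weight d st e + 1) + for_weight 4 (V 1))) ?\<rho> (?I k)"
    proof (rule triple_For)
      fix J assume J: "J < k"
      let ?\<rho>' = "?\<rho>(4 := J)"
      have env': "env ?\<rho>'" using env by simp
      show "triple ?\<rho>' (?I J) (If bit_test (add_term d st e) Skip)
          (1 + bexp_weight bit_test + (add_term_weight d st e + 1)) ?\<rho>' (?I (Suc J))"
      proof (rule triple_If)
        show "triple ?\<rho>' (\<lambda>g. ?I J g \<and> \<not> bval R bit_test (?\<rho>', g)) Skip 1 ?\<rho>' (?I (Suc J))"
          using J env' x f env(5) by (intro triple_Skip) (simp add: partial_step_Suc)
        show "triple ?\<rho>' (\<lambda>g. ?I J g \<and> bval R bit_test (?\<rho>', g)) (add_term d st e)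
            (add_term_weight d st e) ?\<rho>' (?I (Suc J))"
          unfolding add_term_def add_term_weight_def
        proof (rule triple_RStore)
          fix g assume g: "?I J g \<and> bval R bit_test (?\<rho>', g)"
          then have odd: "odd (x div 2 ^ J)" using env' J by simp
          have inp: "inp g"
            by (rule inp_writes[OF g0(1) conjunct1[OF g]]) (use D in simp)
          have last: "g (D + S * x) = partial_step v ?f J x"
            using writesD(1)[OF conjunct1[OF g], of x] by simp
          \<comment> \<open>\<open>x - 2 ^ J\<close> is again a position below \<open>W\<close>, so
            disjointness shows that the source cell is unchanged.\<close>
          have src: "g (E + S * (x - 2 ^ J)) = g0 (E + S * (x - 2 ^ J))"
            by (rule writesD(2)[OF conjunct1[OF g]]) (use x in \<open>intro dis; simp\<close>)
          have coeff: "g (((x div 2 ^ k) * k + J) * n + v) = a (x div 2 ^ k) J v"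
            using inp J x env(5) gate_less by (simp add: inp_def)
          have val: "rval R ?sum (?\<rho>', g) = partial_step v ?f (Suc J) x"
            using env' J x f env last src coeff odd
            by (simp add: gate_coeff_def dse partial_step_Suc envD)
          show "sz (rval R ?sum (?\<rho>', g)) \<le> Z"
            unfolding val using size[OF x, of "Suc J"] J by simp
          show "?I (Suc J) (g(nval (NAdd d (NMul st (V 5))) (?\<rho>', g) := rval R ?sum (?\<rho>', g)))"
            unfolding val using writes_rewrite_last[OF conjunct1[OF g] inj] by (simp add: dse)
        qed
      qed
    qed (use env L_bounds(2) in \<open>simp_all add: envD\<close>)
    have k: "?h(x := partial_step v ?f k x) = ?h" by (simp add: partial_step_k fun_upd_idem)
    show "triple ?\<rho> (writes g0 ?d x ?h) (Seq ?zero
        ?loop) (1 + nexp_weight (NAdd d (NMul st (V 5))) + rexp_weight RZero +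
      Suc k * (1 + bexp_weight bit_test + (add_term_weight d st e + 1) + for_weight 4 (V 1))) ?\<rho> (writes g0 ?d (Suc x) ?h)"
      using triple_Seq[OF 1 2] unfolding k .
  qed (use env(1,3) L_bounds(5) in simp_all)
  then show ?thesis by (rule triple_conseq) (simp_all only: writes_0)
qed

lemma finsum_lessThan_Suc:
  assumes "\<And>i. i \<le> N \<Longrightarrow> t i \<in> carrier R"
  shows "(\<Oplus>i\<in>{..<Suc N}. t i) = (\<Oplus>i\<in>{..<N}. t i) \<oplus> t N"
proof -
  have "(\<Oplus>i\<in>{..<Suc N}. t i) = t N \<oplus> (\<Oplus>i\<in>{..<N}. t i)"
    unfolding lessThan_Suc using assms by (intro finsum_insert) auto
  also have "\<dots> = (\<Oplus>i\<in>{..<N}. t i) \<oplus> t N"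
    using assms by (intro a_comm) (auto intro!: finsum_closed)
  finally show ?thesis .
qed

text \<open>The summands are evaluated for an arbitrary content \<open>c\<close> of the accumulator,
  since they are read while it changes. Each of the \<open>N\<close> additions adds at most one
  bit.\<close>

lemma triple_sum:
  assumes "\<And>i (g :: nat \<Rightarrow> 'a). i \<le> N \<Longrightarrow> nval e (\<rho>(x := i), g) = N" "N < 2 ^ L" "\<rho> x = 0"
    and A: "\<And>i (g :: nat \<Rightarrow> 'a). i < N \<Longrightarrow> nval A (\<rho>(x := i), g) = \<alpha>"
    and t: "\<And>i c. i < N \<Longrightarrow> rval R r (\<rho>(x := i), g0(\<alpha> := c)) = t i" "\<And>i. i < N \<Longrightarrow> t i \<in> carrier R"
      "\<And>i. i < N \<Longrightarrow> sz (t i) \<le> z"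
    and c: "c \<in> carrier R" "sz c \<le> z"
    and z: "z + N \<le> Z"
  shows "triple \<rho> (\<lambda>g. g = g0(\<alpha> := c)) (For x e (RStore A (RAdd (RMem A) r)))
    (Suc N * (sum_weight A r + for_weight x e)) \<rho>
    (\<lambda>g. g = g0(\<alpha> := c \<oplus> (\<Oplus>i\<in>{..<N}. t i)) \<and> sz (c \<oplus> (\<Oplus>i\<in>{..<N}. t i)) \<le> z + N)"
proof -
  let ?p = "\<lambda>i. c \<oplus> (\<Oplus>j\<in>{..<i}. t j)"
  let ?I = "\<lambda>i g. g = g0(\<alpha> := ?p i) \<and> sz (?p i) \<le> z + i"
  have p: "(\<Oplus>j\<in>{..<i}. t j) \<in> carrier R" if "i \<le> N" for i
    using t(2) that by (intro finsum_closed) auto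
  have "triple \<rho> (?I 0) (For x e (RStore A (RAdd (RMem A) r)))
      (Suc N * (sum_weight A r + for_weight x e)) \<rho> (?I N)"
  proof (rule triple_For[OF assms(1-3)])
    fix i assume i: "i < N"
    have "(\<Oplus>j\<in>{..<Suc i}. t j) = (\<Oplus>j\<in>{..<i}. t j) \<oplus> t i"
      using t(2) i by (intro finsum_lessThan_Suc) auto
    then have Suc: "?p i \<oplus> t i = ?p (Suc i)" using c(1) p[of i] t(2)[OF i] i by (simp add: a_assoc)
    show "triple (\<rho>(x := i)) (?I i) (RStore A (RAdd (RMem A) r)) (sum_weight A r) (\<rho>(x := i)) (?I (Suc i))"
      unfolding sum_weight_def
    proof (rule triple_RStore)
      fix g assume g: "?I i g"
      have val: "rval R (RAdd (RMem A) r) (\<rho>(x := i), g) = ?p (Suc i)"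
        using g A[OF i] t(1)[OF i] Suc by simp
      have size: "sz (?p (Suc i)) \<le> z + Suc i"
      proof -
        have "max (sz (?p i)) (sz (t i)) \<le> z + i" using g t(3)[OF i] by simp
        moreover have "sz (?p i \<oplus> t i) \<le> max (sz (?p i)) (sz (t i)) + 1"
          using t(2)[OF i] c(1) p[of i] i by (intro sz_add) auto
        ultimately show ?thesis unfolding Suc by linarith
      qed
      show "sz (rval R (RAdd (RMem A) r) (\<rho>(x := i), g)) \<le> Z"
        unfolding val using size i z by simp
      show "?I (Suc i) (g(nval A (\<rho>(x := i), g) := rval R (RAdd (RMem A) r) (\<rho>(x := i), g)))"
        unfolding val using size g A[OF i] by simp
    qed
  qed
  then show ?thesis by (rule triple_conseq) (use c in simp_all)
qed

end

section \<open>The sum of the multilinear coefficients\<close>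

definition add_prog :: "nexp \<Rightarrow> nexp \<Rightarrow> nexp \<Rightarrow> com" where
  "add_prog N d e = For 7 N (RStore (NAdd d (V 7)) (RAdd (RMem (NAdd d (V 7))) (RMem (NAdd e (V 7)))))"

definition add_weight :: "nexp \<Rightarrow> nexp \<Rightarrow> nexp \<Rightarrow> nat" where
  "add_weight N d e = 1 + nexp_weight (NAdd d (V 7)) +
     rexp_weight (RAdd (RMem (NAdd d (V 7))) (RMem (NAdd e (V 7)))) + for_weight 7 N"

text \<open>Stores the vector of the empty set: only the empty product, at the multiples of
  \<open>2 ^ k\<close>, has a constant term. The zeros are already in memory.\<close>

definition init_prog :: com where
  "init_prog = For 3 (V 2) (RStore (NAdd base (NMul (V 3) (pow2 (V 1)))) ROne)"

definition init_weight :: nat where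
  "init_weight = 1 + nexp_weight (NAdd base (NMul (V 3) (pow2 (V 1)))) + rexp_weight ROne + for_weight 3 (V 2)"

definition sum_loop :: com where
  "sum_loop = For 6 (V 0) (Seq (step_prog (NAdd base width) (NConst 1) base)
     (add_prog width base (NAdd base width)))"

text \<open>The result is formed in a scratch cell and moved to ring cell \<open>0\<close> at the
  very end, because that cell belongs to the input when the input is nonempty.\<close>

definition sum_prog :: com where
  "sum_prog = Seq powers_prog (Seq init_prog (Seq sum_loop
     (Seq (For 3 (V 2) (RStore acc_addr (RAdd (RMem acc_addr) (RMem (NAdd base (full_pos (V 3)))))))
       (RStore (NConst 0) (RMem acc_addr)))))"

definition sum_time :: "nat \<Rightarrow> nat \<Rightarrow> nat \<Rightarrow> nat \<Rightarrow> nat" where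
  "sum_time n k s w = powers_time k + (Suc s * init_weight +
     (Suc n * ((step_time (NAdd base width) (NConst 1) base w k +
        Suc w * add_weight width base (NAdd base width)) + for_weight 6 (V 0)) +
     (Suc s * (sum_weight acc_addr (RMem (NAdd base (full_pos (V 3)))) + for_weight 3 (V 2)) +
       (1 + nexp_weight (NConst 0) + rexp_weight (RMem acc_addr)))))"

context circuit_machine
begin

lemma triple_add:
  assumes "\<And>i (g :: nat \<Rightarrow> 'a). i \<le> m \<Longrightarrow> nval N (\<rho>(7 := i), g) = m" "m < 2 ^ L" "\<rho> 7 = 0"
    and d: "\<And>i (g :: nat \<Rightarrow> 'a). nval d (\<rho>(7 := i), g) = D"
    and e: "\<And>i (g :: nat \<Rightarrow> 'a). nval e (\<rho>(7 := i), g) = E"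
    and "D + m \<le> E" and g0: "ring_ok g0"
    and z: "\<And>i. i < m \<Longrightarrow> sz (g0 (D + i)) \<le> z" "\<And>i. i < m \<Longrightarrow> sz (g0 (E + i)) \<le> z" "z + 1 \<le> Z"
  shows "triple \<rho> (\<lambda>g. g = g0) (add_prog N d e) (Suc m * add_weight N d e) \<rho>
    (writes g0 (\<lambda>i. D + i) m (\<lambda>i. g0 (D + i) \<oplus> g0 (E + i)))"
  unfolding add_prog_def add_weight_def
proof (rule triple_map[OF assms(1-3)])
  fix i and g :: "nat \<Rightarrow> 'a"
  assume i: "i < m" and w: "writes g0 (\<lambda>i. D + i) i (\<lambda>i. g0 (D + i) \<oplus> g0 (E + i)) g"
  have "g (D + i) = g0 (D + i)" "g (E + i) = g0 (E + i)"
    by (rule writesD(2)[OF w]; use assms(6) i in simp)+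
  moreover have "sz (g0 (D + i) \<oplus> g0 (E + i)) \<le> max (sz (g0 (D + i))) (sz (g0 (E + i))) + 1"
    by (intro sz_add ring_okD(1)[OF g0])
  ultimately show "rval R (RAdd (RMem (NAdd d (V 7))) (RMem (NAdd e (V 7)))) (\<rho>(7 := i), g) =
      g0 (D + i) \<oplus> g0 (E + i) \<and> sz (g0 (D + i) \<oplus> g0 (E + i)) \<le> Z"
    using z(1,2)[OF i] z(3) d[of i g] e[of i g] by simp
qed (use d in auto)

definition start :: "(nat \<Rightarrow> 'a) \<Rightarrow> bool" where
  "start g \<longleftrightarrow> inp g \<and> (\<forall>y\<ge>acc. g y = \<zero>)"

lemma dvd_less_W:
  assumes "2 ^ k dvd x" "x < W"
  obtains i where "i < s" "x = i * 2 ^ k"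
  using assms gate_less by (metis dvd_div_mult_self)

text \<open>The zeros behind the first \<open>W\<close> cells are recorded for the basis program,
  whose other rows must start out empty.\<close>

lemma triple_init:
  assumes "env \<rho>" "\<rho> 3 = 0" "start g0" "1 \<le> Z"
  shows "triple \<rho> (\<lambda>g. g = g0) init_prog (Suc s * init_weight) \<rho>
    (\<lambda>g. inp g \<and> g acc = \<zero> \<and> (\<forall>x<W. g (acc + 2 + x) = evec {} x) \<and>
      (\<forall>y\<ge>acc + 2 + W. g y = \<zero>))"
proof -
  have "triple \<rho> (\<lambda>g. g = g0) init_prog (Suc s * init_weight) \<rho>
      (writes g0 (\<lambda>i. acc + 2 + i * 2 ^ k) s (\<lambda>_. \<one>))"
    unfolding init_prog_def init_weight_def
    by (rule triple_map) (use assms sz_one L_bounds in \<open>auto simp: envD inj_on_def\<close>)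
  then show ?thesis
  proof (rule triple_conseq)
    fix g assume w: "writes g0 (\<lambda>i. acc + 2 + i * 2 ^ k) s (\<lambda>_. \<one>) g"
    have "g (acc + 2 + x) = evec {} x" if x: "x < W" for x
    proof (cases "2 ^ k dvd x")
      case True
      from dvd_less_W[OF this x] obtain i where i: "i < s" "x = i * 2 ^ k" .
      then show ?thesis using writesD(1)[OF w i(1)] x by (simp add: evec_empty)
    next
      case False
      have "g (acc + 2 + x) = g0 (acc + 2 + x)" by (rule writesD(2)[OF w]) (use False in auto)
      then show ?thesis using False assms(3) x by (simp add: evec_empty start_def)
    qed
    moreover have "g acc = g0 acc" by (rule writesD(2)[OF w]) simp
    moreover have "g y = g0 y" if "y \<ge> acc + 2 + W" for y
    proof (rule writesD(2)[OF w])
      fix i assume "i < s"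
      then have "i * 2 ^ k < W" by (simp add: W_def)
      then show "y \<noteq> acc + 2 + i * 2 ^ k" using that by simp
    qed
    moreover have "inp g" by (rule inp_writes[OF _ w]) (use assms(3) in \<open>simp_all add: start_def\<close>)
    ultimately show "inp g \<and> g acc = \<zero> \<and> (\<forall>x<W. g (acc + 2 + x) = evec {} x) \<and>
        (\<forall>y\<ge>acc + 2 + W. g y = \<zero>)"
      using assms(3) by (simp add: start_def)
  qed
qed

text \<open>Growth per variable: \<open>b + k + 1\<close> bits for applying \<open>M\<^sub>v\<close>
  and one for the addition.\<close>

definition sum_inv :: "nat \<Rightarrow> (nat \<Rightarrow> 'a) \<Rightarrow> bool" where
  "sum_inv v g \<longleftrightarrow> inp g \<and> g acc = \<zero> \<and>
    (\<forall>x<W. g (acc + 2 + x) = subset_sum v x \<and> sz (subset_sum v x) \<le> 1 + v * (b + k + 2))"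

lemma triple_sum_stage:
  assumes env: "env \<rho>" "\<rho> 4 = 0" "\<rho> 5 = 0" "\<rho> 6 = v" "\<rho> 7 = 0" "v < n"
    and Z: "1 + n * (b + k + 2) \<le> Z"
  shows "triple \<rho> (sum_inv v) (Seq (step_prog (NAdd base width) (NConst 1) base)
     (add_prog width base (NAdd base width)))
     (step_time (NAdd base width) (NConst 1) base W k + Suc W * add_weight width base (NAdd base width))
     \<rho> (sum_inv (Suc v))"
proof (rule triple_ghost)
  fix g0 assume g0: "ring_ok g0" "sum_inv v g0"
  let ?P = "(Seq (step_prog (NAdd base width) (NConst 1) base) (add_prog width base (NAdd base width)))"
  let ?T = "(step_time (NAdd base width) (NConst 1) base W k + Suc W * add_weight width base (NAdd base width))"
  let ?Q = "(add_prog width base (NAdd base width))"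
  let ?U = "(Suc W * add_weight width base (NAdd base width))"
  let ?S = "(step_prog (NAdd base width) (NConst 1) base)"
  let ?z = "1 + v * (b + k + 2)"
  let ?h = "step v (subset_sum v)"
  have "Suc v * (b + k + 2) \<le> n * (b + k + 2)" using env(6) by (intro mult_le_mono1) simp
  then have z: "?z + (b + k + 2) \<le> Z" using Z by simp
  have inv: "inp g0" "g0 acc = \<zero>" "\<And>x. x < W \<Longrightarrow> g0 (acc + 2 + x) = subset_sum v x"
    "\<And>x. x < W \<Longrightarrow> sz (subset_sum v x) \<le> ?z"
    using g0(2) by (auto simp: sum_inv_def)
  have h: "step v (\<lambda>x. g0 (acc + 2 + 1 * x)) x = ?h x" if "x < W" for x
    using that env(6) inv(3) by (intro step_cong) auto
  have hsize: "sz (?h x) \<le> ?z + b + 1 + k" if "x < W" for x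
    using that env(6) inv(4) by (intro step_size) auto
  have 1: "triple \<rho> (\<lambda>g. g = g0) ?S
      (step_time (NAdd base width) (NConst 1) base W k) \<rho>
      (writes g0 (\<lambda>x. acc + 2 + W + 1 * x) W (step v (\<lambda>x. g0 (acc + 2 + 1 * x))))"
    by (rule triple_step[where z = ?z]) (use env g0 inv z in auto)
  have 2: "triple \<rho> (writes g0 (\<lambda>x. acc + 2 + W + 1 * x) W (step v (\<lambda>x. g0 (acc + 2 + 1 * x))))
      ?Q ?U
      \<rho> (sum_inv (Suc v))"
  proof (rule triple_ghost)
    fix g1 assume g1: "ring_ok g1"
      and w: "writes g0 (\<lambda>x. acc + 2 + W + 1 * x) W (step v (\<lambda>x. g0 (acc + 2 + 1 * x))) g1"
    have D: "g1 (acc + 2 + x) = subset_sum v x" if "x < W" for x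
    proof -
      have "g1 (acc + 2 + x) = g0 (acc + 2 + x)" by (rule writesD(2)[OF w]) (use that in simp)
      then show ?thesis using inv(3)[OF that] by simp
    qed
    have E: "g1 (acc + 2 + W + x) = ?h x" if "x < W" for x
      using writesD(1)[OF w that] h[OF that] by simp
    have acc: "g1 acc = \<zero>" using writesD(2)[OF w, of acc] inv(2) by simp
    have inp: "inp g1" by (rule inp_writes[OF inv(1) w]) simp
    have "triple \<rho> (\<lambda>g. g = g1) ?Q
        ?U \<rho>
        (writes g1 (\<lambda>i. acc + 2 + i) W (\<lambda>i. g1 (acc + 2 + i) \<oplus> g1 (acc + 2 + W + i)))"
    proof (rule triple_add[where z = "?z + b + 1 + k"])
      fix x assume x: "x < W"
      show "sz (g1 (acc + 2 + x)) \<le> ?z + b + 1 + k" using D[OF x] inv(4)[OF x] by simp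
      show "sz (g1 (acc + 2 + W + x)) \<le> ?z + b + 1 + k" using E[OF x] hsize[OF x] by simp
    qed (use env g1 z L_bounds in auto)
    then show "triple \<rho> (\<lambda>g. g = g1) ?Q
        ?U \<rho> (sum_inv (Suc v))"
    proof (rule triple_conseq)
      fix g assume w: "writes g1 (\<lambda>i. acc + 2 + i) W (\<lambda>i. g1 (acc + 2 + i) \<oplus> g1 (acc + 2 + W + i)) g"
      have "g (acc + 2 + x) = subset_sum (Suc v) x \<and> sz (subset_sum (Suc v) x) \<le> 1 + Suc v * (b + k + 2)"
        if x: "x < W" for x
      proof
        show "g (acc + 2 + x) = subset_sum (Suc v) x"
          using writesD(1)[OF w x] D[OF x] E[OF x] subset_sum_Suc[OF x env(6)] by simp
        have "sz (subset_sum v x \<oplus> ?h x) \<le> max (sz (subset_sum v x)) (sz (?h x)) + 1"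
          using x env(6) by (intro sz_add) auto
        then show "sz (subset_sum (Suc v) x) \<le> 1 + Suc v * (b + k + 2)"
          using subset_sum_Suc[OF x env(6)] inv(4)[OF x] hsize[OF x] by simp
      qed
      moreover have "g acc = \<zero>" using writesD(2)[OF w, of acc] acc by simp
      moreover have "inp g" by (rule inp_writes[OF inp w]) simp
      ultimately show "sum_inv (Suc v) g" unfolding sum_inv_def by blast
    qed
  qed
  show "triple \<rho> (\<lambda>g. g = g0) ?P
     ?T
     \<rho> (sum_inv (Suc v))"
    by (rule triple_Seq[OF 1 2])
qed

definition start_env :: "nat \<Rightarrow> nat" where
  "start_env = (\<lambda>_. 0)(0 := n, 1 := k, 2 := s)"

definition main_env :: "nat \<Rightarrow> nat" where
  "main_env = (\<lambda>y. if 20 \<le> y \<and> y \<le> 20 + k then 2 ^ (y - 20) else start_env y)"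

lemma env_main: "env main_env"
  by (auto simp: env_def main_env_def start_env_def)

lemma main_env_counter: "2 < x \<Longrightarrow> x < 20 \<Longrightarrow> main_env x = 0"
  by (simp add: main_env_def start_env_def)

lemma triple_powers_main: "triple start_env I powers_prog (powers_time k) main_env I"
  unfolding main_env_def by (rule triple_powers) (simp_all add: start_env_def)

lemma triple_sum_prog:
  assumes Z: "1 + n * (b + k + 2) + s \<le> Z"
  shows "triple start_env start sum_prog (sum_time n k s W) main_env
    (\<lambda>g. g 0 = multilinear_coeff_sum R n k (circuit_poly R n k s a))"
proof -
  note env = env_main main_env_counter
  let ?final = "(For 3 (V 2) (RStore acc_addr (RAdd (RMem acc_addr) (RMem (NAdd base (full_pos (V 3)))))))"
  let ?ftime = "(Suc s * (sum_weight acc_addr (RMem (NAdd base (full_pos (V 3)))) + for_weight 3 (V 2)))"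
  let ?stage = "(Seq (step_prog (NAdd base width) (NConst 1) base) (add_prog width base (NAdd base width)))"
  let ?stime = "(step_time (NAdd base width) (NConst 1) base W k + Suc W * add_weight width base (NAdd base width))"
  let ?M = "multilinear_coeff_sum R n k (circuit_poly R n k s a)"
  have init: "triple main_env start init_prog (Suc s * init_weight) main_env (sum_inv 0)"
  proof (rule triple_ghost)
    fix g0 assume g0: "start g0"
    show "triple main_env (\<lambda>g. g = g0) init_prog (Suc s * init_weight) main_env (sum_inv 0)"
      by (rule triple_conseq[OF triple_init[OF env_main _ g0]])
        (use Z env sz_zero sz_one in \<open>auto simp: sum_inv_def subset_sum_0 evec_empty\<close>)
  qed
  have loop: "triple main_env (sum_inv 0) sum_loop (Suc n * (?stime + for_weight 6 (V 0))) main_env (sum_inv n)"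
    unfolding sum_loop_def
  proof (rule triple_For)
    fix v assume "v < n"
    then show "triple (main_env(6 := v)) (sum_inv v) ?stage
       ?stime
       (main_env(6 := v)) (sum_inv (Suc v))"
      using Z by (intro triple_sum_stage) (simp_all add: env)
  qed (use env L_bounds in \<open>auto simp: envD\<close>)
  have final: "triple main_env (sum_inv n)
      ?final
      ?ftime
      main_env (\<lambda>g. g acc = ?M)"
  proof (rule triple_ghost)
    fix g0 assume g0: "ring_ok g0" "sum_inv n g0"
    then have g0': "g0 = g0(acc := \<zero>)" "\<And>i. i < s \<Longrightarrow> g0 (acc + 2 + full i) = subset_sum n (full i)"
      "\<And>i. i < s \<Longrightarrow> sz (subset_sum n (full i)) \<le> 1 + n * (b + k + 2)"
      by (auto simp: sum_inv_def)
    have closed: "\<zero> \<oplus> (\<Oplus>i\<in>{..<s}. subset_sum n (full i)) = ?M"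
      unfolding top_sum_subset_sum[symmetric] top_sum_def by (intro l_zero finsum_closed) auto
    have "triple main_env (\<lambda>g. g = g0(acc := \<zero>))
      ?final
      ?ftime
      main_env (\<lambda>g. g = g0(acc := \<zero> \<oplus> (\<Oplus>i\<in>{..<s}. subset_sum n (full i))) \<and>
         sz (\<zero> \<oplus> (\<Oplus>i\<in>{..<s}. subset_sum n (full i))) \<le> 1 + n * (b + k + 2) + s)"
      by (rule triple_sum) (use env g0' Z L_bounds sz_zero in \<open>auto simp: envD\<close>)
    then show "triple main_env (\<lambda>g. g = g0)
      ?final
      ?ftime
      main_env (\<lambda>g. g acc = ?M)"
      unfolding closed g0'(1)[symmetric] by (rule triple_conseq) simp_all
  qed
  have out: "triple main_env (\<lambda>g. g acc = ?M) (RStore (NConst 0) (RMem acc_addr))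
      (1 + nexp_weight (NConst 0) + rexp_weight (RMem acc_addr)) main_env (\<lambda>g. g 0 = ?M)"
  proof (rule triple_RStore)
    fix g assume "ring_ok g"
    then show "sz (rval R (RMem acc_addr) (main_env, g)) \<le> Z"
      using ring_okD(2)[of g acc] env_main by simp
  qed (use env_main in simp)
  show ?thesis
    unfolding sum_prog_def sum_time_def
    by (intro triple_Seq[OF triple_powers_main] triple_Seq[OF init] triple_Seq[OF loop] triple_Seq[OF final] out)
qed

end

section \<open>The sum of the squared multilinear coefficients\<close>

definition decide_prog :: com where
  "decide_prog = If (RIsZero (RMem acc_addr)) (NStore (NConst 0) (NConst 0)) (NStore (NConst 0) (NConst 1))"

definition decide_weight :: nat where
  "decide_weight = 1 + bexp_weight (RIsZero (RMem acc_addr)) +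
     ((1 + nexp_weight (NConst 0) + nexp_weight (NConst 0)) + (1 + nexp_weight (NConst 0) + nexp_weight (NConst 1)))"

text \<open>Each of the first two arrays has \<open>W * W\<close> cells. The Gram program keeps
  \<open>G\<close>, the intermediate product and the increment in the three arrays; the basis
  program keeps the rows, a copy of them and a single candidate vector.\<close>

definition array2 :: nexp where
  "array2 = NAdd base (NMul width width)"

definition array3 :: nexp where
  "array3 = NAdd array2 (NMul width width)"

definition gram_init_addr :: nexp where
  "gram_init_addr = NAdd base (NAdd (NMul (NMul (V 3) (pow2 (V 1))) width) (NMul (V 7) (pow2 (V 1))))"

definition gram_init :: com where
  "gram_init = For 3 (V 2) (For 7 (V 2) (RStore gram_init_addr ROne))"

definition gram_row :: com where
  "gram_row = step_prog (NAdd array2 (NMul (V 7) width)) (NConst 1) (NAdd base (NMul (V 7) width))"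

text \<open>The stride \<open>width\<close> presents a column of the matrix as a vector. After the
  rows, this completes the multiplication by \<open>M\<^sub>v\<close> from both sides.\<close>

definition gram_column :: com where
  "gram_column = step_prog (NAdd array3 (V 7)) width (NAdd array2 (V 7))"

definition gram_stage :: com where
  "gram_stage = Seq (For 7 width gram_row)
     (Seq (For 7 width gram_column) (add_prog (NMul width width) base array3))"

definition gram_entry :: rexp where
  "gram_entry = RMem (NAdd base (NAdd (NMul (full_pos (V 3)) width) (full_pos (V 7))))"

definition gram_prog :: com where
  "gram_prog = Seq powers_prog (Seq gram_init (Seq (For 6 (V 0) gram_stage)
     (For 3 (V 2) (For 7 (V 2) (RStore acc_addr (RAdd (RMem acc_addr) gram_entry))))))"

definition row_time :: "nat \<Rightarrow> nat \<Rightarrow> nat" where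
  "row_time w k = step_time (NAdd array2 (NMul (V 7) width)) (NConst 1) (NAdd base (NMul (V 7) width)) w k"

definition column_time :: "nat \<Rightarrow> nat \<Rightarrow> nat" where
  "column_time w k = step_time (NAdd array3 (V 7)) width (NAdd array2 (V 7)) w k"

definition gram_stage_time :: "nat \<Rightarrow> nat \<Rightarrow> nat" where
  "gram_stage_time w k = Suc w * (row_time w k + for_weight 7 width) +
     (Suc w * (column_time w k + for_weight 7 width) +
      Suc (w * w) * add_weight (NMul width width) base array3)"

definition gram_init_time :: "nat \<Rightarrow> nat" where
  "gram_init_time s = Suc s * (Suc s * (1 + nexp_weight gram_init_addr + rexp_weight ROne +
     for_weight 7 (V 2)) + for_weight 3 (V 2))"

definition gram_time :: "nat \<Rightarrow> nat \<Rightarrow> nat \<Rightarrow> nat \<Rightarrow> nat" where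
  "gram_time n k s w = powers_time k + (gram_init_time s + (Suc n * (gram_stage_time w k + for_weight 6 (V 0)) +
     Suc s * (Suc s * (sum_weight acc_addr gram_entry + for_weight 7 (V 2)) + for_weight 3 (V 2))))"

context circuit_machine
begin

lemma nval_array2 [simp]: "env \<rho> \<Longrightarrow> nval array2 (\<rho>, g) = acc + 2 + W * W"
  by (simp add: array2_def)

lemma nval_array3 [simp]: "env \<rho> \<Longrightarrow> nval array3 (\<rho>, g) = acc + 2 + W * W + W * W"
  by (simp add: array3_def)

text \<open>Per variable, \<open>M\<^sub>v\<close> is applied on both sides at
  \<open>b + k + 1\<close> bits each, and the addition costs one more.\<close>

definition gram_inv :: "nat \<Rightarrow> (nat \<Rightarrow> 'a) \<Rightarrow> bool" where
  "gram_inv v g \<longleftrightarrow> inp g \<and> g acc = \<zero> \<and> (\<forall>x<W. \<forall>y<W.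
    g (acc + 2 + (x * W + y)) = gram v x y \<and> sz (gram v x y) \<le> 1 + v * (2 * (b + k + 1) + 1))"

lemma s_less_W: "i < s \<Longrightarrow> i * 2 ^ k < W"
  by (simp add: W_def)

lemma triple_gram_init:
  assumes "env \<rho>" "\<rho> 3 = 0" "\<rho> 7 = 0" "1 \<le> Z"
  shows "triple \<rho> start gram_init (gram_init_time s) \<rho> (gram_inv 0)"
proof -
  let ?P = "(For 7 (V 2) (RStore gram_init_addr ROne))"
  let ?T = "(Suc s * (1 + nexp_weight gram_init_addr + rexp_weight ROne + for_weight 7 (V 2)))"
  \<comment> \<open>The entries of the gates below \<open>i\<close> are set. At \<open>i = s\<close>
    the last condition holds for every row and \<open>gram 0\<close> remains.\<close>
  let ?v = "\<lambda>i x y. if 2 ^ k dvd x \<and> 2 ^ k dvd y \<and> x div 2 ^ k < i then \<one> else \<zero>"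
  let ?I = "\<lambda>i g. inp g \<and> g acc = \<zero> \<and> (\<forall>x<W. \<forall>y<W. g (acc + 2 + (x * W + y)) = ?v i x y)"
  have "triple \<rho> (?I 0) gram_init (gram_init_time s) \<rho> (?I s)"
    unfolding gram_init_def gram_init_time_def
  proof (rule triple_For)
    fix i assume i: "i < s"
    let ?d = "\<lambda>j. acc + 2 + ((i * 2 ^ k) * W + j * 2 ^ k)"
    show "triple (\<rho>(3 := i)) (?I i) ?P
      ?T
      (\<rho>(3 := i)) (?I (Suc i))"
    proof (rule triple_ghost)
      fix g0 assume g0: "?I i g0"
      have "triple (\<rho>(3 := i)) (\<lambda>g. g = g0) ?P
        ?T
        (\<rho>(3 := i)) (writes g0 ?d s (\<lambda>_. \<one>))"
        by (rule triple_map) (use assms sz_one L_bounds in \<open>auto simp: envD inj_on_def gram_init_addr_def\<close>)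
      then show "triple (\<rho>(3 := i)) (\<lambda>g. g = g0) ?P
        ?T
        (\<rho>(3 := i)) (?I (Suc i))"
      proof (rule triple_conseq)
        fix g assume w: "writes g0 ?d s (\<lambda>_. \<one>) g"
        have "g (acc + 2 + (x * W + y)) = ?v (Suc i) x y" if xy: "x < W" "y < W" for x y
        proof (cases "2 ^ k dvd y \<and> x = i * 2 ^ k")
          case True
          from True xy(2) obtain j where j: "j < s" "y = j * 2 ^ k" using dvd_less_W by blast
          then show ?thesis using writesD(1)[OF w j(1)] True by simp
        next
          case False
          have "g (acc + 2 + (x * W + y)) = g0 (acc + 2 + (x * W + y))"
          proof (rule writesD(2)[OF w])
            fix j assume j: "j < s"
            show "acc + 2 + (x * W + y) \<noteq> ?d j"
            proof
              assume "acc + 2 + (x * W + y) = ?d j"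
              then have eq: "x * W + y = i * 2 ^ k * W + j * 2 ^ k" by simp
              \<comment> \<open>Division by \<open>W\<close> recovers both matrix indices from an
                address, so equal addresses force equal indices.\<close>
              have "(x * W + y) div W = x" "(x * W + y) mod W = y" using xy by auto
              moreover have "(i * 2 ^ k * W + j * 2 ^ k) div W = i * 2 ^ k"
                "(i * 2 ^ k * W + j * 2 ^ k) mod W = j * 2 ^ k"
                using s_less_W[OF j] by auto
              ultimately show False using False unfolding eq by auto
            qed
          qed
          also have "\<dots> = ?v i x y" using g0 xy by blast
          also have "\<dots> = ?v (Suc i) x y"
          proof -
            have "x div 2 ^ k \<noteq> i" if "2 ^ k dvd x" "2 ^ k dvd y" using that False by auto
            then show ?thesis by (auto simp: less_Suc_eq)
          qed
          finally show ?thesis .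
        qed
        moreover have "g acc = g0 acc" by (rule writesD(2)[OF w]) simp
        moreover have "inp g" by (rule inp_writes[OF _ w]) (use g0 in auto)
        ultimately show "?I (Suc i) g" using g0 by simp
      qed
    qed
  qed (use assms L_bounds in \<open>auto simp: envD\<close>)
  then show ?thesis
  proof (rule triple_conseq)
    fix g assume "?I s g"
    then show "gram_inv 0 g"
      using gate_less sz_zero sz_one by (auto simp: gram_inv_def gram_0)
  next
    fix g assume "start g"
    then show "?I 0 g" by (simp add: start_def)
  qed
qed

lemma triple_gram_stage:
  assumes env: "env \<rho>" "\<rho> 4 = 0" "\<rho> 5 = 0" "\<rho> 6 = v" "\<rho> 7 = 0" "v < n"
    and Z: "1 + n * (2 * (b + k + 1) + 1) \<le> Z"
  shows "triple \<rho> (gram_inv v) gram_stage (gram_stage_time W k) \<rho> (gram_inv (Suc v))"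
proof (rule triple_ghost)
  fix g0 assume g0: "ring_ok g0" "gram_inv v g0"
  let ?Add = "(add_prog (NMul width width) base array3)"
  let ?addtime = "(Suc (W * W) * add_weight (NMul width width) base array3)"
  let ?z = "1 + v * (2 * (b + k + 1) + 1)"
  let ?B = "acc + 2"
  let ?C = "acc + 2 + W * W"
  let ?D = "acc + 2 + W * W + W * W"
  have "Suc v * (2 * (b + k + 1) + 1) \<le> n * (2 * (b + k + 1) + 1)"
    using env(6) by (intro mult_le_mono1) simp
  then have z: "?z + (b + k + 1) + (b + k + 1) + 1 \<le> Z" using Z by simp
  have inv: "inp g0" "g0 acc = \<zero>" "\<And>x y. x < W \<Longrightarrow> y < W \<Longrightarrow> g0 (?B + (x * W + y)) = gram v x y"
    "\<And>x y. x < W \<Longrightarrow> y < W \<Longrightarrow> sz (gram v x y) \<le> ?z"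
    using g0(2) by (auto simp: gram_inv_def)
  have less: "x * W + y < W * W" if "x < W" "y < W" for x y
    using that by (rule mult_add_less)
  let ?r = "\<lambda>x y. step v (gram v x) y"
  have rsize: "sz (?r x y) \<le> ?z + b + 1 + k" if "x < W" "y < W" for x y
    using that env(6) inv(4) by (intro step_size) auto
  have vecr: "vec (\<lambda>x. ?r x y)" if "y < W" for y
    using that env(6) by (simp add: vec_def)
  let ?c = "\<lambda>x y. step v (\<lambda>x. ?r x y) x"
  have csize: "sz (?c x y) \<le> (?z + b + 1 + k) + b + 1 + k" if "x < W" "y < W" for x y
    by (rule step_size[OF that(1) env(6) vecr[OF that(2)] rsize[OF _ that(2)]])
  let ?I = "\<lambda>x g. (\<forall>p<?C. g p = g0 p) \<and> (\<forall>x'<x. \<forall>y<W. g (?C + (x' * W + y)) = ?r x' y)"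
  have 1: "triple \<rho> (?I 0) (For 7 width gram_row) (Suc W * (row_time W k + for_weight 7 width)) \<rho> (?I W)"
    unfolding gram_row_def row_time_def
  proof (rule triple_For)
    fix x assume x: "x < W"
    let ?\<rho> = "\<rho>(7 := x)"
    let ?P = "step_prog (NAdd array2 (NMul (V 7) width)) (NConst 1) (NAdd base (NMul (V 7) width))"
    let ?T = "step_time (NAdd array2 (NMul (V 7) width)) (NConst 1) (NAdd base (NMul (V 7) width)) W k"
    show "triple ?\<rho> (?I x) ?P ?T ?\<rho> (?I (Suc x))"
    proof (rule triple_ghost)
      fix g1 assume g1: "ring_ok g1" "?I x g1"
      have old: "g1 p = g0 p" if "p < ?C" for p using g1(2) that by blast
      have src: "g1 (?B + x * W + 1 * y) = gram v x y" if "y < W" for y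
        using old[of "?B + x * W + 1 * y"] less[OF x that] inv(3)[OF x that] by (simp add: add.assoc)
      have "triple ?\<rho> (\<lambda>g. g = g1) ?P ?T ?\<rho> (writes g1 (\<lambda>y. ?C + x * W + 1 * y) W (step v (\<lambda>y. g1 (?B + x * W + 1 * y))))"
      proof (rule triple_step[where z = ?z])
        fix y y' assume y: "y < W" "y' < W"
        then show "?B + x * W + 1 * y \<noteq> ?C + x * W + 1 * y'" using less[OF x y(1)] by simp
      next
        show "inp g1" by (rule inp_cong[OF inv(1) old]) simp
        show "sz (g1 (?B + x * W + 1 * y)) \<le> ?z" if "y < W" for y
          using src[OF that] inv(4)[OF x that] by simp
      qed (use env g1 z in auto)
      then show "triple ?\<rho> (\<lambda>g. g = g1) ?P ?T ?\<rho> (?I (Suc x))"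
      proof (rule triple_conseq)
        fix g assume w: "writes g1 (\<lambda>y. ?C + x * W + 1 * y) W (step v (\<lambda>y. g1 (?B + x * W + 1 * y))) g"
        have "g p = g0 p" if "p < ?C" for p
        proof -
          have "g p = g1 p" by (rule writesD(2)[OF w]) (use that in simp)
          then show ?thesis using old[OF that] by simp
        qed
        moreover have "g (?C + (x' * W + y)) = ?r x' y" if x': "x' < Suc x" and y: "y < W" for x' y
        proof (cases "x' = x")
          case True
          have "step v (\<lambda>y. g1 (?B + x * W + 1 * y)) y = ?r x y"
            using y env(6) x src by (intro step_cong) auto
          then show ?thesis using writesD(1)[OF w y] True by (simp add: add.assoc)
        next
          case False
          then have lt: "x' * W + y < x * W" using x' y by (intro mult_add_less) auto
          have "g (?C + (x' * W + y)) = g1 (?C + (x' * W + y))"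
            by (rule writesD(2)[OF w]) (use lt in simp)
          also have "\<dots> = ?r x' y" using g1(2) x' y False by (metis less_SucE)
          finally show ?thesis .
        qed
        ultimately show "?I (Suc x) g" by blast
      qed
    qed
  qed (use env L_bounds in auto)
  let ?J = "\<lambda>y g. (\<forall>p<?C. g p = g0 p) \<and> (\<forall>x<W. \<forall>y'<W. g (?C + (x * W + y')) = ?r x y') \<and>
    (\<forall>y'<y. \<forall>x<W. g (?D + (x * W + y')) = ?c x y')"
  have 2: "triple \<rho> (?J 0) (For 7 width gram_column) (Suc W * (column_time W k + for_weight 7 width)) \<rho> (?J W)"
    unfolding gram_column_def column_time_def
  proof (rule triple_For)
    fix y assume y: "y < W"
    let ?\<rho> = "\<rho>(7 := y)"
    let ?P = "step_prog (NAdd array3 (V 7)) width (NAdd array2 (V 7))"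
    let ?T = "step_time (NAdd array3 (V 7)) width (NAdd array2 (V 7)) W k"
    show "triple ?\<rho> (?J y) ?P ?T ?\<rho> (?J (Suc y))"
    proof (rule triple_ghost)
      fix g1 assume g1: "ring_ok g1" "?J y g1"
      have old: "g1 p = g0 p" if "p < ?C" for p using g1(2) that by blast
      have src: "g1 (?C + y + W * x) = ?r x y" if "x < W" for x
        using g1(2) that y by (simp add: algebra_simps)
      have "triple ?\<rho> (\<lambda>g. g = g1) ?P ?T ?\<rho> (writes g1 (\<lambda>x. ?D + y + W * x) W (step v (\<lambda>x. g1 (?C + y + W * x))))"
      proof (rule triple_step[where z = "?z + b + 1 + k"])
        fix x x' assume x: "x < W" "x' < W"
        then show "?C + y + W * x \<noteq> ?D + y + W * x'" using less[OF x(1) y] by (simp add: algebra_simps)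
      next
        show "inp g1" by (rule inp_cong[OF inv(1) old]) simp
        show "sz (g1 (?C + y + W * x)) \<le> ?z + b + 1 + k" if "x < W" for x
          using src[OF that] rsize[OF that y] by simp
      qed (use env g1 z y in auto)
      then show "triple ?\<rho> (\<lambda>g. g = g1) ?P ?T ?\<rho> (?J (Suc y))"
      proof (rule triple_conseq)
        fix g assume w: "writes g1 (\<lambda>x. ?D + y + W * x) W (step v (\<lambda>x. g1 (?C + y + W * x))) g"
        have low: "g p = g1 p" if "p < ?D" for p
          by (rule writesD(2)[OF w]) (use that in simp)
        have "g p = g0 p" if "p < ?C" for p
          using low[of p] old[OF that] that by simp
        moreover have "g (?C + (x * W + y')) = ?r x y'" if "x < W" "y' < W" for x y'
          using low[of "?C + (x * W + y')"] less[OF that] g1(2) that by simp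
        moreover have "g (?D + (x * W + y')) = ?c x y'" if y': "y' < Suc y" and x: "x < W" for x y'
        proof (cases "y' = y")
          case True
          have "step v (\<lambda>x. g1 (?C + y + W * x)) x = ?c x y"
            using x env(6) y src vecr by (intro step_cong) auto
          then show ?thesis using writesD(1)[OF w x] True by (simp add: algebra_simps)
        next
          case False
          have "g (?D + (x * W + y')) = g1 (?D + (x * W + y'))"
          proof (rule writesD(2)[OF w])
            fix x' assume "x' < W"
            \<comment> \<open>Cells of different columns differ modulo \<open>W\<close>, so writing
              column \<open>y\<close> leaves the finished columns alone.\<close>
            have "(x * W + y') mod W = y'" "(x' * W + y) mod W = y" using y' y by auto
            then have "x * W + y' \<noteq> x' * W + y" using False by metis
            then show "?D + (x * W + y') \<noteq> ?D + y + W * x'" by (simp add: algebra_simps)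
          qed
          also have "\<dots> = ?c x y'" using g1(2) x y' False by (metis less_SucE)
          finally show ?thesis .
        qed
        ultimately show "?J (Suc y) g" by blast
      qed
    qed
  qed (use env L_bounds in auto)
  have 3: "triple \<rho> (?J W) ?Add
      ?addtime \<rho> (gram_inv (Suc v))"
  proof (rule triple_ghost)
    fix g1 assume g1: "ring_ok g1" "?J W g1"
    have old: "g1 p = g0 p" if "p < ?C" for p using g1(2) that by blast
    have split: "\<exists>x<W. \<exists>y<W. p = x * W + y" if "p < W * W" for p
    proof -
      have "p div W < W" using that by (simp add: less_mult_imp_div_less)
      moreover have "p mod W < W" using that by (cases "W = 0") auto
      moreover have "p = p div W * W + p mod W" by (rule div_mult_mod_eq[symmetric])
      ultimately show ?thesis by blast
    qed
    have src: "g1 (?B + (x * W + y)) = gram v x y" "g1 (?D + (x * W + y)) = ?c x y"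
      if "x < W" "y < W" for x y
      using old[of "?B + (x * W + y)"] less[OF that] inv(3)[OF that] g1(2) that by auto
    have "triple \<rho> (\<lambda>g. g = g1) ?Add
      ?addtime \<rho>
      (writes g1 (\<lambda>i. ?B + i) (W * W) (\<lambda>i. g1 (?B + i) \<oplus> g1 (?D + i)))"
    proof (rule triple_add[where z = "(?z + b + 1 + k) + b + 1 + k"])
      fix p assume "p < W * W"
      then obtain x y where xy: "x < W" "y < W" "p = x * W + y" using split by blast
      show "sz (g1 (?B + p)) \<le> (?z + b + 1 + k) + b + 1 + k"
        using src(1)[OF xy(1,2)] inv(4)[OF xy(1,2)] xy(3) by simp
      show "sz (g1 (?D + p)) \<le> (?z + b + 1 + k) + b + 1 + k"
        using src(2)[OF xy(1,2)] csize[OF xy(1,2)] xy(3) by simp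
    qed (use env g1 z L_bounds in auto)
    then show "triple \<rho> (\<lambda>g. g = g1) ?Add
      ?addtime \<rho> (gram_inv (Suc v))"
    proof (rule triple_conseq)
      fix g assume w: "writes g1 (\<lambda>i. ?B + i) (W * W) (\<lambda>i. g1 (?B + i) \<oplus> g1 (?D + i)) g"
      have "g (?B + (x * W + y)) = gram (Suc v) x y \<and> sz (gram (Suc v) x y) \<le> 1 + Suc v * (2 * (b + k + 1) + 1)"
        if xy: "x < W" "y < W" for x y
      proof
        show "g (?B + (x * W + y)) = gram (Suc v) x y"
          using writesD(1)[OF w less[OF xy]] src[OF xy] gram_Suc[OF xy env(6)] by simp
        have "sz (gram v x y \<oplus> ?c x y) \<le> max (sz (gram v x y)) (sz (?c x y)) + 1"
          using xy env(6) vecr by (intro sz_add) auto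
        then show "sz (gram (Suc v) x y) \<le> 1 + Suc v * (2 * (b + k + 1) + 1)"
          using gram_Suc[OF xy env(6)] inv(4)[OF xy] csize[OF xy] by simp
      qed
      moreover have "g acc = \<zero>" using writesD(2)[OF w, of acc] old[of acc] inv(2) by simp
      moreover have "inp g" by (rule inp_writes[OF inp_cong[OF inv(1) old] w]) simp_all
      ultimately show "gram_inv (Suc v) g" unfolding gram_inv_def by blast
    qed
  qed
  have start: "triple \<rho> (\<lambda>g. g = g0) (For 7 width gram_row)
      (Suc W * (row_time W k + for_weight 7 width)) \<rho> (?J 0)"
    by (rule triple_conseq[OF 1]) auto
  show "triple \<rho> (\<lambda>g. g = g0) gram_stage (gram_stage_time W k) \<rho> (gram_inv (Suc v))"
    unfolding gram_stage_def gram_stage_time_def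
    by (intro triple_Seq[OF start] triple_Seq[OF 2] 3)
qed

lemma triple_gram_prog:
  assumes Z: "2 + n * (2 * (b + k + 1) + 1) + s * s \<le> Z"
  shows "triple start_env start gram_prog (gram_time n k s W) main_env
    (\<lambda>g. g acc = (\<Oplus>A\<in>Pow {..<n}. top_sum (evec A) \<otimes> top_sum (evec A)))"
proof -
  note env = env_main main_env_counter
  let ?inner = "(For 7 (V 2) (RStore acc_addr (RAdd (RMem acc_addr) gram_entry)))"
  let ?itime = "(Suc s * (sum_weight acc_addr gram_entry + for_weight 7 (V 2)))"
  let ?otime = "(Suc s * (Suc s * (sum_weight acc_addr gram_entry + for_weight 7 (V 2)) + for_weight 3 (V 2)))"
  let ?result = "(\<lambda>g. g acc = (\<Oplus>A\<in>Pow {..<n}. top_sum (evec A) \<otimes> top_sum (evec A)))"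
  have init: "triple main_env start gram_init (gram_init_time s) main_env (gram_inv 0)"
    using Z by (intro triple_gram_init) (auto simp: env)
  have loop: "triple main_env (gram_inv 0) (For 6 (V 0) gram_stage)
      (Suc n * (gram_stage_time W k + for_weight 6 (V 0))) main_env (gram_inv n)"
  proof (rule triple_For)
    fix v assume "v < n"
    then show "triple (main_env(6 := v)) (gram_inv v) gram_stage (gram_stage_time W k)
        (main_env(6 := v)) (gram_inv (Suc v))"
      using Z by (intro triple_gram_stage) (simp_all add: env)
  qed (use env L_bounds in \<open>auto simp: envD\<close>)
  have final: "triple main_env (gram_inv n)
      (For 3 (V 2) ?inner)
      ?otime
      main_env ?result"
  proof (rule triple_ghost)
    fix g0 assume g0: "ring_ok g0" "gram_inv n g0"
    let ?z = "1 + n * (2 * (b + k + 1) + 1)"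
    let ?row = "\<lambda>i. \<Oplus>j\<in>{..<s}. gram n (full i) (full j)"
    let ?p = "\<lambda>i. \<Oplus>i'\<in>{..<i}. ?row i'"
    \<comment> \<open>Every outer round performs \<open>s\<close> additions on the same accumulator,
      hence \<open>i * s\<close> extra bits after \<open>i\<close> rounds.\<close>
    let ?I = "\<lambda>i g. g = g0(acc := ?p i) \<and> sz (?p i) \<le> ?z + i * s"
    have g0': "g0 acc = \<zero>" "\<And>i j. i < s \<Longrightarrow> j < s \<Longrightarrow> g0 (acc + 2 + (full i * W + full j)) = gram n (full i) (full j)"
      "\<And>i j. i < s \<Longrightarrow> j < s \<Longrightarrow> sz (gram n (full i) (full j)) \<le> ?z"
      using g0(2) by (auto simp: gram_inv_def)
    have row: "?row i \<in> carrier R" if "i < s" for i using that by (intro finsum_closed) auto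
    have p: "?p i \<in> carrier R" if "i \<le> s" for i using that row by (intro finsum_closed) auto
    have "triple main_env (?I 0)
      (For 3 (V 2) ?inner)
      ?otime
      main_env (?I s)"
    proof (rule triple_For)
      fix i assume i: "i < s"
      have Suc: "?p i \<oplus> ?row i = ?p (Suc i)" using row i by (intro finsum_lessThan_Suc[symmetric]) auto
      let ?\<rho> = "main_env(3 := i)"
      show "triple ?\<rho> (?I i) ?inner
        ?itime ?\<rho> (?I (Suc i))"
      proof (rule triple_ghost)
        fix g1 assume g1: "?I i g1"
        have "Suc i * s \<le> s * s" using i by (intro mult_le_mono1) simp
        then have z: "?z + i * s + s \<le> Z" using Z by simp
        have size: "sz (gram n (full i) (full j)) \<le> ?z + i * s" if "j < s" for j
          using g0'(3)[OF i that] by linarith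
        have "triple ?\<rho> (\<lambda>g. g = g0(acc := ?p i)) ?inner
          ?itime ?\<rho>
          (\<lambda>g. g = g0(acc := ?p i \<oplus> ?row i) \<and> sz (?p i \<oplus> ?row i) \<le> ?z + i * s + s)"
          by (rule triple_sum)
            (use env g0'(1,2) g1 z i p size L_bounds in \<open>auto simp: envD gram_entry_def\<close>)
        then show "triple ?\<rho> (\<lambda>g. g = g1) ?inner
          ?itime ?\<rho> (?I (Suc i))"
          unfolding Suc by (rule triple_conseq) (use g1 in auto)
      qed
    qed (use env L_bounds in \<open>auto simp: envD\<close>)
    then show "triple main_env (\<lambda>g. g = g0)
      (For 3 (V 2) ?inner)
      ?otime
      main_env ?result"
      unfolding top_sum_gram[symmetric]
      by (rule triple_conseq) (use g0'(1) sz_zero in auto)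
  qed
  show ?thesis
    unfolding gram_prog_def gram_time_def
    by (intro triple_Seq[OF triple_powers_main] triple_Seq[OF init] triple_Seq[OF loop] final)
qed

text \<open>Here, for the only time, the natural number memory depends on ring elements. The final
  memory is therefore stated in terms of \<open>Q\<close>, after the triple for \<open>P\<close> has
  been applied to the given input.\<close>

lemma decide:
  assumes "triple start_env start P A main_env (\<lambda>g. g acc = \<zero> \<longleftrightarrow> \<not> Q)"
    and "nat_ok start_env" "ring_ok g" "start g"
  shows "\<exists>t \<sigma>. exec R sz (Seq P decide_prog) (start_env, g) t \<sigma> \<and>
    t \<le> (A + decide_weight) * unit_time \<and> fst \<sigma> 0 = (if Q then 1 else 0)"
proof -
  obtain t g' where 1: "exec R sz P (start_env, g) t (main_env, g')" "t \<le> A * unit_time"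
    "nat_ok main_env" "ring_ok g'" "g' acc = \<zero> \<longleftrightarrow> \<not> Q"
    using tripleE[OF assms] .
  let ?\<rho> = "main_env(0 := if Q then 1 else 0)"
  have L: "(1 :: nat) < 2 ^ L" using L_bounds(4) by (metis le_less_trans one_le_numeral one_le_power)
  have "triple main_env (\<lambda>g. g = g') decide_prog decide_weight ?\<rho> (\<lambda>_. True)"
    unfolding decide_prog_def decide_weight_def
  proof (rule triple_If)
    show "triple main_env (\<lambda>g. g = g' \<and> bval R (RIsZero (RMem acc_addr)) (main_env, g))
        (NStore (NConst 0) (NConst 0)) (1 + nexp_weight (NConst 0) + nexp_weight (NConst 0)) ?\<rho> (\<lambda>_. True)"
    \<comment> \<open>If \<open>Q\<close> holds, the zero test contradicts the postcondition of
      \<open>P\<close> and the triple is vacuous; the other branch is symmetric.\<close>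
    proof (cases Q)
      case True
      then show ?thesis using 1(5) env_main by (simp add: triple_def)
    next
      case False
      then show ?thesis
        using triple_conseq[OF triple_NStore[of "NConst 0" main_env 0 "NConst 0" 0 "\<lambda>_. True"]] by simp
    qed
    show "triple main_env (\<lambda>g. g = g' \<and> \<not> bval R (RIsZero (RMem acc_addr)) (main_env, g))
        (NStore (NConst 0) (NConst 1)) (1 + nexp_weight (NConst 0) + nexp_weight (NConst 1)) ?\<rho> (\<lambda>_. True)"
    proof (cases Q)
      case False
      then show ?thesis using 1(5) env_main by (simp add: triple_def)
    next
      case True
      then show ?thesis
        using triple_conseq[OF triple_NStore[of "NConst 0" main_env 0 "NConst 1" 1 "\<lambda>_. True"]] L by simp
    qed
  qed
  then obtain t' g'' where 2: "exec R sz decide_prog (main_env, g') t' (?\<rho>, g'')" "t' \<le> decide_weight * unit_time"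
    using tripleE[OF _ 1(3,4)] by blast
  show ?thesis
    using exec.Seq[OF 1(1) 2(1)] add_le_unit_time[OF 1(2) 2(2)] by fastforce
qed

end

section \<open>A basis of the span of the coefficient vectors\<close>

text \<open>\<open>M\<^sub>v\<close> must be applied to the rows as they were before the stage,
  while insertion changes the working rows.\<close>

definition copy_prog :: com where
  "copy_prog = For 7 (NMul width width) (RStore (NAdd array2 (V 7)) (RMem (NAdd base (V 7))))"

definition candidate_prog :: com where
  "candidate_prog = step_prog array3 (NConst 1) (NAdd array2 (NMul (V 7) width))"

definition pivot :: rexp where
  "pivot = RMem (NAdd base (NAdd (NMul (V 8) width) (V 8)))"

definition row_addr :: nexp where
  "row_addr = NAdd base (NAdd (NMul (V 8) width) (V 5))"

definition cand_addr :: nexp where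
  "cand_addr = NAdd array3 (V 5)"

definition cand_pivot :: rexp where
  "cand_pivot = RMem (NAdd array3 (V 8))"

definition store_prog :: com where
  "store_prog = Seq (For 5 width (RStore row_addr (RMem cand_addr))) (For 5 width (RStore cand_addr RZero))"

definition eliminated :: rexp where
  "eliminated = RSub (RMul pivot (RMem cand_addr)) (RMul (RMem tmp_addr) (RMem row_addr))"

text \<open>Elimination without division: the ring of the machine has no inverses.\<close>

definition eliminate_prog :: com where
  "eliminate_prog = Seq (RStore tmp_addr cand_pivot) (For 5 width (RStore cand_addr eliminated))"

text \<open>One pass over the pivot columns. Once the candidate has been stored it is zero, so all
  later rounds take the \<open>Skip\<close> branch.\<close>

definition insert_prog :: com where
  "insert_prog = For 8 width (If (RIsZero cand_pivot) Skip (If (RIsZero pivot) store_prog eliminate_prog))"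

definition basis_stage :: com where
  "basis_stage = Seq copy_prog (For 7 width (Seq candidate_prog insert_prog))"

definition row_top :: rexp where
  "row_top = RMem (NAdd base (NAdd (NMul (V 7) width) (full_pos (V 3))))"

text \<open>The accumulator is only a flag here: in a finite field the values of several rows could
  cancel in a sum.\<close>

definition test_prog :: com where
  "test_prog = For 7 width (Seq (RStore tmp_addr RZero)
     (Seq (For 3 (V 2) (RStore tmp_addr (RAdd (RMem tmp_addr) row_top)))
       (If (RIsZero (RMem tmp_addr)) Skip (RStore acc_addr ROne))))"

definition basis_prog :: com where
  "basis_prog = Seq powers_prog (Seq init_prog (Seq (For 6 (V 0) basis_stage) test_prog))"

definition copy_time :: "nat \<Rightarrow> nat" where
  "copy_time w = Suc (w * w) * (1 + nexp_weight (NAdd array2 (V 7)) + rexp_weight (RMem (NAdd base (V 7))) +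
     for_weight 7 (NMul width width))"

definition candidate_time :: "nat \<Rightarrow> nat \<Rightarrow> nat" where
  "candidate_time w k = step_time array3 (NConst 1) (NAdd array2 (NMul (V 7) width)) w k"

definition store_time :: "nat \<Rightarrow> nat" where
  "store_time w = Suc w * (1 + nexp_weight row_addr + rexp_weight (RMem cand_addr) + for_weight 5 width) +
     Suc w * (1 + nexp_weight cand_addr + rexp_weight RZero + for_weight 5 width)"

definition eliminate_time :: "nat \<Rightarrow> nat" where
  "eliminate_time w = (1 + nexp_weight tmp_addr + rexp_weight cand_pivot) +
     Suc w * (1 + nexp_weight cand_addr + rexp_weight eliminated + for_weight 5 width)"

definition insert_time :: "nat \<Rightarrow> nat" where
  "insert_time w = Suc w * ((1 + bexp_weight (RIsZero cand_pivot) + (1 + (1 + bexp_weight (RIsZero pivot) +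
     (store_time w + eliminate_time w)))) + for_weight 8 width)"

definition basis_stage_time :: "nat \<Rightarrow> nat \<Rightarrow> nat" where
  "basis_stage_time w k = copy_time w + Suc w * ((candidate_time w k + insert_time w) + for_weight 7 width)"

definition test_time :: "nat \<Rightarrow> nat \<Rightarrow> nat" where
  "test_time s w = Suc w * (((1 + nexp_weight tmp_addr + rexp_weight RZero) +
     (Suc s * (sum_weight tmp_addr row_top + for_weight 3 (V 2)) +
      (1 + bexp_weight (RIsZero (RMem tmp_addr)) + (1 + (1 + nexp_weight acc_addr + rexp_weight ROne))))) +
     for_weight 7 width)"

definition basis_time :: "nat \<Rightarrow> nat \<Rightarrow> nat \<Rightarrow> nat \<Rightarrow> nat" where
  "basis_time n k s w = powers_time k + (Suc s * init_weight +
     (Suc n * (basis_stage_time w k + for_weight 6 (V 0)) + test_time s w))"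

text \<open>With \<open>size_zero\<close>, the size conditions on products of row entries hold
  trivially. The bound on \<open>Z\<close> supplies the slack that \<open>triple_step\<close> and
  \<open>triple_sum\<close> ask for.\<close>

locale unit_cost_circuit = circuit_machine + domain_circuit +
  assumes size_zero [simp]: "sz x = 0"
    and Z_bound: "b + 1 + k + s \<le> Z"
begin

text \<open>The value zero outside the array makes \<open>rows\<close> depend on the array cells
  alone, so that unchanged cells give equality of functions.\<close>

definition rows :: "(nat \<Rightarrow> 'a) \<Rightarrow> nat \<Rightarrow> nat \<Rightarrow> 'a" where
  "rows g q y = (if q < W \<and> y < W then g (acc + 2 + (q * W + y)) else \<zero>)"

definition cand :: "(nat \<Rightarrow> 'a) \<Rightarrow> nat \<Rightarrow> 'a" where
  "cand g y = (if y < W then g (acc + 2 + W * W + W * W + y) else \<zero>)"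

lemma less_WW: "x < W \<Longrightarrow> y < W \<Longrightarrow> x * W + y < W * W"
  by (rule mult_add_less)

lemma rows_eqI: "(\<And>p. p < W * W \<Longrightarrow> g (acc + 2 + p) = g' (acc + 2 + p)) \<Longrightarrow> rows g = rows g'"
  by (simp add: rows_def fun_eq_iff less_WW)

lemma vec_rows: "ring_ok g \<Longrightarrow> vec (rows g q)"
  by (simp add: vec_def rows_def ring_okD)

lemma vec_cand: "ring_ok g \<Longrightarrow> vec (cand g)"
  by (simp add: vec_def cand_def ring_okD)

text \<open>Equality of the spans of the rows together with the candidate, in terms of functionals.
  Storing and eliminating both preserve it.\<close>

definition span_eq :: "(nat \<Rightarrow> 'a) \<Rightarrow> (nat \<Rightarrow> 'a) \<Rightarrow> bool" where
  "span_eq g g' \<longleftrightarrow> (\<forall>\<psi>. linear_functional \<psi> \<longrightarrow>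
     (annihilates \<psi> (rows g) \<and> \<psi> (cand g) = \<zero> \<longleftrightarrow> annihilates \<psi> (rows g') \<and> \<psi> (cand g') = \<zero>))"

lemma span_eq_trans: "span_eq g g' \<Longrightarrow> span_eq g' g'' \<Longrightarrow> span_eq g g''"
  by (simp add: span_eq_def)

text \<open>Protected are the input, the accumulator and the copy of the rows; the scratch cell
  behind the accumulator, the rows and the candidate may change.\<close>

definition frame_eq :: "(nat \<Rightarrow> 'a) \<Rightarrow> (nat \<Rightarrow> 'a) \<Rightarrow> bool" where
  "frame_eq g g' \<longleftrightarrow> (\<forall>p. p \<le> acc \<or> (acc + 2 + W * W \<le> p \<and> p < acc + 2 + W * W + W * W) \<longrightarrow> g p = g' p)"

lemma frame_eq_trans: "frame_eq g g' \<Longrightarrow> frame_eq g' g'' \<Longrightarrow> frame_eq g g''"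
  by (simp add: frame_eq_def)

text \<open>At \<open>q = W\<close> the candidate has become zero, so the rows alone carry the span
  of the old rows and the old candidate.\<close>

definition insert_inv :: "(nat \<Rightarrow> 'a) \<Rightarrow> nat \<Rightarrow> (nat \<Rightarrow> 'a) \<Rightarrow> bool" where
  "insert_inv g0 q g \<longleftrightarrow> frame_eq g g0 \<and> span_eq g g0 \<and> reduced (rows g) \<and> (\<forall>y<q. cand g y = \<zero>)"

lemma triple_store:
  assumes env: "env \<rho>" "\<rho> 5 = 0" "\<rho> 8 = q" "q < W"
    and g1: "ring_ok g1" "insert_inv g0 q g1" "cand g1 q \<noteq> \<zero>" "rows g1 q q = \<zero>"
  shows "triple \<rho> (\<lambda>g. g = g1) store_prog (store_time W) \<rho> (insert_inv g0 (Suc q))"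
proof -
  let ?P = "(For 5 width (RStore cand_addr RZero))"
  let ?T = "(Suc W * (1 + nexp_weight cand_addr + rexp_weight RZero + for_weight 5 width))"
  let ?B = "acc + 2" and ?D = "acc + 2 + W * W + W * W"
  have less: "q * W + y < W * W" if "y < W" for y using env(4) that by (rule less_WW)
  let ?d = "\<lambda>y. ?B + (q * W + y)" and ?e = "\<lambda>y. ?D + y"
  have 1: "triple \<rho> (\<lambda>g. g = g1) (For 5 width (RStore row_addr (RMem cand_addr)))
      (Suc W * (1 + nexp_weight row_addr + rexp_weight (RMem cand_addr) + for_weight 5 width)) \<rho>
      (writes g1 ?d W (cand g1))"
  proof (rule triple_map)
    fix i g assume i: "i < W" and w: "writes g1 ?d i (cand g1) g"
    have "g (?D + i) = g1 (?D + i)"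
    proof (rule writesD(2)[OF w])
      fix y assume "y < i"
      then show "?D + i \<noteq> ?d y" using less[of y] i by simp
    qed
    then show "rval R (RMem cand_addr) (\<rho>(5 := i), g) = cand g1 i \<and> sz (cand g1 i) \<le> Z"
      using env i by (simp add: cand_addr_def cand_def)
  qed (use env L_bounds in \<open>auto simp: row_addr_def inj_on_def\<close>)
  have 2: "triple \<rho> (writes g1 ?d W (cand g1)) ?P
      ?T \<rho> (insert_inv g0 (Suc q))"
  proof (rule triple_ghost)
    fix g2 assume g2: "ring_ok g2" and w: "writes g1 ?d W (cand g1) g2"
    have "triple \<rho> (\<lambda>g. g = g2) ?P
        ?T \<rho>
        (writes g2 ?e W (\<lambda>_. \<zero>))"
      by (rule triple_map) (use env L_bounds in \<open>auto simp: cand_addr_def inj_on_def\<close>)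
    then show "triple \<rho> (\<lambda>g. g = g2) ?P
        ?T \<rho> (insert_inv g0 (Suc q))"
    proof (rule triple_conseq)
      fix g3 assume w2: "writes g2 ?e W (\<lambda>_. \<zero>) g3"
      have cand: "cand g3 y = \<zero>" for y
        using writesD(1)[OF w2, of y] by (simp add: cand_def)
      have rows: "rows g3 p y = (if p = q then cand g1 y else rows g1 p y)" if py: "p < W" "y < W" for p y
      proof -
        have "g3 (?B + (p * W + y)) = g2 (?B + (p * W + y))"
          by (rule writesD(2)[OF w2]) (use less_WW[OF py] in simp)
        also have "\<dots> = (if p = q then cand g1 y else g1 (?B + (p * W + y)))"
        proof (cases "p = q")
          case True
          then show ?thesis using writesD(1)[OF w py(2)] by simp
        next
          case False
          have "g2 (?B + (p * W + y)) = g1 (?B + (p * W + y))"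
          proof (rule writesD(2)[OF w])
            fix y' assume "y' < W"
            then have "(p * W + y) div W = p" "(q * W + y') div W = q" using py by auto
            then show "?B + (p * W + y) \<noteq> ?d y'" using False by auto
          qed
          then show ?thesis using False by simp
        qed
        finally show ?thesis using py by (simp add: rows_def)
      qed
      have "frame_eq g3 g1"
        unfolding frame_eq_def
      proof (intro allI impI)
        fix p assume p: "p \<le> acc \<or> (?B + W * W \<le> p \<and> p < ?D)"
        have "g3 p = g2 p" by (rule writesD(2)[OF w2]) (use p in auto)
        also have "g2 p = g1 p"
        proof (rule writesD(2)[OF w])
          fix y assume "y < W"
          then show "p \<noteq> ?d y" using p less[of y] by auto
        qed
        finally show "g3 p = g1 p" .
      qed
      moreover have "span_eq g3 g1"
        unfolding span_eq_def
        by (intro allI impI annihilates_store[where q = q])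
          (use g1 env(4) cand rows vec_cand vec_rows in \<open>auto simp: insert_inv_def\<close>)
      moreover have "reduced (rows g3)"
        by (rule reduced_store[where r = "rows g1" and x = "cand g1", OF _ env(4) g1(3)])
          (use g1(2) rows in \<open>simp_all add: insert_inv_def\<close>)
      ultimately show "insert_inv g0 (Suc q) g3"
        using g1(2) frame_eq_trans span_eq_trans cand unfolding insert_inv_def by blast
    qed
  qed
  show ?thesis unfolding store_prog_def store_time_def by (rule triple_Seq[OF 1 2])
qed

lemma triple_eliminate:
  assumes env: "env \<rho>" "\<rho> 5 = 0" "\<rho> 8 = q" "q < W"
    and g1: "ring_ok g1" "insert_inv g0 q g1" "rows g1 q q \<noteq> \<zero>"
  shows "triple \<rho> (\<lambda>g. g = g1) eliminate_prog (eliminate_time W) \<rho> (insert_inv g0 (Suc q))"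
proof -
  let ?B = "acc + 2" and ?D = "acc + 2 + W * W + W * W"
  have less: "q * W + y < W * W" if "y < W" for y using env(4) that by (rule less_WW)
  \<comment> \<open>The multiplier is saved in the scratch cell because round \<open>q\<close>
    overwrites \<open>cand g1 q\<close>, which the later rounds still use.\<close>
  let ?g2 = "g1(Suc acc := cand g1 q)" and ?e = "\<lambda>y. ?D + y"
  let ?h = "\<lambda>y. rows g1 q q \<otimes> cand g1 y \<ominus> cand g1 q \<otimes> rows g1 q y"
  have 1: "triple \<rho> (\<lambda>g. g = g1) (RStore tmp_addr cand_pivot)
      (1 + nexp_weight tmp_addr + rexp_weight cand_pivot) \<rho> (\<lambda>g. g = ?g2)"
    by (rule triple_RStore) (use env in \<open>auto simp: cand_pivot_def cand_def\<close>)
  have "triple \<rho> (\<lambda>g. g = ?g2) (For 5 width (RStore cand_addr eliminated))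
      (Suc W * (1 + nexp_weight cand_addr + rexp_weight eliminated + for_weight 5 width)) \<rho>
      (writes ?g2 ?e W ?h)"
  proof (rule triple_map)
    fix i g assume i: "i < W" and w: "writes ?g2 ?e i ?h g"
    have low: "g p = ?g2 p" if "p < ?D" for p
      by (rule writesD(2)[OF w]) (use that in simp)
    have "g (?D + i) = g1 (?D + i)" using writesD(2)[OF w, of "?D + i"] by simp
    moreover have "g (?B + (q * W + y)) = g1 (?B + (q * W + y))" if "y < W" for y
      using low[of "?B + (q * W + y)"] less[OF that] by simp
    moreover have "g (Suc acc) = cand g1 q" using low[of "Suc acc"] by simp
    ultimately show "rval R eliminated (\<rho>(5 := i), g) = ?h i \<and> sz (?h i) \<le> Z"
      using env i by (simp add: eliminated_def pivot_def cand_addr_def row_addr_def cand_def rows_def)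
  qed (use env L_bounds in \<open>auto simp: cand_addr_def inj_on_def\<close>)
  then have 2: "triple \<rho> (\<lambda>g. g = ?g2) (For 5 width (RStore cand_addr eliminated))
      (Suc W * (1 + nexp_weight cand_addr + rexp_weight eliminated + for_weight 5 width)) \<rho>
      (insert_inv g0 (Suc q))"
  proof (rule triple_conseq)
    fix g3 assume w: "writes ?g2 ?e W ?h g3"
    have low: "g3 p = g1 p" if "p < ?D" "p \<noteq> Suc acc" for p
    proof -
      have "g3 p = ?g2 p" by (rule writesD(2)[OF w]) (use that in simp)
      then show ?thesis using that by simp
    qed
    have rows: "rows g3 = rows g1" by (rule rows_eqI) (simp add: low)
    have cand: "cand g3 y = ?h y" if "y < W" for y
      using writesD(1)[OF w that] that by (simp add: cand_def)
    have c: "cand g1 y \<in> carrier R" "rows g1 p y \<in> carrier R" for p y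
      using ring_okD(1)[OF g1(1)] by (simp_all add: cand_def rows_def)
    have "frame_eq g3 g1" unfolding frame_eq_def using low by auto
    moreover have "span_eq g3 g1"
      unfolding span_eq_def rows
      by (intro allI impI annihilates_eliminate[where q = q and d = "cand g1 q"])
        (use g1 env(4) cand c vec_cand vec_rows in auto)
    \<comment> \<open>Column \<open>q\<close> cancels by commutativity; to the left of it the
      candidate and row \<open>q\<close> are zero already.\<close>
    moreover have "cand g3 y = \<zero>" if y: "y < Suc q" for y
    proof (cases "y = q")
      case True
      then show ?thesis using cand[OF env(4)] c m_comm[OF c(1)[of q] c(2)[of q q]] by simp
    next
      case False
      then have "cand g1 y = \<zero>" "rows g1 q y = \<zero>"
        using g1(2) y env(4) by (auto simp: insert_inv_def reduced_def)
      then show ?thesis using cand[of y] y env(4) c by (simp add: a_minus_def)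
    qed
    ultimately show "insert_inv g0 (Suc q) g3"
      using g1(2) frame_eq_trans span_eq_trans rows unfolding insert_inv_def by metis
  qed simp
  show ?thesis unfolding eliminate_prog_def eliminate_time_def by (rule triple_Seq[OF 1 2])
qed

lemma triple_insert:
  assumes env: "env \<rho>" "\<rho> 5 = 0" "\<rho> 8 = 0" and g0: "reduced (rows g0)"
  shows "triple \<rho> (\<lambda>g. g = g0) insert_prog (insert_time W) \<rho> (insert_inv g0 W)"
proof -
  have "triple \<rho> (insert_inv g0 0) insert_prog (insert_time W) \<rho> (insert_inv g0 W)"
    unfolding insert_prog_def insert_time_def
  proof (rule triple_For)
    fix q assume q: "q < W"
    let ?\<rho> = "\<rho>(8 := q)"
    have env': "env ?\<rho>" "?\<rho> 5 = 0" "?\<rho> 8 = q" using env by simp_all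
    have bv: "bval R (RIsZero cand_pivot) (?\<rho>, g) \<longleftrightarrow> cand g q = \<zero>"
      "bval R (RIsZero pivot) (?\<rho>, g) \<longleftrightarrow> rows g q q = \<zero>" for g
      using env' q by (simp_all add: cand_pivot_def cand_def pivot_def rows_def)
    show "triple ?\<rho> (insert_inv g0 q) (If (RIsZero cand_pivot) Skip (If (RIsZero pivot) store_prog eliminate_prog))
       (1 + bexp_weight (RIsZero cand_pivot) + (1 + (1 + bexp_weight (RIsZero pivot) +
       (store_time W + eliminate_time W)))) ?\<rho> (insert_inv g0 (Suc q))"
    proof (intro triple_If)
      show "triple ?\<rho> (\<lambda>g. insert_inv g0 q g \<and> bval R (RIsZero cand_pivot) (?\<rho>, g)) Skip 1 ?\<rho> (insert_inv g0 (Suc q))"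
        unfolding bv by (rule triple_Skip) (auto simp: insert_inv_def less_Suc_eq)
      show "triple ?\<rho> (\<lambda>g. (insert_inv g0 q g \<and> \<not> bval R (RIsZero cand_pivot) (?\<rho>, g)) \<and>
          bval R (RIsZero pivot) (?\<rho>, g)) store_prog (store_time W) ?\<rho> (insert_inv g0 (Suc q))"
        unfolding bv by (rule triple_ghost) (use triple_store env' q in blast)
      show "triple ?\<rho> (\<lambda>g. (insert_inv g0 q g \<and> \<not> bval R (RIsZero cand_pivot) (?\<rho>, g)) \<and>
          \<not> bval R (RIsZero pivot) (?\<rho>, g)) eliminate_prog (eliminate_time W) ?\<rho> (insert_inv g0 (Suc q))"
        unfolding bv by (rule triple_ghost) (use triple_eliminate env' q in blast)
    qed
  qed (use env L_bounds in auto)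
  then show ?thesis
    by (rule triple_conseq) (use g0 in \<open>auto simp: insert_inv_def frame_eq_def span_eq_def\<close>)
qed

text \<open>The rows span the same space as the vectors of the subsets of \<open>{..<v}\<close>, in
  dual form. The quantifier over all functionals is what \<open>annihilates_stage\<close>
  consumes.\<close>

definition basis_inv :: "nat \<Rightarrow> (nat \<Rightarrow> 'a) \<Rightarrow> bool" where
  "basis_inv v g \<longleftrightarrow> inp g \<and> g acc = \<zero> \<and> reduced (rows g) \<and>
    (\<forall>\<psi>. linear_functional \<psi> \<longrightarrow> (annihilates \<psi> (rows g) \<longleftrightarrow> (\<forall>A\<subseteq>{..<v}. \<psi> (evec A) = \<zero>)))"

lemma triple_basis_stage:
  assumes env: "env \<rho>" "\<rho> 4 = 0" "\<rho> 5 = 0" "\<rho> 6 = v" "\<rho> 7 = 0" "\<rho> 8 = 0" "v < n"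
  shows "triple \<rho> (basis_inv v) basis_stage (basis_stage_time W k) \<rho> (basis_inv (Suc v))"
proof (rule triple_ghost)
  fix g0 assume g0: "ring_ok g0" "basis_inv v g0"
  let ?B = "acc + 2" and ?C = "acc + 2 + W * W" and ?D = "acc + 2 + W * W + W * W"
  let ?r = "rows g0"
  \<comment> \<open>The copy preserves the old rows \<open>?r\<close>, while the working rows come
    to represent the old span enlarged by the images of the first \<open>q\<close> old rows.\<close>
  let ?I = "\<lambda>q g. inp g \<and> g acc = \<zero> \<and> reduced (rows g) \<and>
    (\<forall>x<W. \<forall>y<W. g (?C + (x * W + y)) = ?r x y) \<and>
    (\<forall>\<psi>. linear_functional \<psi> \<longrightarrow> (annihilates \<psi> (rows g) \<longleftrightarrow>
       annihilates \<psi> ?r \<and> (\<forall>q'<q. \<psi> (step v (?r q')) = \<zero>)))"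
  have 1: "triple \<rho> (\<lambda>g. g = g0) copy_prog (copy_time W) \<rho> (?I 0)"
  proof -
    have "triple \<rho> (\<lambda>g. g = g0) copy_prog (copy_time W) \<rho> (writes g0 (\<lambda>p. ?C + p) (W * W) (\<lambda>p. g0 (?B + p)))"
      unfolding copy_prog_def copy_time_def
    proof (rule triple_map)
      fix p g assume p: "p < W * W" and w: "writes g0 (\<lambda>p. ?C + p) p (\<lambda>p. g0 (?B + p)) g"
      have "g (?B + p) = g0 (?B + p)" by (rule writesD(2)[OF w]) (use p in simp)
      then show "rval R (RMem (NAdd base (V 7))) (\<rho>(7 := p), g) = g0 (?B + p) \<and> sz (g0 (?B + p)) \<le> Z"
        using env by simp
    qed (use env L_bounds in \<open>auto simp: inj_on_def\<close>)
    then show ?thesis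
    proof (rule triple_conseq)
      fix g assume w: "writes g0 (\<lambda>p. ?C + p) (W * W) (\<lambda>p. g0 (?B + p)) g"
      have low: "g p = g0 p" if "p < ?C" for p
        by (rule writesD(2)[OF w]) (use that in simp)
      have "rows g = ?r" by (rule rows_eqI) (simp add: low)
      moreover have "inp g" by (rule inp_cong[of g0]) (use g0(2) low in \<open>auto simp: basis_inv_def\<close>)
      moreover have "g (?C + (x * W + y)) = ?r x y" if "x < W" "y < W" for x y
        using writesD(1)[OF w less_WW[OF that]] that by (simp add: rows_def)
      ultimately show "?I 0 g" using g0(2) low[of acc] by (simp add: basis_inv_def)
    qed
  qed
  have 2: "triple \<rho> (?I 0) (For 7 width (Seq candidate_prog insert_prog))
      (Suc W * ((candidate_time W k + insert_time W) + for_weight 7 width)) \<rho> (?I W)"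
  proof (rule triple_For)
    fix q assume q: "q < W"
    let ?\<rho> = "\<rho>(7 := q)"
    show "triple ?\<rho> (?I q) (Seq candidate_prog insert_prog) (candidate_time W k + insert_time W) ?\<rho> (?I (Suc q))"
    proof (rule triple_ghost)
      fix g1 assume g1: "ring_ok g1" "?I q g1"
      let ?w = "writes g1 (\<lambda>x. ?D + 1 * x) W (step v (\<lambda>x. g1 (?C + q * W + 1 * x)))"
      have src: "g1 (?C + q * W + 1 * y) = ?r q y" if "y < W" for y
        using g1(2) q that by (simp add: add.assoc)
      have a: "triple ?\<rho> (\<lambda>g. g = g1) candidate_prog (candidate_time W k) ?\<rho> ?w"
        unfolding candidate_prog_def candidate_time_def
      proof (rule triple_step[where z = 0])
        fix x y assume "x < W" "y < W"
        then show "?C + q * W + 1 * x \<noteq> ?D + 1 * y" using less_WW[OF q, of x] by simp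
      qed (use env g1 Z_bound in auto)
      have b: "triple ?\<rho> ?w insert_prog (insert_time W) ?\<rho> (?I (Suc q))"
      proof (rule triple_ghost)
        fix g2 assume g2: "ring_ok g2" and w: "?w g2"
        have low: "g2 p = g1 p" if "p < ?D" for p
          by (rule writesD(2)[OF w]) (use that in simp)
        have rows: "rows g2 = rows g1" by (rule rows_eqI) (simp add: low)
        have cand: "cand g2 y = step v (?r q) y" if y: "y < W" for y
        proof -
          have "step v (\<lambda>x. g1 (?C + q * W + 1 * x)) y = step v (?r q) y"
            by (rule step_cong[OF y env(7) vec_rows[OF g0(1)] src])
          then show ?thesis using writesD(1)[OF w y] y by (simp add: cand_def)
        qed
        have "reduced (rows g2)" using g1(2) rows by simp
        then have "triple ?\<rho> (\<lambda>g. g = g2) insert_prog (insert_time W) ?\<rho> (insert_inv g2 W)"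
          using env by (intro triple_insert) simp_all
        then show "triple ?\<rho> (\<lambda>g. g = g2) insert_prog (insert_time W) ?\<rho> (?I (Suc q))"
        proof (rule triple_conseq)
          fix g assume g: "ring_ok g" and inv: "insert_inv g2 W g"
          have fr: "g p = g1 p" if "p \<le> acc \<or> (?C \<le> p \<and> p < ?D)" for p
          proof -
            have "g p = g2 p" using inv that unfolding insert_inv_def frame_eq_def by blast
            also have "\<dots> = g1 p" by (rule low) (use that in auto)
            finally show ?thesis .
          qed
          have "annihilates \<psi> (rows g) \<longleftrightarrow> annihilates \<psi> ?r \<and> (\<forall>q'<Suc q. \<psi> (step v (?r q')) = \<zero>)"
            if \<psi>: "linear_functional \<psi>" for \<psi>
          proof -
            have "\<psi> (cand g) = \<zero>"
              by (rule linear_functional_zero[OF \<psi>]) (use inv in \<open>simp add: insert_inv_def\<close>)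
            moreover have "annihilates \<psi> (rows g) \<and> \<psi> (cand g) = \<zero> \<longleftrightarrow>
                annihilates \<psi> (rows g2) \<and> \<psi> (cand g2) = \<zero>"
              using inv \<psi> unfolding insert_inv_def span_eq_def by blast
            ultimately have "annihilates \<psi> (rows g) \<longleftrightarrow> annihilates \<psi> (rows g2) \<and> \<psi> (cand g2) = \<zero>"
              by simp
            also have "\<psi> (cand g2) = \<psi> (step v (?r q))"
              by (rule linear_functionalD(2)[OF \<psi> vec_cand[OF g2] cand])
            also have "annihilates \<psi> (rows g2) \<longleftrightarrow> annihilates \<psi> ?r \<and> (\<forall>q'<q. \<psi> (step v (?r q')) = \<zero>)"
              unfolding rows using g1(2) \<psi> by blast
            finally show ?thesis by (auto simp: less_Suc_eq)
          qed
          moreover have "inp g" by (rule inp_cong[of g1]) (use g1(2) fr in auto)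
          moreover have "g (?C + (x * W + y)) = ?r x y" if "x < W" "y < W" for x y
            using fr[of "?C + (x * W + y)"] less_WW[OF that] g1(2) that by simp
          moreover have "reduced (rows g)" using inv by (simp add: insert_inv_def)
          ultimately show "?I (Suc q) g" using fr[of acc] g1(2) by simp
        qed
      qed
      show "triple ?\<rho> (\<lambda>g. g = g1) (Seq candidate_prog insert_prog) (candidate_time W k + insert_time W) ?\<rho> (?I (Suc q))"
        by (rule triple_Seq[OF a b])
    qed
  qed (use env L_bounds in auto)
  have "triple \<rho> (\<lambda>g. g = g0) basis_stage (basis_stage_time W k) \<rho> (?I W)"
    unfolding basis_stage_def basis_stage_time_def by (rule triple_Seq[OF 1 2])
  then show "triple \<rho> (\<lambda>g. g = g0) basis_stage (basis_stage_time W k) \<rho> (basis_inv (Suc v))"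
  proof (rule triple_conseq)
    fix g assume I: "?I W g"
    have "annihilates \<psi> (rows g) \<longleftrightarrow> (\<forall>A\<subseteq>{..<Suc v}. \<psi> (evec A) = \<zero>)" if \<psi>: "linear_functional \<psi>" for \<psi>
    proof (rule annihilates_stage[OF \<psi> env(7)])
      show "vec (?r q)" for q by (rule vec_rows[OF g0(1)])
      show "annihilates \<psi>' ?r \<longleftrightarrow> (\<forall>A\<subseteq>{..<v}. \<psi>' (evec A) = \<zero>)" if "linear_functional \<psi>'" for \<psi>'
        using g0(2) that unfolding basis_inv_def by blast
      show "annihilates \<psi> (rows g) \<longleftrightarrow> annihilates \<psi> ?r \<and> (\<forall>q<W. \<psi> (step v (?r q)) = \<zero>)"
        using I \<psi> by blast
    qed
    then show "basis_inv (Suc v) g" using I by (simp add: basis_inv_def)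
  qed
qed

lemma triple_basis_init:
  assumes "env \<rho>" "\<rho> 3 = 0"
  shows "triple \<rho> start init_prog (Suc s * init_weight) \<rho> (basis_inv 0)"
proof (rule triple_ghost)
  fix g0 assume "start g0"
  then have "triple \<rho> (\<lambda>g. g = g0) init_prog (Suc s * init_weight) \<rho>
    (\<lambda>g. inp g \<and> g acc = \<zero> \<and> (\<forall>x<W. g (acc + 2 + x) = evec {} x) \<and> (\<forall>y\<ge>acc + 2 + W. g y = \<zero>))"
    using assms Z_bound by (intro triple_init) auto
  then show "triple \<rho> (\<lambda>g. g = g0) init_prog (Suc s * init_weight) \<rho> (basis_inv 0)"
  proof (rule triple_conseq)
    fix g assume g: "ring_ok g" "inp g \<and> g acc = \<zero> \<and> (\<forall>x<W. g (acc + 2 + x) = evec {} x) \<and>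
      (\<forall>y\<ge>acc + 2 + W. g y = \<zero>)"
    have first: "rows g 0 y = evec {} y" if "y < W" for y using g(2) that by (simp add: rows_def)
    have rest: "rows g q y = \<zero>" if "0 < q" for q y
    proof -
      have "W \<le> q * W + y" using that by (cases q) auto
      then show ?thesis using g(2) by (simp add: rows_def)
    qed
    have "reduced (rows g)"
      unfolding reduced_def
    proof (intro allI impI)
      fix q assume q: "q < W"
      \<comment> \<open>Row \<open>0\<close> is the vector of the empty set, whose entry at position
        \<open>0\<close> is \<open>\<one>\<close>, a nonzero pivot; all other rows are empty
        slots.\<close>
      show "(\<forall>y<q. rows g q y = \<zero>) \<and> (rows g q q = \<zero> \<longrightarrow> (\<forall>y<W. rows g q y = \<zero>))"
        using q rest first evec_empty[of 0] by (cases "q = 0") auto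
    qed
    moreover have "annihilates \<psi> (rows g) \<longleftrightarrow> \<psi> (evec {}) = \<zero>" if \<psi>: "linear_functional \<psi>" for \<psi>
    \<comment> \<open>Without positions there is no row \<open>0\<close>, but then every functional
      vanishes on every vector.\<close>
    proof (cases "W = 0")
      case True
      then show ?thesis using linear_functional_zero[OF \<psi>, of "evec {}"] by (simp add: annihilates_def)
    next
      case False
      have "\<psi> (rows g 0) = \<psi> (evec {})"
        by (rule linear_functionalD(2)[OF \<psi> vec_rows[OF g(1)] first])
      moreover have "\<psi> (rows g q) = \<zero>" if "0 < q" for q
        by (rule linear_functional_zero[OF \<psi> rest[OF that]])
      ultimately show ?thesis using False unfolding annihilates_def by (metis neq0_conv)
    qed
    ultimately show "basis_inv 0 g" using g(2) by (simp add: basis_inv_def)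
  qed
qed

lemma triple_test:
  assumes env: "env \<rho>" "\<rho> 3 = 0" "\<rho> 7 = 0"
  shows "triple \<rho> (basis_inv n) test_prog (test_time s W) \<rho>
    (\<lambda>g. g acc = \<zero> \<longleftrightarrow> \<not> has_multilinear_monomial R n k (circuit_poly R n k s a))"
proof (rule triple_ghost)
  fix g0 assume g0: "ring_ok g0" "basis_inv n g0"
  let ?sum = "(For 3 (V 2) (RStore tmp_addr (RAdd (RMem tmp_addr) row_top)))"
  let ?stime = "(Suc s * (sum_weight tmp_addr row_top + for_weight 3 (V 2)))"
  let ?If = "(If (RIsZero (RMem tmp_addr)) Skip (RStore acc_addr ROne))"
  let ?itime = "(1 + bexp_weight (RIsZero (RMem tmp_addr)) + (1 + (1 + nexp_weight acc_addr + rexp_weight ROne)))"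
  let ?zero = "(1 + nexp_weight tmp_addr + rexp_weight RZero)"
  let ?J = "\<lambda>q g. (\<forall>p\<ge>acc + 2. g p = g0 p) \<and> (g acc = \<zero> \<longleftrightarrow> (\<forall>q'<q. top_sum (rows g0 q') = \<zero>))"
  have "triple \<rho> (?J 0) test_prog (test_time s W) \<rho> (?J W)"
    unfolding test_prog_def test_time_def
  proof (rule triple_For)
    fix q assume q: "q < W"
    let ?\<rho> = "\<rho>(7 := q)"
    have env': "env ?\<rho>" "?\<rho> 3 = 0" "?\<rho> 7 = q" using env by simp_all
    let ?c = "top_sum (rows g0 q)"
    let ?K = "\<lambda>g. (\<forall>p\<ge>acc + 2. g p = g0 p) \<and> (g acc = \<zero> \<longleftrightarrow> (\<forall>q'<q. top_sum (rows g0 q') = \<zero>)) \<and>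
      g (Suc acc) = ?c"
    have 1: "triple ?\<rho> (\<lambda>g. g = g1) (RStore tmp_addr RZero) ?zero ?\<rho>
        (\<lambda>g. g = g1(Suc acc := \<zero>))" for g1
      by (rule triple_RStore) (use env' in auto)
    have 2: "triple ?\<rho> (\<lambda>g. g = g1(Suc acc := \<zero>)) ?sum
        ?stime ?\<rho> ?K" if g1: "?J q g1" for g1
    proof -
      have "\<zero> \<oplus> (\<Oplus>i\<in>{..<s}. rows g0 q (full i)) = ?c"
        unfolding top_sum_def using vec_rows[OF g0(1)] by (intro l_zero finsum_closed) auto
      moreover have "triple ?\<rho> (\<lambda>g. g = g1(Suc acc := \<zero>)) ?sum
        ?stime ?\<rho>
        (\<lambda>g. g = g1(Suc acc := \<zero> \<oplus> (\<Oplus>i\<in>{..<s}. rows g0 q (full i))) \<and>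
          sz (\<zero> \<oplus> (\<Oplus>i\<in>{..<s}. rows g0 q (full i))) \<le> 0 + s)"
        by (rule triple_sum)
          (use env conjunct1[OF g1] q Z_bound L_bounds(3) ring_okD(1)[OF g0(1)] in \<open>auto simp: envD row_top_def rows_def less_WW\<close>)
      ultimately show ?thesis
        by (elim triple_conseq) (use g1 in auto)
    qed
    have 3: "triple ?\<rho> ?K ?If
        ?itime ?\<rho> (?J (Suc q))"
    proof (rule triple_If)
      show "triple ?\<rho> (\<lambda>g. ?K g \<and> bval R (RIsZero (RMem tmp_addr)) (?\<rho>, g)) Skip 1 ?\<rho> (?J (Suc q))"
        using env' by (intro triple_Skip) (auto simp: less_Suc_eq)
      show "triple ?\<rho> (\<lambda>g. ?K g \<and> \<not> bval R (RIsZero (RMem tmp_addr)) (?\<rho>, g)) (RStore acc_addr ROne)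
          (1 + nexp_weight acc_addr + rexp_weight ROne) ?\<rho> (?J (Suc q))"
        using env' by (intro triple_RStore) (auto simp: less_Suc_eq)
    qed
    show "triple ?\<rho> (?J q) (Seq (RStore tmp_addr RZero)
     (Seq ?sum
       ?If))
     (?zero +
     (Suc s * (sum_weight tmp_addr row_top + for_weight 3 (V 2)) +
      ?itime))
      ?\<rho> (?J (Suc q))"
      by (rule triple_ghost, rule triple_Seq[OF 1], rule triple_Seq[OF 2 3])
  qed (use env L_bounds in auto)
  then show "triple \<rho> (\<lambda>g. g = g0) test_prog (test_time s W) \<rho>
    (\<lambda>g. g acc = \<zero> \<longleftrightarrow> \<not> has_multilinear_monomial R n k (circuit_poly R n k s a))"
  proof (rule triple_conseq)
    fix g assume "?J W g"
    then have "g acc = \<zero> \<longleftrightarrow> annihilates top_sum (rows g0)" by (simp add: annihilates_def)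
    \<comment> \<open>The invariant is used at the functional \<open>top_sum\<close>: checking the
      rows is as good as checking all exponentially many subsets.\<close>
    also have "\<dots> \<longleftrightarrow> (\<forall>A\<subseteq>{..<n}. top_sum (evec A) = \<zero>)"
      using g0(2) linear_functional_top_sum unfolding basis_inv_def by blast
    finally show "g acc = \<zero> \<longleftrightarrow> \<not> has_multilinear_monomial R n k (circuit_poly R n k s a)"
      unfolding has_multilinear_monomial_iff by blast
  qed (use g0(2) in \<open>simp add: basis_inv_def\<close>)
qed

lemma triple_basis_prog:
  "triple start_env start basis_prog (basis_time n k s W) main_env
    (\<lambda>g. g acc = \<zero> \<longleftrightarrow> \<not> has_multilinear_monomial R n k (circuit_poly R n k s a))"
proof -
  note env = env_main main_env_counter
  have init: "triple main_env start init_prog (Suc s * init_weight) main_env (basis_inv 0)"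
    by (intro triple_basis_init) (simp_all add: env)
  have loop: "triple main_env (basis_inv 0) (For 6 (V 0) basis_stage)
      (Suc n * (basis_stage_time W k + for_weight 6 (V 0))) main_env (basis_inv n)"
  proof (rule triple_For)
    fix v assume "v < n"
    then show "triple (main_env(6 := v)) (basis_inv v) basis_stage (basis_stage_time W k)
        (main_env(6 := v)) (basis_inv (Suc v))"
      by (intro triple_basis_stage) (simp_all add: env)
  qed (use env L_bounds in \<open>auto simp: envD\<close>)
  show ?thesis
    unfolding basis_prog_def basis_time_def
    by (intro triple_Seq[OF triple_powers_main] triple_Seq[OF init] triple_Seq[OF loop] triple_test)
      (simp_all add: env)
qed

end

section \<open>Running times\<close>

text \<open>This is \<open>O^*((2^q)^k)\<close> with constant and degree uniform in all parameters;
  \<open>b\<close> is the bit length of the coefficients. The \<open>+ 1\<close> keeps the base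
  positive, so that degrees may be raised.\<close>

definition time_class :: "nat \<Rightarrow> (nat \<Rightarrow> nat \<Rightarrow> nat \<Rightarrow> nat \<Rightarrow> nat) \<Rightarrow> bool" where
  "time_class q f \<longleftrightarrow> (\<exists>C d. \<forall>n k s b. f n k s b \<le> C * 2 ^ (q * k) * (n + k + s + b + 1) ^ d)"

lemma time_classI: "(\<And>n k s b. f n k s b \<le> C * 2 ^ (q * k) * (n + k + s + b + 1) ^ d) \<Longrightarrow> time_class q f"
  unfolding time_class_def by blast

lemma time_class_mono: "time_class q f \<Longrightarrow> q \<le> q' \<Longrightarrow> time_class q' f"
proof -
  assume "time_class q f" and q: "q \<le> q'"
  then obtain C d where C: "\<And>n k s b. f n k s b \<le> C * 2 ^ (q * k) * (n + k + s + b + 1) ^ d"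
    unfolding time_class_def by blast
  show ?thesis
  proof (rule time_classI)
    fix n k s b
    have "(2 :: nat) ^ (q * k) \<le> 2 ^ (q' * k)" using q by (intro power_increasing mult_le_mono1) auto
    then have "C * 2 ^ (q * k) * (n + k + s + b + 1) ^ d \<le> C * 2 ^ (q' * k) * (n + k + s + b + 1) ^ d"
      by (intro mult_le_mono) auto
    with C[of n k s b] show "f n k s b \<le> C * 2 ^ (q' * k) * (n + k + s + b + 1) ^ d" by linarith
  qed
qed

lemma time_class_const: "time_class q (\<lambda>_ _ _ _. c)"
  by (rule time_classI[where C = c and d = 0]) simp

lemma time_class_linear:
  assumes "\<And>n k s b. f n k s b \<le> n + k + s + b + 1"
  shows "time_class q f"
proof (rule time_classI[where C = 1 and d = 1])
  fix n k s b
  have "1 * (n + k + s + b + 1) \<le> 2 ^ (q * k) * (n + k + s + b + 1)" by (intro mult_le_mono1) simp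
  then show "f n k s b \<le> 1 * 2 ^ (q * k) * (n + k + s + b + 1) ^ 1" using assms[of n k s b] by simp
qed

lemma time_class_mult:
  assumes "time_class q f" "time_class q' g"
  shows "time_class (q + q') (\<lambda>n k s b. f n k s b * g n k s b)"
proof -
  obtain C d where C: "\<And>n k s b. f n k s b \<le> C * 2 ^ (q * k) * (n + k + s + b + 1) ^ d"
    using assms(1) unfolding time_class_def by blast
  obtain C' d' where C': "\<And>n k s b. g n k s b \<le> C' * 2 ^ (q' * k) * (n + k + s + b + 1) ^ d'"
    using assms(2) unfolding time_class_def by blast
  show ?thesis
  proof (rule time_classI[where C = "C * C'" and d = "d + d'"])
    fix n k s b
    show "f n k s b * g n k s b \<le> C * C' * 2 ^ ((q + q') * k) * (n + k + s + b + 1) ^ (d + d')"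
      using mult_le_mono[OF C[of n k s b] C'[of n k s b]]
      by (simp only: power_add distrib_left distrib_right mult_ac)
  qed
qed

lemma time_class_add:
  assumes "time_class q f" "time_class q g"
  shows "time_class q (\<lambda>n k s b. f n k s b + g n k s b)"
proof -
  obtain C d where C: "\<And>n k s b. f n k s b \<le> C * 2 ^ (q * k) * (n + k + s + b + 1) ^ d"
    using assms(1) unfolding time_class_def by blast
  obtain C' d' where C': "\<And>n k s b. g n k s b \<le> C' * 2 ^ (q * k) * (n + k + s + b + 1) ^ d'"
    using assms(2) unfolding time_class_def by blast
  show ?thesis
  proof (rule time_classI[where C = "C + C'" and d = "d + d'"])
    fix n k s b :: nat
    let ?X = "n + k + s + b + 1"
    have "?X ^ d \<le> ?X ^ (d + d')" "?X ^ d' \<le> ?X ^ (d + d')"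
      by (intro power_increasing; simp)+
    then have "C * 2 ^ (q * k) * ?X ^ d + C' * 2 ^ (q * k) * ?X ^ d' \<le>
        C * 2 ^ (q * k) * ?X ^ (d + d') + C' * 2 ^ (q * k) * ?X ^ (d + d')"
      by (intro add_mono mult_le_mono2)
    with C[of n k s b] C'[of n k s b]
    have "f n k s b + g n k s b \<le> C * 2 ^ (q * k) * ?X ^ (d + d') + C' * 2 ^ (q * k) * ?X ^ (d + d')"
      by linarith
    then show "f n k s b + g n k s b \<le> (C + C') * 2 ^ (q * k) * ?X ^ (d + d')"
      by (simp only: distrib_right)
  qed
qed

lemma time_class_poly_mult:
  "time_class 0 f \<Longrightarrow> time_class q g \<Longrightarrow> time_class q (\<lambda>n k s b. f n k s b * g n k s b)"
  using time_class_mult[of 0 f q g] by simp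

lemma time_class_Suc: "time_class q f \<Longrightarrow> time_class q (\<lambda>n k s b. Suc (f n k s b))"
  using time_class_add[OF _ time_class_const[of q 1], of f] by simp

lemma time_class_n: "time_class q (\<lambda>n k s b. n)"
  and time_class_k: "time_class q (\<lambda>n k s b. k)"
  and time_class_s: "time_class q (\<lambda>n k s b. s)"
  and time_class_b: "time_class q (\<lambda>n k s b. b)"
  by (rule time_class_linear; simp)+

lemma time_class_width: "time_class 1 (\<lambda>n k s b. s * 2 ^ k)"
proof -
  have "time_class 1 (\<lambda>n k s b. 2 ^ k)" by (rule time_classI[where C = 1 and d = 0]) simp
  then show ?thesis by (intro time_class_poly_mult time_class_s)
qed

lemmas time_class_intros = time_class_add time_class_Suc time_class_const time_class_n time_class_k
  time_class_s time_class_b time_class_width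

text \<open>Every loop over all positions contributes one factor \<open>2 ^ k\<close>.\<close>

lemma time_class_width_mult:
  "time_class 0 g \<Longrightarrow> time_class 1 (\<lambda>n k s b. Suc (s * 2 ^ k) * g n k s b)"
  "time_class 1 g \<Longrightarrow> time_class 2 (\<lambda>n k s b. Suc (s * 2 ^ k) * g n k s b)"
  "time_class 2 g \<Longrightarrow> time_class 3 (\<lambda>n k s b. Suc (s * 2 ^ k) * g n k s b)"
  using time_class_mult[OF time_class_Suc[OF time_class_width], of _ g]
  by (simp_all add: numeral_2_eq_2 numeral_3_eq_3)

section \<open>The exponents of the three programs\<close>

lemma time_class_step_time: "time_class 1 (\<lambda>n k s b. step_time d st e (s * 2 ^ k) k)"
  unfolding step_time_def
  by (intro time_class_width_mult time_class_poly_mult time_class_intros)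

lemma time_class_powers_time: "time_class q (\<lambda>n k s b. powers_time k)"
  unfolding powers_time_def by (intro time_class_poly_mult time_class_intros)

lemma time_class_sum_time: "time_class 1 (\<lambda>n k s b. sum_time n k s (s * 2 ^ k))"
proof -
  have "time_class 1 (\<lambda>n k s b. Suc (s * 2 ^ k) * c)" for c
    by (intro time_class_width_mult time_class_intros)
  then show ?thesis
    unfolding sum_time_def
    by (intro time_class_add time_class_powers_time time_class_step_time time_class_const
        time_class_poly_mult[of "\<lambda>n k s b. Suc n"] time_class_poly_mult[of "\<lambda>n k s b. Suc s"]
        time_class_Suc time_class_n time_class_s)
qed

lemma time_class_width_sq:
  "time_class 2 (\<lambda>n k s b. Suc (s * 2 ^ k * (s * 2 ^ k)) * c)"
proof -
  have "time_class (1 + 1) (\<lambda>n k s b. s * 2 ^ k * (s * 2 ^ k))"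
    by (intro time_class_mult time_class_width)
  from time_class_mult[OF time_class_Suc[OF this] time_class_const[of 0 c]]
  show ?thesis by (simp add: numeral_2_eq_2)
qed

lemma time_class_gram_time: "time_class 2 (\<lambda>n k s b. gram_time n k s (s * 2 ^ k))"
proof -
  have row: "time_class 2 (\<lambda>n k s b. Suc (s * 2 ^ k) * (step_time d st e (s * 2 ^ k) k + c))" for d st e c
    by (intro time_class_width_mult time_class_add time_class_step_time time_class_const)
  have "time_class 2 (\<lambda>n k s b. gram_stage_time (s * 2 ^ k) k)"
    unfolding gram_stage_time_def row_time_def column_time_def
    by (intro time_class_add row time_class_width_sq)
  moreover have "time_class 2 (\<lambda>n k s b. gram_init_time s)"
    unfolding gram_init_time_def by (intro time_class_poly_mult time_class_intros)
  ultimately show ?thesis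
    unfolding gram_time_def
    by (intro time_class_add time_class_powers_time time_class_const
        time_class_poly_mult[of "\<lambda>n k s b. Suc n"] time_class_poly_mult[of "\<lambda>n k s b. Suc s"]
        time_class_Suc time_class_n time_class_s)
qed

text \<open>Three nested loops of length \<open>W\<close> dominate: over the candidates, over the
  pivots and over the entries of a row.\<close>

lemma time_class_basis_time: "time_class 3 (\<lambda>n k s b. basis_time n k s (s * 2 ^ k))"
proof -
  have w: "time_class 1 (\<lambda>n k s b. Suc (s * 2 ^ k) * c)" for c
    by (intro time_class_width_mult time_class_intros)
  have store: "time_class 1 (\<lambda>n k s b. store_time (s * 2 ^ k))"
    unfolding store_time_def by (intro time_class_add w)
  have eliminate: "time_class 1 (\<lambda>n k s b. eliminate_time (s * 2 ^ k))"
    unfolding eliminate_time_def by (intro time_class_add w time_class_const)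
  have insert: "time_class 2 (\<lambda>n k s b. insert_time (s * 2 ^ k))"
    unfolding insert_time_def
    by (intro time_class_width_mult time_class_add time_class_const store eliminate)
  have "time_class 2 (\<lambda>n k s b. candidate_time (s * 2 ^ k) k)"
    unfolding candidate_time_def by (rule time_class_mono[OF time_class_step_time]) simp
  then have "time_class 3 (\<lambda>n k s b. Suc (s * 2 ^ k) * (candidate_time (s * 2 ^ k) k + insert_time (s * 2 ^ k) + c))" for c
    by (intro time_class_width_mult time_class_add insert time_class_const)
  moreover have "time_class 3 (\<lambda>n k s b. copy_time (s * 2 ^ k))"
    unfolding copy_time_def by (rule time_class_mono[OF time_class_width_sq]) simp
  ultimately have stage: "time_class 3 (\<lambda>n k s b. basis_stage_time (s * 2 ^ k) k)"
    unfolding basis_stage_time_def by (intro time_class_add)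
  have "time_class 1 (\<lambda>n k s b. test_time s (s * 2 ^ k))"
    unfolding test_time_def
    by (intro time_class_width_mult time_class_add time_class_poly_mult[of "\<lambda>n k s b. Suc s"] time_class_intros)
  then have "time_class 3 (\<lambda>n k s b. test_time s (s * 2 ^ k))"
    by (rule time_class_mono) simp
  with stage show ?thesis
    unfolding basis_time_def
    by (intro time_class_add time_class_powers_time time_class_const
        time_class_poly_mult[of "\<lambda>n k s b. Suc n"] time_class_poly_mult[of "\<lambda>n k s b. Suc s"]
        time_class_Suc time_class_n time_class_s)
qed

section \<open>Running the programs on the input\<close>

context circuit_machine
begin

lemma input_state_eq:
  "input_state R n k s a = (start_env, \<lambda>x. if x < s * k * n then a (x div (k * n)) (x div n mod k) (x mod n) else \<zero>)"
  by (simp add: input_state_def start_env_def)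

lemma input_ok:
  assumes "b \<le> Z" "1 \<le> Z"
  shows "nat_ok start_env" "ring_ok (snd (input_state R n k s a))" "start (snd (input_state R n k s a))"
proof -
  show "nat_ok start_env" using L_bounds by (simp add: nat_ok_def start_env_def)
  have index: "x div (k * n) < s" "x div n mod k < k" "x mod n < n" if "x < s * k * n" for x
    using that by (auto simp: less_mult_imp_div_less mult.assoc intro!: mod_less_divisor gr0I)
  have "a (x div (k * n)) (x div n mod k) (x mod n) \<in> carrier R" if "x < s * k * n" for x
    using circuit index[OF that] by (simp add: depth3_circuit_def)
  moreover have "sz (a (x div (k * n)) (x div n mod k) (x mod n)) \<le> Z" if "x < s * k * n" for x
    using coeff_size[OF index[OF that]] assms(1) by simp
  ultimately show "ring_ok (snd (input_state R n k s a))"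
    using sz_zero assms(2) by (auto simp: ring_ok_def input_state_eq)
  have "inp (snd (input_state R n k s a))"
    unfolding inp_def
  proof (intro allI impI)
    fix i j v assume ijv: "i < s" "j < k" "v < n"
    let ?x = "(i * k + j) * n + v"
    have "?x div n = i * k + j" using ijv by simp
    moreover from this have "?x div (k * n) = i"
      using ijv by (simp add: mult.commute[of k n] div_mult2_eq)
    moreover have "?x mod n = v" using ijv by simp
    moreover have "?x < s * k * n" using coeff_addr_less[OF ijv] by (simp add: acc_def)
    ultimately show "snd (input_state R n k s a) ?x = a i j v"
      using ijv by (simp add: input_state_eq)
  qed
  then show "start (snd (input_state R n k s a))"
    by (auto simp: start_def input_state_eq acc_def)
qed

lemma outputs_sum:
  assumes "1 + n * (b + k + 2) + s + b \<le> Z"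
  shows "outputs_sum_within R sz sum_prog n k s a (real (sum_time n k s W * unit_time))"
proof -
  have ok: "nat_ok start_env" "ring_ok (snd (input_state R n k s a))" "start (snd (input_state R n k s a))"
    using input_ok assms by simp_all
  have "triple start_env start sum_prog (sum_time n k s W) main_env
    (\<lambda>g. g 0 = multilinear_coeff_sum R n k (circuit_poly R n k s a))"
    using assms by (intro triple_sum_prog) simp
  from tripleE[OF this ok] obtain t g' where
    "exec R sz sum_prog (start_env, snd (input_state R n k s a)) t (main_env, g')"
    "t \<le> sum_time n k s W * unit_time" "g' 0 = multilinear_coeff_sum R n k (circuit_poly R n k s a)" .
  then show ?thesis
    unfolding outputs_sum_within_def input_state_eq
    by (intro exI[of _ t] exI[of _ "(main_env, g')"]) (simp del: of_nat_mult)
qed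

lemma decides_monomial:
  assumes "triple start_env start P A main_env
      (\<lambda>g. g acc = \<zero> \<longleftrightarrow> \<not> has_multilinear_monomial R n k (circuit_poly R n k s a))"
    and "b \<le> Z" "1 \<le> Z"
  shows "decides_monomial_within R sz (Seq P decide_prog) n k s a (real ((A + decide_weight) * unit_time))"
proof -
  obtain t \<sigma> where "exec R sz (Seq P decide_prog) (start_env, snd (input_state R n k s a)) t \<sigma>"
    "t \<le> (A + decide_weight) * unit_time"
    "fst \<sigma> 0 = (if has_multilinear_monomial R n k (circuit_poly R n k s a) then 1 else 0)"
    using decide[OF assms(1) input_ok[OF assms(2,3)]] by (elim exE conjE) (rule that)
  then show ?thesis
    unfolding decides_monomial_within_def input_state_eq by (intro exI[of _ t] exI[of _ \<sigma>]) (simp del: of_nat_mult)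
qed

end

text \<open>Since \<open>s < 2 ^ s\<close>, both \<open>W < 2 ^ (s + k)\<close> and
  \<open>W * W < 2 ^ ((s + k) + (s + k))\<close>. The bound is linear in the parameters, so the
  logarithmic cost of addresses and counters is a polynomial factor.\<close>

definition L_bound :: "nat \<Rightarrow> nat \<Rightarrow> nat \<Rightarrow> nat" where
  "L_bound n k s = n + (s + k) + (s + k) + 1"

lemma circuit_machineI:
  assumes "sized_cring R sz" "depth3_circuit R n k s a"
    and "\<forall>i<s. \<forall>j<k. \<forall>v<n. sz (a i j v) \<le> b"
  shows "circuit_machine R sz (L_bound n k s) n k s a b"
proof -
  interpret sized_cring R sz by fact
  interpret circuit R n k s a by unfold_locales fact
  have pow: "(2 :: nat) ^ m \<le> 2 ^ L_bound n k s" if "m \<le> L_bound n k s" for m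
    using that by (intro power_increasing) auto
  have less: "m < 2 ^ L_bound n k s" if "m \<le> L_bound n k s" for m
    using less_exp[of m] pow[OF that] by (rule less_le_trans)
  have "s * 2 ^ k < 2 ^ s * 2 ^ k" by (simp add: less_exp)
  then have W: "W < 2 ^ (s + k)" by (simp add: W_def power_add)
  then have WW: "W * W < 2 ^ (s + k) * 2 ^ (s + k)" by (intro mult_strict_mono') auto
  show ?thesis
  proof
    show "i < s \<Longrightarrow> j < k \<Longrightarrow> v < n \<Longrightarrow> sz (a i j v) \<le> b" for i j v using assms(3) by blast
    show "n < 2 ^ L_bound n k s" "k < 2 ^ L_bound n k s" "s < 2 ^ L_bound n k s"
      by (rule less; simp add: L_bound_def)+
    show "(2 :: nat) ^ k < 2 ^ L_bound n k s"
      by (rule power_strict_increasing) (simp_all add: L_bound_def)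
    show "W < 2 ^ L_bound n k s" by (rule less_le_trans[OF W pow]) (simp add: L_bound_def)
    show "W * W < 2 ^ L_bound n k s"
      using WW unfolding power_add[symmetric] by (rule less_le_trans[OF _ pow]) (simp add: L_bound_def)
  qed
qed

section \<open>The two cost models\<close>

lemma sized_cring_unit_cost: "cring R \<Longrightarrow> sized_cring R (\<lambda>_. 0)"
  by (simp add: sized_cring_def sized_cring_axioms_def)

lemma int_bits_le_iff: "int_bits z \<le> m \<longleftrightarrow> \<bar>z\<bar> < 2 ^ m"
  by (simp add: int_bits_def floorlog2_le_iff nat_less_iff)

lemma abs_less_int_bits: "\<bar>z\<bar> < 2 ^ int_bits z"
  using int_bits_le_iff by blast

lemma int_bits_max: "\<bar>x\<bar> < 2 ^ max (int_bits x) (int_bits y)" "\<bar>y\<bar> < 2 ^ max (int_bits x) (int_bits y)"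
  by (simp_all flip: int_bits_le_iff)

lemma sized_cring_int_bits: "sized_cring \<Z> int_bits"
proof (intro sized_cring.intro sized_cring_axioms.intro int_is_cring)
  fix x y :: int
  show "int_bits (x \<oplus>\<^bsub>\<Z>\<^esub> y) \<le> max (int_bits x) (int_bits y) + 1"
    using int_bits_max(1)[of x y] int_bits_max(2)[of y x] by (simp add: int_bits_le_iff)
  show "int_bits (x \<ominus>\<^bsub>\<Z>\<^esub> y) \<le> max (int_bits x) (int_bits y) + 1"
    using int_bits_max(1)[of x y] int_bits_max(2)[of y x] by (simp add: int_bits_le_iff int_a_minus_eq)
  show "int_bits (x \<otimes>\<^bsub>\<Z>\<^esub> y) \<le> int_bits x + int_bits y"
    using abs_less_int_bits[of x] abs_less_int_bits[of y]
    by (simp add: int_bits_le_iff abs_mult power_add mult_strict_mono')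
qed (simp_all add: int_bits_def floorlog_def)

text \<open>The first factor is \<open>unit_time\<close> for the chosen \<open>L\<close> and
  \<open>Z\<close>; the separate summand \<open>b\<close> lets \<open>Z\<close> cover the
  coefficients in the input.\<close>

definition sum_total :: "nat \<Rightarrow> nat \<Rightarrow> nat \<Rightarrow> nat \<Rightarrow> nat" where
  "sum_total n k s b = (L_bound n k s + (1 + n * (b + k + 2) + s + b) + 1) * sum_time n k s (s * 2 ^ k)"

definition gram_total :: "nat \<Rightarrow> nat \<Rightarrow> nat \<Rightarrow> nat \<Rightarrow> nat" where
  "gram_total n k s b = (L_bound n k s + (2 + n * (2 * (b + k + 1) + 1) + s * s + b) + 1) *
     (gram_time n k s (s * 2 ^ k) + decide_weight)"

definition basis_total :: "nat \<Rightarrow> nat \<Rightarrow> nat \<Rightarrow> nat \<Rightarrow> nat" where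
  "basis_total n k s b = (L_bound n k s + (b + 1 + k + s) + 1) * (basis_time n k s (s * 2 ^ k) + decide_weight)"

lemma time_class_sum_total: "time_class 1 sum_total"
  unfolding sum_total_def[abs_def] L_bound_def
  by (intro time_class_poly_mult time_class_sum_time time_class_intros)

lemma time_class_gram_total: "time_class 2 gram_total"
  unfolding gram_total_def[abs_def] L_bound_def
  by (intro time_class_poly_mult time_class_gram_time time_class_intros)

lemma time_class_basis_total: "time_class 3 basis_total"
  unfolding basis_total_def[abs_def] L_bound_def
  by (intro time_class_poly_mult time_class_basis_time time_class_intros)

lemma sum_prog_correct:
  assumes "sized_cring R sz" "depth3_circuit R n k s a" "\<forall>i<s. \<forall>j<k. \<forall>v<n. sz (a i j v) \<le> b"
  shows "outputs_sum_within R sz sum_prog n k s a (real (sum_total n k s b))"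
proof -
  interpret circuit_machine R sz "L_bound n k s" "1 + n * (b + k + 2) + s + b" n k s a b
    by (rule circuit_machineI[OF assms])
  have eq: "sum_total n k s b = sum_time n k s W * unit_time"
    by (simp only: sum_total_def unit_time_def W_def mult.commute)
  show ?thesis unfolding eq by (rule outputs_sum) simp
qed

lemma gram_prog_correct:
  assumes "sized_cring \<Z> sz" "\<forall>i<s. \<forall>j<k. \<forall>v<n. sz (a i j v) \<le> b"
  shows "decides_monomial_within \<Z> sz (Seq gram_prog decide_prog) n k s a (real (gram_total n k s b))"
proof -
  interpret circuit_machine \<Z> sz "L_bound n k s" "2 + n * (2 * (b + k + 1) + 1) + s * s + b" n k s a b
    by (rule circuit_machineI[OF assms(1) _ assms(2)]) (simp add: depth3_circuit_def)
  \<comment> \<open>The order of the integers enters here: a sum of squares vanishes only if each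
    square does.\<close>
  have "(\<Sum>A\<in>Pow {..<n}. top_sum (evec A) * top_sum (evec A)) = 0 \<longleftrightarrow> (\<forall>A\<subseteq>{..<n}. top_sum (evec A) = 0)"
    by (subst sum_nonneg_eq_0_iff) auto
  then have iff: "(\<Sum>A\<in>Pow {..<n}. top_sum (evec A) * top_sum (evec A)) = 0 \<longleftrightarrow>
      \<not> has_multilinear_monomial \<Z> n k (circuit_poly \<Z> n k s a)"
    unfolding has_multilinear_monomial_iff by simp
  have "triple start_env start gram_prog (gram_time n k s W) main_env
      (\<lambda>g. g acc = 0 \<longleftrightarrow> \<not> has_multilinear_monomial \<Z> n k (circuit_poly \<Z> n k s a))"
    by (rule triple_conseq[OF triple_gram_prog]) (simp, assumption, simp only: iff)
  note * = decides_monomial[OF this]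
  have eq: "gram_total n k s b = (gram_time n k s W + decide_weight) * unit_time"
    by (simp only: gram_total_def unit_time_def W_def mult.commute)
  show ?thesis unfolding eq by (rule *) simp_all
qed

lemma (in unit_cost_circuit) decides_basis:
  "decides_monomial_within R sz (Seq basis_prog decide_prog) n k s a
     (real ((basis_time n k s W + decide_weight) * unit_time))"
  by (rule decides_monomial[OF triple_basis_prog]) (use Z_bound in auto)

lemma basis_prog_correct:
  assumes "field R" "depth3_circuit R n k s a"
  shows "decides_monomial_within R (\<lambda>_. 0) (Seq basis_prog decide_prog) n k s a (real (basis_total n k s 0))"
proof -
  let ?Z = "0 + 1 + k + s"
  have R: "cring R" "domain R" using assms(1) by (simp_all add: field_def domain_def)
  have m: "circuit_machine R (\<lambda>_. 0) (L_bound n k s) n k s a 0"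
    by (rule circuit_machineI[OF sized_cring_unit_cost[OF R(1)] assms(2)]) simp
  then have "unit_cost_circuit R (\<lambda>_. 0) (L_bound n k s) ?Z n k s a 0"
    using R(2)
    by (intro unit_cost_circuit.intro domain_circuit.intro unit_cost_circuit_axioms.intro)
      (simp_all add: circuit_machine_def)
  note * = unit_cost_circuit.decides_basis[OF this]
  have "bounded_machine R (\<lambda>_. 0)" "circuit R n k s a"
    using m by (simp_all add: circuit_machine_def)
  then have "basis_total n k s 0 = (basis_time n k s (circuit.W k s) + decide_weight) *
      bounded_machine.unit_time (L_bound n k s) ?Z"
    by (simp only: basis_total_def bounded_machine.unit_time_def circuit.W_def mult.commute)
  with * show ?thesis by simp
qed

lemma outputs_sum_within_mono: "outputs_sum_within R sz P n k s a T \<Longrightarrow> T \<le> T' \<Longrightarrow> outputs_sum_within R sz P n k s a T'"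
  unfolding outputs_sum_within_def by (meson order_trans)

lemma decides_monomial_within_mono:
  "decides_monomial_within R sz P n k s a T \<Longrightarrow> T \<le> T' \<Longrightarrow> decides_monomial_within R sz P n k s a T'"
  unfolding decides_monomial_within_def by (meson order_trans)

lemma time_class_real:
  assumes "time_class q f"
  obtains C d where "\<And>n k s b. real (f n k s b) \<le> real C * (2 ^ q) ^ k * real (n + k + s + b + 1) ^ d"
proof -
  obtain C d where C: "\<And>n k s b. f n k s b \<le> C * 2 ^ (q * k) * (n + k + s + b + 1) ^ d"
    using assms unfolding time_class_def by blast
  have "real (f n k s b) \<le> real C * (2 ^ q) ^ k * real (n + k + s + b + 1) ^ d" for n k s b
  proof -
    have "real (f n k s b) \<le> real (C * 2 ^ (q * k) * (n + k + s + b + 1) ^ d)"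
      using C by (simp only: of_nat_le_iff)
    then show ?thesis by (simp add: power_mult)
  qed
  then show thesis by (rule that)
qed

theorem theorem3:
  shows
    "(\<exists>(P :: com) (C :: nat) (d :: nat).
        (\<forall>(R :: 'a ring) n k s a. field R \<longrightarrow> depth3_circuit R n k s a \<longrightarrow>
           outputs_sum_within R (\<lambda>_. 0) P n k s a
             (real C * 2 ^ k * real (n + k + s + 1) ^ d)) \<and>
        (\<forall>n k s a.
           outputs_sum_within \<Z> (\<lambda>_. 0) P n k s a
             (real C * 2 ^ k * real (n + k + s + 1) ^ d) \<and>
           (\<forall>b. (\<forall>i<s. \<forall>j<k. \<forall>v<n. int_bits (a i j v) \<le> b) \<longrightarrow>
              outputs_sum_within \<Z> int_bits P n k s a
                (real C * 2 ^ k * real (n + k + s + b + 1) ^ d))))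
   \<and> (\<exists>(P :: com) (C :: nat) (d :: nat). \<forall>n k s a.
        decides_monomial_within \<Z> (\<lambda>_. 0) P n k s a
          (real C * 4 ^ k * real (n + k + s + 1) ^ d) \<and>
        (\<forall>b. (\<forall>i<s. \<forall>j<k. \<forall>v<n. int_bits (a i j v) \<le> b) \<longrightarrow>
           decides_monomial_within \<Z> int_bits P n k s a
             (real C * 4 ^ k * real (n + k + s + b + 1) ^ d)))
   \<and> (\<exists>(P :: com) (C :: nat) (d :: nat) (\<alpha> :: real) (c :: real). c \<le> 5 \<and>
        (\<forall>(R :: 'a ring) n k s a. field R \<longrightarrow> finite (carrier R) \<longrightarrow> depth3_circuit R n k s a \<longrightarrow>
           decides_monomial_within R (\<lambda>_. 0) P n k s a
             (real C * exp (real k) * real (max 1 k) powr (\<alpha> * log 2 (real (max 1 k))) *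
              (2 powr (c * real k) + 2 ^ k) * real (n + k + s + 1) ^ d)))"
  (is "?sum \<and> ?int \<and> ?field")
proof (intro conjI)
  have Z: "sized_cring \<Z> (\<lambda>_. 0)" "depth3_circuit \<Z> n k s a" for n k s a
    by (simp_all add: sized_cring_unit_cost int_is_cring depth3_circuit_def)
  show ?sum
  proof -
    obtain C d where C: "\<And>n k s b. real (sum_total n k s b) \<le> real C * 2 ^ k * real (n + k + s + b + 1) ^ d"
      using time_class_real[OF time_class_sum_total] by auto
    have C0: "real (sum_total n k s 0) \<le> real C * 2 ^ k * real (n + k + s + 1) ^ d" for n k s
      using C[of n k s 0] by simp
    have "outputs_sum_within R (\<lambda>_. 0) sum_prog n k s a (real C * 2 ^ k * real (n + k + s + 1) ^ d)"
      if "field R" "depth3_circuit R n k s a" for R :: "'a ring" and n k s a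
    proof -
      interpret field R by fact
      show ?thesis
        by (rule outputs_sum_within_mono[OF sum_prog_correct C0])
          (simp_all add: sized_cring_unit_cost is_cring that)
    qed
    moreover have "outputs_sum_within \<Z> (\<lambda>_. 0) sum_prog n k s a (real C * 2 ^ k * real (n + k + s + 1) ^ d)"
      for n k s a
      by (rule outputs_sum_within_mono[OF sum_prog_correct C0]) (simp_all add: Z)
    moreover have "outputs_sum_within \<Z> int_bits sum_prog n k s a (real C * 2 ^ k * real (n + k + s + b + 1) ^ d)"
      if "\<forall>i<s. \<forall>j<k. \<forall>v<n. int_bits (a i j v) \<le> b" for n k s a b
      by (rule outputs_sum_within_mono[OF sum_prog_correct[OF sized_cring_int_bits Z(2) that] C])
    ultimately show ?thesis by blast
  qed
  show ?int
  proof -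
    obtain C d where C: "\<And>n k s b. real (gram_total n k s b) \<le> real C * 4 ^ k * real (n + k + s + b + 1) ^ d"
      using time_class_real[OF time_class_gram_total] by auto
    have C0: "real (gram_total n k s 0) \<le> real C * 4 ^ k * real (n + k + s + 1) ^ d" for n k s
      using C[of n k s 0] by simp
    have "decides_monomial_within \<Z> (\<lambda>_. 0) (Seq gram_prog decide_prog) n k s a
        (real C * 4 ^ k * real (n + k + s + 1) ^ d)" for n k s a
      by (rule decides_monomial_within_mono[OF gram_prog_correct C0]) (simp_all add: Z)
    moreover have "decides_monomial_within \<Z> int_bits (Seq gram_prog decide_prog) n k s a
        (real C * 4 ^ k * real (n + k + s + b + 1) ^ d)"
      if "\<forall>i<s. \<forall>j<k. \<forall>v<n. int_bits (a i j v) \<le> b" for n k s a b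
      by (rule decides_monomial_within_mono[OF gram_prog_correct[OF sized_cring_int_bits that] C])
    ultimately show ?thesis by blast
  qed
  show ?field
  proof -
    obtain C d where C: "\<And>n k s b. real (basis_total n k s b) \<le> real C * (2 ^ 3) ^ k * real (n + k + s + b + 1) ^ d"
      using time_class_real[OF time_class_basis_total] by blast
    have le: "real (basis_total n k s 0) \<le>
        real C * exp (real k) * real (max 1 k) powr (0 * log 2 (real (max 1 k))) *
        (2 powr (5 * real k) + 2 ^ k) * real (n + k + s + 1) ^ d" for n k s
    proof -
      \<comment> \<open>The factor \<open>8 ^ k\<close> of the elimination fits below
        \<open>32 ^ k\<close>, which is \<open>2 powr (5 * k)\<close>.\<close>
      have "(2 ^ 3 :: real) ^ k \<le> (2 ^ 5) ^ k" by (intro power_mono) auto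
      also have "\<dots> = 2 powr real (5 * k)" by (simp only: powr_realpow power_mult zero_less_numeral)
      also have "\<dots> = 2 powr (5 * real k)" by simp
      finally have "(2 ^ 3 :: real) ^ k \<le> 2 powr (5 * real k) + 2 ^ k" by (simp add: add_increasing2)
      moreover have "1 \<le> exp (real k)" by simp
      ultimately have "1 * (2 ^ 3) ^ k \<le> exp (real k) * (2 powr (5 * real k) + 2 ^ k)"
        by (intro mult_mono) auto
      then have "real C * (2 ^ 3) ^ k * real (n + k + s + 1) ^ d \<le>
          real C * (exp (real k) * (2 powr (5 * real k) + 2 ^ k)) * real (n + k + s + 1) ^ d"
        by (intro mult_right_mono mult_left_mono) auto
      \<comment> \<open>With exponent zero the \<open>powr\<close> factor is one, because its base
        \<open>max 1 k\<close> is positive.\<close>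
      then show ?thesis using C[of n k s 0] by (simp add: mult.assoc)
    qed
    have "decides_monomial_within R (\<lambda>_. 0) (Seq basis_prog decide_prog) n k s a
        (real C * exp (real k) * real (max 1 k) powr (0 * log 2 (real (max 1 k))) *
        (2 powr (5 * real k) + 2 ^ k) * real (n + k + s + 1) ^ d)"
      if "field R" "depth3_circuit R n k s a" for R :: "'a ring" and n k s a
      by (rule decides_monomial_within_mono[OF basis_prog_correct[OF that] le])
    then show ?thesis by (intro exI[of _ "Seq basis_prog decide_prog"] exI[of _ C] exI[of _ d] exI[of _ 0] exI[of _ 5]) blast
  qed
qed

end
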